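(* Let $X_1,\dots,X_s$ be path-connected compact topological manifolds, each with a chosen base point, let $X=\bigvee_{i=1}^s X_i$, and let $f\colon X\to X$ be a continuous pointed map which is permutative and squared by blocks with associated permutation $\sigma$. Write $\sigma=\pi_1\cdots\pi_q$ as a product of disjoint cycles (including cycles of length one), let $\Lambda_j$ be the set of indices moved cyclically by $\pi_j$, and $s_j=\#\Lambda_j$. Then for every integer $m>1$, $$\ell(f^m)=\sum_{j=1}^q\mathbb{1}_{s_j}(m)\left(\sum_{i\in\Lambda_j}\ell(f^m_{ii})\right),$$ where $\mathbb{1}_{s_j}(m)=1$ if $m\equiv0\pmod{s_j}$ and $0$ otherwise; and $\ell(f)=L(f)$.
   Context: The wedge sum identifies all base points to one point $x_0$; $\iota_j\colon X_j\to X$ is the inclusion and $\nu_j\colon X\to X_j$ the projection collapsing all other summands to the base point. For a continuous $f\colon X\to X$ with $f(x_0)=x_0$, its coordinates are $f_{jk}=\nu_k\circ f\circ\iota_j$. $f$ is permutative with permutation $\sigma$ if $f_{jk}$ is constant equal to the base point whenever $k\ne\sigma(j)$; it is squared by blocks if, for each cycle of $\sigma$, the $X_j$ with $j$ in that cycle are pairwise homeomorphic. For $m\ge1$, $f^m_{ii}=\nu_i\circ f^m\circ\iota_i\colon X_i\to X_i$. For a self-map $g$ of a compact ENR, $L(g)=\sum_k(-1)^k\operatorname{trace}(g_{*k}\colon H_k(\cdot;\mathbb Q)\to H_k(\cdot;\mathbb Q))$ is its Lefschetz number. The Dold coefficients are $\ell(f^m)=\sum_{r\mid m}\mu(m/r)L(f^r)$,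 with $\mu$ the Möbius function, and for the coordinate maps $\ell(f^m_{ii})=\sum_{r\mid m}\mu(m/r)L(f^r_{ii})$. *)

theory Defs
  imports "HOL-Analysis.Analysis" "HOL-Homology.Homology" "HOL-Combinatorics.Orbits" "HOL-Combinatorics.Permutations"
          "HOL-Computational_Algebra.Squarefree"
begin

definition top_manifold :: "'a topology \<Rightarrow> bool" where
  "top_manifold X \<longleftrightarrow> Hausdorff_space X \<and> second_countable X \<and>
     (\<exists>n. \<forall>x\<in>topspace X. \<exists>U. openin X U \<and> x \<in> U \<and>
        (\<exists>V. openin (Euclidean_space n) V \<and>
             subtopology X U homeomorphic_space subtopology (Euclidean_space n) V))"

text \<open>The wedge of the spaces X 0, ..., X (s-1) with base points x0 i.
  Points: None is the common base point; Some (i,x) is a non-base point x of X i.\<close>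
definition wedge_incl :: "(nat \<Rightarrow> 'a) \<Rightarrow> nat \<Rightarrow> 'a \<Rightarrow> (nat \<times> 'a) option" where
  "wedge_incl x0 i x = (if x = x0 i then None else Some (i, x))"

definition wedge_proj :: "(nat \<Rightarrow> 'a) \<Rightarrow> nat \<Rightarrow> (nat \<times> 'a) option \<Rightarrow> 'a" where
  "wedge_proj x0 j p = (case p of None \<Rightarrow> x0 j
                          | Some (i, x) \<Rightarrow> (if i = j then x else x0 j))"

definition wedge_carrier :: "(nat \<Rightarrow> 'a topology) \<Rightarrow> (nat \<Rightarrow> 'a) \<Rightarrow> nat \<Rightarrow> (nat \<times> 'a) option set" where
  "wedge_carrier X x0 s =
     insert None {Some (i, x) | i x. i < s \<and> x \<in> topspace (X i) \<and> x \<noteq> x0 i}"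

text \<open>Quotient topology of the disjoint union: U is open iff each preimage under
  the inclusions is open.\<close>
definition wedge :: "(nat \<Rightarrow> 'a topology) \<Rightarrow> (nat \<Rightarrow> 'a) \<Rightarrow> nat \<Rightarrow> (nat \<times> 'a) option topology" where
  "wedge X x0 s = topology (\<lambda>U. U \<subseteq> wedge_carrier X x0 s \<and>
      (\<forall>i<s. openin (X i) {x \<in> topspace (X i). wedge_incl x0 i x \<in> U}))"

definition wedge_coord ::
  "(nat \<Rightarrow> 'a) \<Rightarrow> ((nat \<times> 'a) option \<Rightarrow> (nat \<times> 'a) option) \<Rightarrow> nat \<Rightarrow> nat \<Rightarrow> nat \<Rightarrow> 'a \<Rightarrow> 'a" where
  "wedge_coord x0 f m j k = (\<lambda>x. wedge_proj x0 k ((f ^^ m) (wedge_incl x0 j x)))"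

definition permutative ::
  "(nat \<Rightarrow> 'a topology) \<Rightarrow> (nat \<Rightarrow> 'a) \<Rightarrow> nat \<Rightarrow> ((nat \<times> 'a) option \<Rightarrow> (nat \<times> 'a) option)
     \<Rightarrow> (nat \<Rightarrow> nat) \<Rightarrow> bool" where
  "permutative X x0 s f \<sigma> \<longleftrightarrow> \<sigma> permutes {..<s} \<and>
     (\<forall>j<s. \<forall>k<s. k \<noteq> \<sigma> j \<longrightarrow> (\<forall>x\<in>topspace (X j). wedge_coord x0 f 1 j k x = x0 k))"

definition squared_by_blocks :: "(nat \<Rightarrow> 'a topology) \<Rightarrow> nat \<Rightarrow> (nat \<Rightarrow> nat) \<Rightarrow> bool" where
  "squared_by_blocks X s \<sigma> \<longleftrightarrow> (\<forall>j<s. \<forall>k\<in>orbit \<sigma> j. X j homeomorphic_space X k)"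

text \<open>H_k(Y;Q) = H_k(Y;Z) tensor Q (universal coefficients). For an abelian group G
  (written multiplicatively, as in HOL-Algebra) we express the trace of h tensor Q
  on G tensor Q using a family b of elements of G whose images form a Q-basis of
  G tensor Q.\<close>
definition zlc :: "('c, 'm) monoid_scheme \<Rightarrow> (nat \<Rightarrow> 'c) \<Rightarrow> (nat \<Rightarrow> int) \<Rightarrow> nat \<Rightarrow> 'c" where
  "zlc G b c r = finprod G (\<lambda>i. b i [^]\<^bsub>G\<^esub> c i) {..<r}"

definition torsion_el :: "('c, 'm) monoid_scheme \<Rightarrow> 'c \<Rightarrow> bool" where
  "torsion_el G x \<longleftrightarrow> x \<in> carrier G \<and> (\<exists>n::int. n \<noteq> 0 \<and> x [^]\<^bsub>G\<^esub> n = \<one>\<^bsub>G\<^esub>)"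

definition rational_basis :: "('c, 'm) monoid_scheme \<Rightarrow> (nat \<Rightarrow> 'c) \<Rightarrow> nat \<Rightarrow> bool" where
  "rational_basis G b r \<longleftrightarrow> (\<forall>i<r. b i \<in> carrier G) \<and>
     (\<forall>c. torsion_el G (zlc G b c r) \<longrightarrow> (\<forall>i<r. c i = 0)) \<and>
     (\<forall>g\<in>carrier G. \<exists>N::int. N \<noteq> 0 \<and>
        (\<exists>c. torsion_el G (g [^]\<^bsub>G\<^esub> N \<otimes>\<^bsub>G\<^esub> inv\<^bsub>G\<^esub> (zlc G b c r))))"

definition rat_trace :: "('c, 'm) monoid_scheme \<Rightarrow> ('c \<Rightarrow> 'c) \<Rightarrow> rat" where
  "rat_trace G h = (THE t. \<exists>b r. rational_basis G b r \<and>
     (\<exists>N::int. N \<noteq> 0 \<and> (\<exists>a::nat \<Rightarrow> nat \<Rightarrow> int.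
        (\<forall>i<r. torsion_el G (h (b i) [^]\<^bsub>G\<^esub> N \<otimes>\<^bsub>G\<^esub> inv\<^bsub>G\<^esub> (zlc G b (a i) r))) \<and>
        t = of_int (\<Sum>i<r. a i i) / of_int N)))"

text \<open>Lefschetz number L(g) = sum_k (-1)^k trace(g_* on H_k(Y;Q)).  The sum is over
  the (finitely many, for compact ENRs) degrees with nonzero trace.\<close>
definition lefschetz :: "'b topology \<Rightarrow> ('b \<Rightarrow> 'b) \<Rightarrow> rat" where
  "lefschetz Y g = (\<Sum>k\<in>{k::nat. rat_trace (homology_group (int k) Y) (hom_induced (int k) Y {} Y {} g) \<noteq> 0}.
      (-1) ^ k * rat_trace (homology_group (int k) Y) (hom_induced (int k) Y {} Y {} g))"

definition moebius :: "nat \<Rightarrow> int" where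
  "moebius n = (if n = 0 then 0 else if squarefree n then (-1) ^ card (prime_factors n) else 0)"

text \<open>dold L m = sum_{r | m} mu(m/r) L(r), where L r is the Lefschetz number of the r-th iterate.\<close>
definition dold :: "(nat \<Rightarrow> rat) \<Rightarrow> nat \<Rightarrow> rat" where
  "dold L m = (\<Sum>r\<in>{r. r dvd m}. of_int (moebius (m div r)) * L r)"

end

theory Submission
  imports Defs
begin

text \<open>
  The heart of the matter is \<open>L(f\<^sup>r) = 1 + \<Sum>i. (L(f\<^sup>r\<^sub>i\<^sub>i) - 1)\<close>.  In positive degrees the homology of the wedge
  is rationally the direct sum of the homologies of the summands: a Mayer--Vietoris induction, using
  contractible neighbourhoods of the base points, shows that a class killed by all projections is
  trivial.  Hence the trace of \<open>f\<^sup>r\<close> is the sum of the traces of its diagonal blocks.  If the length of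
  the cycle of \<open>i\<close> does not divide \<open>r\<close>, then \<open>f\<^sup>r\<^sub>i\<^sub>i\<close> is constant, with Lefschetz number 1, and Dold
  coefficients of constant sequences vanish for \<open>m > 1\<close>.

  The traces make sense because compact manifolds have finitely generated rational homology that
  vanishes in high degrees.  This is proved without embedding the manifold: if \<open>V\<^sub>i \<subseteq> V\<^sub>i' \<subseteq> U\<close> are open
  and the maps \<open>H(V\<^sub>i') \<rightarrow> H(U)\<close> and \<open>H(V\<^sub>1 \<inter> V\<^sub>2) \<rightarrow> H(V\<^sub>1' \<inter> V\<^sub>2')\<close> have images of finite rank, then so has
  \<open>H(V\<^sub>1 \<union> V\<^sub>2) \<rightarrow> H(U)\<close>.  Starting from finite unions of convex open sets in a chart, one passes to
  arbitrary finite unions of compact subsets of charts.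
\<close>

section \<open>Rational spans and traces on abelian groups\<close>

text \<open>\<open>rat_trace\<close> is a definite description over rational bases of an integral
  homology group, so its value is known only where such a basis exists. Linear algebra over the
  rationals is done inside abelian groups: equations between vectors hold after a nonzero integer
  multiple and modulo torsion, and additive maps to \<open>rat\<close> serve as linear functionals.
  A family with dual functionals turns the trace into the sum of the numbers
  \<open>\<phi> i (h (b i))\<close>, from which diagonal blocks can be read off.

  Finite rank is required of inclusions and not of spaces because compact subsets of different
  charts may meet in an arbitrarily bad compact set, whose open neighbourhoods can have homology of
  infinite rank; a small neighbourhood inside a larger one still contributes an image of finite
  rank.

  Degree 0 stands apart: the path-connected wedge has rank one there, whereas the summands together
  have rank \<open>s\<close>. This explains the shift by 1 in each term of the Lefschetz
  formula.\<close>

text \<open>The preimage in \<open>G\<close> of the rational span of \<open>B\<close> in \<open>G \<otimes> \<rat>\<close>; it contains all torsion elements.\<close>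
inductive_set rspan :: "('c, 'm) monoid_scheme \<Rightarrow> 'c set \<Rightarrow> 'c set" for G B where
  rspan_one: "\<one>\<^bsub>G\<^esub> \<in> rspan G B"
| rspan_incl: "x \<in> B \<Longrightarrow> x \<in> carrier G \<Longrightarrow> x \<in> rspan G B"
| rspan_inv: "x \<in> rspan G B \<Longrightarrow> inv\<^bsub>G\<^esub> x \<in> rspan G B"
| rspan_mult: "x \<in> rspan G B \<Longrightarrow> y \<in> rspan G B \<Longrightarrow> x \<otimes>\<^bsub>G\<^esub> y \<in> rspan G B"
| rspan_root: "x \<in> carrier G \<Longrightarrow> N \<noteq> 0 \<Longrightarrow> x [^]\<^bsub>G\<^esub> (N::int) \<in> rspan G B \<Longrightarrow> x \<in> rspan G B"

lemmas rspan_intros = rspan_one rspan_incl rspan_inv rspan_mult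

lemma (in group) rspan_carrier: "x \<in> rspan G B \<Longrightarrow> x \<in> carrier G"
  by (induction rule: rspan.induct) auto

lemma (in group) rspan_nat_pow:
  assumes "x \<in> rspan G B"
  shows "x [^] (n::nat) \<in> rspan G B"
  by (induction n) (simp_all add: rspan_one rspan_mult assms)

lemma (in group) rspan_int_pow:
  assumes "x \<in> rspan G B"
  shows "x [^] (n::int) \<in> rspan G B"
proof (cases "n < 0")
  case True
  have "x [^] n = inv (x [^] nat (- n))" using True by (subst int_pow_def2) simp
  then show ?thesis using rspan_inv[OF rspan_nat_pow[OF assms]] by metis
next
  case False
  have "x [^] n = x [^] nat n" using False by (subst int_pow_def2) simp
  then show ?thesis using rspan_nat_pow[OF assms] by metis
qed

lemma (in group) rspan_trans:
  assumes "B \<subseteq> rspan G C"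
  shows "rspan G B \<subseteq> rspan G C"
proof
  fix x assume "x \<in> rspan G B"
  then show "x \<in> rspan G C"
  proof (induction rule: rspan.induct)
    case (rspan_root x N)
    then show ?case by (metis rspan.rspan_root)
  qed (use assms in \<open>auto intro: rspan_intros\<close>)
qed

lemma (in group) rspan_mono:
  assumes "B \<subseteq> C"
  shows "rspan G B \<subseteq> rspan G C"
proof
  fix x assume "x \<in> rspan G B"
  then show "x \<in> rspan G C"
  proof (induction rule: rspan.induct)
    case (rspan_root x N)
    then show ?case by (metis rspan.rspan_root)
  qed (use assms in \<open>auto intro: rspan_intros\<close>)
qed

lemma (in group_hom) rspan_hom:
  assumes "x \<in> rspan G B"
  shows "h x \<in> rspan H (h ` B)"
  using assms
proof (induction rule: rspan.induct)
  case rspan_one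
  show ?case by (metis hom_one rspan.rspan_one)
next
  case (rspan_incl x)
  then show ?case by (auto intro: rspan.rspan_incl)
next
  case (rspan_inv x)
  then show ?case by (simp add: G.rspan_carrier rspan.rspan_inv)
next
  case (rspan_mult x y)
  then show ?case by (simp add: G.rspan_carrier rspan.rspan_mult)
next
  case (rspan_root x N)
  then show ?case by (metis hom_closed hom_int_pow rspan.rspan_root)
qed

lemma (in comm_group) pow_cross:
  fixes M N :: int
  assumes "x \<in> carrier G" "y \<in> carrier G"
  shows "(x \<otimes> y) [^] (M * N) = (x [^] M) [^] N \<otimes> (y [^] N) [^] M"
  using assms by (simp add: int_pow_distrib int_pow_pow mult.commute)

text \<open>A root taken in \<open>H\<close> need not be the image of a root in \<open>G\<close>, so
  only a nonzero multiple of \<open>z\<close> can be lifted. For products the two multiples are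
  combined into \<open>N * M\<close>.\<close>

lemma rspan_lift:
  fixes h :: "'a \<Rightarrow> 'b"
  assumes "group_hom G H h" and "comm_group G" and "comm_group H" and B: "B \<subseteq> carrier G"
    and "z \<in> rspan H (h ` B)"
  shows "\<exists>N::int. \<exists>y. N \<noteq> 0 \<and> y \<in> rspan G B \<and> z [^]\<^bsub>H\<^esub> N = h y"
proof -
  interpret group_hom G H h by fact
  interpret GC: comm_group G by fact
  interpret HC: comm_group H by fact
  from assms(5) show ?thesis
  proof (induction rule: rspan.induct)
    case rspan_one
    show ?case by (rule exI[of _ 1], rule exI[of _ "\<one>\<^bsub>G\<^esub>"]) (auto intro: rspan_intros)
  next
    case (rspan_incl x)
    then obtain b where "b \<in> B" "x = h b" by auto
    then show ?case using B by (intro exI[of _ 1] exI[of _ b]) (auto intro: rspan_intros)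
  next
    case (rspan_inv x)
    then obtain N :: int and y where "N \<noteq> 0" "y \<in> rspan G B" "x [^]\<^bsub>H\<^esub> N = h y" by auto
    then show ?case
      by (intro exI[of _ N] exI[of _ "inv\<^bsub>G\<^esub> y"])
        (auto intro: rspan_intros simp: int_pow_inv H.rspan_carrier[OF rspan_inv(1)] G.rspan_carrier)
  next
    case (rspan_mult x x')
    then obtain N M :: int and y y' where *: "N \<noteq> 0" "y \<in> rspan G B" "x [^]\<^bsub>H\<^esub> N = h y"
       "M \<noteq> 0" "y' \<in> rspan G B" "x' [^]\<^bsub>H\<^esub> M = h y'" by blast
    have "(x \<otimes>\<^bsub>H\<^esub> x') [^]\<^bsub>H\<^esub> (N * M) = h (y [^]\<^bsub>G\<^esub> M \<otimes>\<^bsub>G\<^esub> y' [^]\<^bsub>G\<^esub> N)"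
      using rspan_mult(1,2) * by (simp add: HC.pow_cross H.rspan_carrier G.rspan_carrier hom_int_pow)
    moreover have "y [^]\<^bsub>G\<^esub> M \<otimes>\<^bsub>G\<^esub> y' [^]\<^bsub>G\<^esub> N \<in> rspan G B"
      using * by (auto intro!: rspan.rspan_mult G.rspan_int_pow)
    ultimately show ?case using * by (metis mult_eq_0_iff)
  next
    case (rspan_root x M)
    then obtain N :: int and y where "N \<noteq> 0" "y \<in> rspan G B" "(x [^]\<^bsub>H\<^esub> M) [^]\<^bsub>H\<^esub> N = h y" by auto
    then show ?case using rspan_root(1,2)
      by (intro exI[of _ "M * N"] exI[of _ y]) (auto simp: int_pow_pow)
  qed
qed

text \<open>Elimination of one generator: a multiple of \<open>x\<close> belongs to the old span up
  to a power of \<open>g\<close>. Closure under roots costs nothing because \<open>N\<close> may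
  grow.\<close>

lemma (in comm_group) rspan_insert:
  assumes g: "g \<in> carrier G" and "x \<in> rspan G (insert g B)"
  shows "\<exists>(N::int) (e::int). N \<noteq> 0 \<and> x [^] N \<otimes> g [^] e \<in> rspan G B"
  using assms(2)
proof (induction rule: rspan.induct)
  case rspan_one
  show ?case by (rule exI[of _ 1], rule exI[of _ 0]) (auto intro: rspan_intros)
next
  case (rspan_incl x)
  show ?case
  proof (cases "x = g")
    case True
    show ?thesis using True g
      by (intro exI[of _ 1] exI[of _ "-1"]) (simp add: int_pow_neg rspan_one)
  next
    case False
    then show ?thesis using rspan_incl
      by (intro exI[of _ 1] exI[of _ 0]) (auto intro: rspan_intros)
  qed
next
  case (rspan_inv x)
  then obtain N e :: int where "N \<noteq> 0" "x [^] N \<otimes> g [^] e \<in> rspan G B" by auto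
  moreover have "inv x [^] N \<otimes> g [^] (-e) = inv (x [^] N \<otimes> g [^] e)"
    using rspan_carrier[OF rspan_inv(1)] g by (simp add: int_pow_inv int_pow_neg inv_mult)
  ultimately show ?case by (metis rspan.rspan_inv)
next
  case (rspan_mult x y)
  then obtain N e M d :: int where *: "N \<noteq> 0" "x [^] N \<otimes> g [^] e \<in> rspan G B"
    "M \<noteq> 0" "y [^] M \<otimes> g [^] d \<in> rspan G B" by blast
  have c: "x \<in> carrier G" "y \<in> carrier G" using rspan_mult rspan_carrier by auto
  have "(x \<otimes> y) [^] (N * M) \<otimes> g [^] (e * M + d * N) =
     (x [^] N \<otimes> g [^] e) [^] M \<otimes> (y [^] M \<otimes> g [^] d) [^] N"
    using c g by (simp add: int_pow_distrib int_pow_pow int_pow_mult m_ac mult.commute)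
  then show ?case using * by (metis mult_eq_0_iff rspan.rspan_mult rspan_int_pow)
next
  case (rspan_root x M)
  then obtain N e :: int where "N \<noteq> 0" "(x [^] M) [^] N \<otimes> g [^] e \<in> rspan G B" by auto
  then show ?case using rspan_root(1,2)
    by (intro exI[of _ "M * N"] exI[of _ e]) (auto simp: int_pow_pow)
qed

text \<open>The rational form of the fact that a subspace of a finite-dimensional space is
  finite-dimensional. Generators inside \<open>S\<close> are demanded because they will be lifted
  along a homomorphism with image \<open>S\<close>. If \<open>S\<close> exceeds the span of
  \<open>F\<close>, one element \<open>s\<close> with a nonzero exponent at \<open>g\<close>
  accounts for the missing direction.\<close>

lemma (in comm_group) rspan_finite_subgroup:
  assumes "finite F" "F \<subseteq> carrier G" "subgroup S G" "S \<subseteq> rspan G F"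
  shows "\<exists>F'. finite F' \<and> F' \<subseteq> S \<and> S \<subseteq> rspan G F'"
  using assms
proof (induction F arbitrary: S rule: finite_induct)
  case empty
  then show ?case by (intro exI[of _ "{}"]) auto
next
  case (insert g F)
  interpret S: subgroup S G by fact
  have g: "g \<in> carrier G" using insert by auto
  define S' where "S' = S \<inter> rspan G F"
  have subS': "subgroup S' G"
    unfolding S'_def by unfold_locales (use S.subset in \<open>auto intro: rspan_intros\<close>)
  have "\<exists>F'. finite F' \<and> F' \<subseteq> S' \<and> S' \<subseteq> rspan G F'"
    by (rule insert.IH) (use insert.prems subS' S'_def in auto)
  then obtain F' where F': "finite F'" "F' \<subseteq> S'" "S' \<subseteq> rspan G F'" by blast
  show ?case
  proof (cases "S \<subseteq> rspan G F")
    case True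
    then show ?thesis using F' by (intro exI[of _ F']) (auto simp: S'_def)
  next
    case False
    then obtain s where s: "s \<in> S" "s \<notin> rspan G F" by auto
    have "s \<in> rspan G (insert g F)" using insert.prems(3) s(1) by (rule subsetD)
    from rspan_insert[OF g this]
    obtain M c :: int where M: "M \<noteq> 0" "s [^] M \<otimes> g [^] c \<in> rspan G F"
      by auto
    have sc: "s \<in> carrier G" using s S.subset by auto
    have c0: "c \<noteq> 0"
    proof
      assume "c = 0"
      then have "s [^] M \<in> rspan G F" using M sc by simp
      then show False using s(2) rspan_root[OF sc M(1)] by blast
    qed
    have "S \<subseteq> rspan G (insert s F')"
    proof
      fix x assume x: "x \<in> S"
      then have xc: "x \<in> carrier G" using S.subset by auto
      have "x \<in> rspan G (insert g F)" using insert.prems(3) x by (rule subsetD)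
      from rspan_insert[OF g this]
      obtain N e :: int where N: "N \<noteq> 0" "x [^] N \<otimes> g [^] e \<in> rspan G F"
        by auto
      \<comment> \<open>Cross-multiplying the relations of \<open>x\<close> and \<open>s\<close>
        cancels \<open>g\<close>: the first is raised to \<open>c\<close>, the second to
        \<open>-e\<close>. Since \<open>y\<close> also lies in \<open>S\<close>, it belongs to the
        smaller subgroup \<open>S'\<close>.\<close>
      define y where "y = x [^] (N * c) \<otimes> s [^] (- (M * e))"
      have "y = (x [^] N \<otimes> g [^] e) [^] c \<otimes> (s [^] M \<otimes> g [^] c) [^] (-e)"
      proof -
        have "(x [^] N \<otimes> g [^] e) [^] c \<otimes> (s [^] M \<otimes> g [^] c) [^] (-e)
          = x [^] (N * c) \<otimes> s [^] (- (M * e)) \<otimes> (g [^] (e * c) \<otimes> g [^] (- (c * e)))"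
          using xc sc g by (simp add: int_pow_distrib int_pow_pow m_ac)
        also have "g [^] (e * c) \<otimes> g [^] (- (c * e)) = \<one>"
          using g by (simp add: mult.commute flip: int_pow_mult)
        finally show ?thesis using xc sc by (simp add: y_def)
      qed
      then have "y \<in> rspan G F" using N M by (simp add: rspan_mult rspan_int_pow)
      moreover have "y \<in> S" unfolding y_def
        using x s insert.prems(2) by (simp add: subgroup_int_pow_closed)
      ultimately have "y \<in> rspan G F'" using F' by (auto simp: S'_def)
      then have y: "y \<in> rspan G (insert s F')" using rspan_mono[of F' "insert s F'"] by blast
      have sr: "s \<in> rspan G (insert s F')" using sc by (auto intro: rspan_intros)
      have "x [^] (N * c) = y \<otimes> s [^] (M * e)"
        unfolding y_def using xc sc by (simp add: m_assoc flip: int_pow_mult)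
      then have "x [^] (N * c) \<in> rspan G (insert s F')"
        using y sr by (simp add: rspan_mult rspan_int_pow)
      then show "x \<in> rspan G (insert s F')"
        using rspan_root[OF xc, of "N * c"] N c0 by auto
    qed
    then show ?thesis using F' s by (intro exI[of _ "insert s F'"]) (auto simp: S'_def)
  qed
qed

section \<open>Additive maps to the rationals, that is, linear functionals on the rationalised
  group\<close>

definition rat_functional :: "('c, 'm) monoid_scheme \<Rightarrow> ('c \<Rightarrow> rat) \<Rightarrow> bool" where
  "rat_functional G \<psi> \<longleftrightarrow>
     (\<forall>x\<in>carrier G. \<forall>y\<in>carrier G. \<psi> (x \<otimes>\<^bsub>G\<^esub> y) = \<psi> x + \<psi> y)"

lemma rat_functionalD:
  "rat_functional G \<psi> \<Longrightarrow> x \<in> carrier G \<Longrightarrow> y \<in> carrier G \<Longrightarrow> \<psi> (x \<otimes>\<^bsub>G\<^esub> y) = \<psi> x + \<psi> y"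
  by (simp add: rat_functional_def)

lemma rat_functional_compose:
  assumes "rat_functional H \<psi>" "h \<in> hom G H"
  shows "rat_functional G (\<lambda>x. \<psi> (h x))"
  using assms by (simp add: rat_functional_def hom_mult hom_in_carrier)

context group
begin

lemma rat_functional_one: "rat_functional G \<psi> \<Longrightarrow> \<psi> \<one> = 0"
  using rat_functionalD[of G \<psi> \<one> \<one>] by simp

lemma rat_functional_inv: "rat_functional G \<psi> \<Longrightarrow> x \<in> carrier G \<Longrightarrow> \<psi> (inv x) = - \<psi> x"
  using rat_functionalD[of G \<psi> x "inv x"] rat_functional_one[of \<psi>] by simp

lemma rat_functional_nat_pow:
  "rat_functional G \<psi> \<Longrightarrow> x \<in> carrier G \<Longrightarrow> \<psi> (x [^] (n::nat)) = of_nat n * \<psi> x"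
  by (induction n) (simp_all add: rat_functional_one rat_functionalD algebra_simps)

lemma rat_functional_int_pow:
  assumes "rat_functional G \<psi>" "x \<in> carrier G"
  shows "\<psi> (x [^] (n::int)) = of_int n * \<psi> x"
proof (cases "n < 0")
  case True
  have "x [^] n = inv (x [^] nat (- n))" using True by (subst int_pow_def2) simp
  then have "\<psi> (x [^] n) = - (of_nat (nat (- n)) * \<psi> x)"
    using assms by (metis nat_pow_closed rat_functional_inv rat_functional_nat_pow)
  then show ?thesis using True by simp
next
  case False
  have "x [^] n = x [^] nat n" using False by (subst int_pow_def2) simp
  then have "\<psi> (x [^] n) = of_nat (nat n) * \<psi> x"
    using assms by (metis rat_functional_nat_pow)
  then show ?thesis using False by simp
qed

lemma rat_functional_torsion:
  assumes "rat_functional G \<psi>" "torsion_el G x"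
  shows "\<psi> x = 0"
proof -
  obtain n :: int where n: "n \<noteq> 0" "x [^] n = \<one>" "x \<in> carrier G"
    using assms(2) by (auto simp: torsion_el_def)
  then have "of_int n * \<psi> x = 0"
    using rat_functional_int_pow[OF assms(1) n(3), of n] rat_functional_one[OF assms(1)] by simp
  then show ?thesis using n by simp
qed

end

lemma torsion_el_closed: "torsion_el G x \<Longrightarrow> x \<in> carrier G"
  by (simp add: torsion_el_def)

section \<open>Torsion elements and integral linear combinations\<close>

context comm_group
begin

lemma rat_functional_finprod:
  assumes "rat_functional G \<psi>" "finite I" "\<And>i. i \<in> I \<Longrightarrow> f i \<in> carrier G"
  shows "\<psi> (finprod G f I) = (\<Sum>i\<in>I. \<psi> (f i))"
  using assms(2,3)
proof (induction I rule: finite_induct)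
  case empty
  then show ?case using rat_functional_one[OF assms(1)] by simp
next
  case (insert i I)
  then have "finprod G f (insert i I) = f i \<otimes> finprod G f I" by (intro finprod_insert) auto
  then show ?case using insert rat_functionalD[OF assms(1)] by (simp add: finprod_closed Pi_def)
qed

lemma torsion_el_one: "torsion_el G \<one>"
  unfolding torsion_el_def by (auto intro: exI[of _ 1])

lemma torsion_el_mult:
  assumes "torsion_el G x" "torsion_el G y"
  shows "torsion_el G (x \<otimes> y)"
proof -
  obtain n m :: int where "n \<noteq> 0" "x [^] n = \<one>" "m \<noteq> 0" "y [^] m = \<one>"
    and c: "x \<in> carrier G" "y \<in> carrier G"
    using assms by (auto simp: torsion_el_def)
  then have "(x \<otimes> y) [^] (n * m) = \<one>" by (simp add: pow_cross)
  with \<open>n \<noteq> 0\<close> \<open>m \<noteq> 0\<close> c show ?thesis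
    unfolding torsion_el_def by (metis m_closed mult_eq_0_iff)
qed

lemma torsion_el_int_pow:
  assumes "torsion_el G x"
  shows "torsion_el G (x [^] (k::int))"
proof -
  obtain n :: int where n: "n \<noteq> 0" "x [^] n = \<one>" and c: "x \<in> carrier G"
    using assms by (auto simp: torsion_el_def)
  have "(x [^] k) [^] n = x [^] (n * k)" using c by (simp add: int_pow_pow mult.commute)
  also have "\<dots> = (x [^] n) [^] k" using c by (simp add: int_pow_pow)
  finally have "(x [^] k) [^] n = (x [^] n) [^] k" .
  then show ?thesis using n c by (auto simp: torsion_el_def)
qed

lemma torsion_el_root:
  assumes "torsion_el G (x [^] (k::int))" "k \<noteq> 0" "x \<in> carrier G"
  shows "torsion_el G x"
proof -
  obtain n :: int where n: "n \<noteq> 0" "(x [^] k) [^] n = \<one>"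
    using assms by (auto simp: torsion_el_def)
  then have "x [^] (k * n) = \<one>" using assms by (simp add: int_pow_pow)
  then show ?thesis using n assms unfolding torsion_el_def by (metis mult_eq_0_iff)
qed

lemma zlc_closed:
  assumes "b \<in> {..<r} \<rightarrow> carrier G"
  shows "zlc G b c r \<in> carrier G"
  unfolding zlc_def using assms by (intro finprod_closed) auto

lemma zlc_add:
  assumes "b \<in> {..<r} \<rightarrow> carrier G"
  shows "zlc G b (\<lambda>i. c i + d i) r = zlc G b c r \<otimes> zlc G b d r"
proof -
  have "finprod G (\<lambda>i. b i [^] (c i + d i)) {..<r} = finprod G (\<lambda>i. b i [^] c i \<otimes> b i [^] d i) {..<r}"
    using assms by (intro finprod_cong') (auto simp: int_pow_mult Pi_iff)
  then show ?thesis
    unfolding zlc_def using assms by (simp add: finprod_multf Pi_def)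
qed

lemma zlc_zero: "(\<And>i. i < r \<Longrightarrow> c i = 0) \<Longrightarrow> zlc G b c r = \<one>"
  unfolding zlc_def by (rule finprod_one_eqI) simp

lemma zlc_uminus:
  assumes "b \<in> {..<r} \<rightarrow> carrier G"
  shows "zlc G b (\<lambda>i. - c i) r = inv (zlc G b c r)"
proof -
  have "zlc G b c r \<otimes> zlc G b (\<lambda>i. - c i) r = \<one>"
    using zlc_add[OF assms, of c "\<lambda>i. - c i"] zlc_zero[of r "\<lambda>i. 0" b] by simp
  then show ?thesis using zlc_closed[OF assms] by (metis inv_equality m_comm)
qed

lemma zlc_scale:
  assumes "b \<in> {..<r} \<rightarrow> carrier G"
  shows "zlc G b (\<lambda>i. c i * k) r = zlc G b c r [^] (k::int)"
proof -
  have "finprod G (\<lambda>i. b i [^] (c i * k)) J = finprod G (\<lambda>i. b i [^] c i) J [^] k"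
    if "finite J" "J \<subseteq> {..<r}" for J
    using that
  proof (induction J rule: finite_induct)
    case (insert j J)
    then have cl: "b j \<in> carrier G" "b \<in> J \<rightarrow> carrier G" using assms by auto
    then show ?case
      using insert by (simp add: Pi_def int_pow_distrib int_pow_pow)
  qed simp
  then show ?thesis unfolding zlc_def by blast
qed

lemma zlc_single:
  assumes "b \<in> {..<r} \<rightarrow> carrier G" "j < r"
  shows "zlc G b (\<lambda>i. of_bool (i = j)) r = b j"
proof -
  have "zlc G b (\<lambda>i. of_bool (i = j)) r = finprod G (\<lambda>i. if j = i then b i else \<one>) {..<r}"
    unfolding zlc_def using assms by (intro finprod_cong') (auto simp: Pi_iff)
  also have "\<dots> = b j" using assms by (intro finprod_singleton) auto
  finally show ?thesis .
qed

lemma rat_functional_zlc: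
  assumes "rat_functional G \<psi>" "b \<in> {..<r} \<rightarrow> carrier G"
  shows "\<psi> (zlc G b c r) = (\<Sum>i<r. of_int (c i) * \<psi> (b i))"
  unfolding zlc_def using assms
  by (subst rat_functional_finprod) (auto simp: rat_functional_int_pow Pi_iff intro!: sum.cong)

end

section \<open>Rational coordinates, dual bases and the trace formula\<close>

definition rat_coords ::
  "('c, 'm) monoid_scheme \<Rightarrow> (nat \<Rightarrow> 'c) \<Rightarrow> nat \<Rightarrow> 'c \<Rightarrow> int \<Rightarrow> (nat \<Rightarrow> int) \<Rightarrow> bool" where
  "rat_coords G b r x N c \<longleftrightarrow> N \<noteq> 0 \<and>
     torsion_el G (x [^]\<^bsub>G\<^esub> N \<otimes>\<^bsub>G\<^esub> inv\<^bsub>G\<^esub> (zlc G b c r))"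

text \<open>The last clause says that the functionals jointly detect everything but torsion, so
  \<open>b\<close> spans rationally; the clause before it gives independence. The index type is
  free, which admits pairs (summand, position) for the wedge and a single index for degree
  0.\<close>

definition dual_basis ::
  "('c, 'm) monoid_scheme \<Rightarrow> 'i set \<Rightarrow> ('i \<Rightarrow> 'c) \<Rightarrow> ('i \<Rightarrow> 'c \<Rightarrow> rat) \<Rightarrow> bool" where
  "dual_basis G I b \<phi> \<longleftrightarrow> finite I \<and> (\<forall>i\<in>I. b i \<in> carrier G \<and> rat_functional G (\<phi> i)) \<and>
     (\<forall>i\<in>I. \<forall>j\<in>I. \<phi> i (b j) = of_bool (i = j)) \<and>
     (\<forall>x\<in>carrier G. (\<forall>i\<in>I. \<phi> i x = 0) \<longrightarrow> torsion_el G x)"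

lemma common_denominator:
  assumes "finite I"
  shows "\<exists>(N::int) c. N \<noteq> 0 \<and> (\<forall>i\<in>I. of_int N * (q i :: rat) = of_int (c i))"
  using assms
proof (induction I rule: finite_induct)
  case empty
  then show ?case by (intro exI[of _ 1]) auto
next
  case (insert i I)
  then obtain N :: int and c where N: "N \<noteq> 0" "\<forall>i\<in>I. of_int N * q i = of_int (c i)" by auto
  obtain a d :: int where ad: "d > 0" "q i = of_int a / of_int d"
    by (metis Fract_of_int_quotient Rat_cases)
  show ?case
  proof (intro exI[of _ "N * d"] exI[of _ "\<lambda>j. if j = i then N * a else c j * d"] conjI ballI)
    fix j assume "j \<in> insert i I"
    then show "of_int (N * d) * q j = of_int (if j = i then N * a else c j * d)"
      using N ad insert.hyps by (auto simp: mult.commute mult.left_commute)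
  qed (use N ad in auto)
qed

context comm_group
begin

lemma rat_coords_mult:
  assumes b: "b \<in> {..<r} \<rightarrow> carrier G" and xy: "x \<in> carrier G" "y \<in> carrier G"
    and R: "rat_coords G b r x N c" "rat_coords G b r y M d"
  shows "rat_coords G b r (x \<otimes> y) (N * M) (\<lambda>i. c i * M + d i * N)"
proof -
  have "(x \<otimes> y) [^] (N * M) \<otimes> inv (zlc G b (\<lambda>i. c i * M + d i * N) r)
     = (x [^] N \<otimes> inv (zlc G b c r)) [^] M \<otimes> (y [^] M \<otimes> inv (zlc G b d r)) [^] N"
    using xy zlc_closed[OF b]
    by (simp add: zlc_add[OF b] zlc_scale[OF b] int_pow_distrib int_pow_pow int_pow_inv inv_mult m_ac
        mult.commute[of M N])
  then show ?thesis
    using R unfolding rat_coords_def by (metis mult_eq_0_iff torsion_el_int_pow torsion_el_mult)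
qed

lemma rat_coords_inv:
  assumes b: "b \<in> {..<r} \<rightarrow> carrier G" and x: "x \<in> carrier G"
    and R: "rat_coords G b r x N c"
  shows "rat_coords G b r (inv x) N (\<lambda>i. - c i)"
proof -
  have "inv x [^] N \<otimes> inv (zlc G b (\<lambda>i. - c i) r) = (x [^] N \<otimes> inv (zlc G b c r)) [^] (-1 :: int)"
    using x zlc_closed[OF b] by (simp add: zlc_uminus[OF b] int_pow_neg inv_mult int_pow_inv)
  then show ?thesis
    using R unfolding rat_coords_def by (metis torsion_el_int_pow)
qed

lemma rat_coords_torsion:
  assumes b: "b \<in> {..<r} \<rightarrow> carrier G" and "torsion_el G x"
  shows "rat_coords G b r x 1 (\<lambda>i. 0)"
  using assms zlc_zero[of r "\<lambda>i. 0" b] by (simp add: rat_coords_def torsion_el_closed)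

lemma rat_coords_basis:
  assumes b: "b \<in> {..<r} \<rightarrow> carrier G" and "j < r"
  shows "rat_coords G b r (b j) 1 (\<lambda>i. of_bool (i = j))"
  using assms zlc_single[OF assms] by (simp add: rat_coords_def torsion_el_one Pi_iff)

text \<open>Coordinates \<open>c i / N\<close> are stored unreduced, so uniqueness is equality of
  cross products. Combining the coordinates of \<open>x\<close> with those of its inverse gives a
  relation for the unit element, to which independence applies.\<close>

lemma rat_coords_unique:
  assumes b: "b \<in> {..<r} \<rightarrow> carrier G" and x: "x \<in> carrier G"
    and indep: "\<forall>c. torsion_el G (zlc G b c r) \<longrightarrow> (\<forall>i<r. c i = 0)"
    and R: "rat_coords G b r x N c" "rat_coords G b r x M d" and "i < r"
  shows "c i * M = d i * N"
proof -
  have "rat_coords G b r (x \<otimes> inv x) (N * M) (\<lambda>i. c i * M + (- d i) * N)"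
    using rat_coords_mult[OF b x inv_closed[OF x] R(1) rat_coords_inv[OF b x R(2)]] .
  then have "torsion_el G (inv (zlc G b (\<lambda>i. c i * M - d i * N) r))"
    using x zlc_closed[OF b] by (simp add: rat_coords_def)
  then have "torsion_el G (zlc G b (\<lambda>i. c i * M - d i * N) r)"
    using torsion_el_int_pow[of "inv (zlc G b (\<lambda>i. c i * M - d i * N) r)" "-1"] zlc_closed[OF b]
    by (simp add: int_pow_neg)
  from indep[rule_format, OF this \<open>i < r\<close>] show ?thesis by simp
qed

text \<open>The choice of \<open>N x\<close> and \<open>c x\<close> is arbitrary, but the quotient
  \<open>c x i / N x\<close> is not, by uniqueness. Additivity and duality follow by comparison with
  coordinates that are known explicitly.\<close>

lemma dual_basis_exists:
  assumes "rational_basis G b r"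
  shows "\<exists>\<phi>. dual_basis G {..<r} b \<phi>"
proof -
  have b: "b \<in> {..<r} \<rightarrow> carrier G" using assms by (auto simp: rational_basis_def)
  have indep: "\<forall>c. torsion_el G (zlc G b c r) \<longrightarrow> (\<forall>i<r. c i = 0)"
    using assms by (auto simp: rational_basis_def)
  have "\<forall>x\<in>carrier G. \<exists>N c. rat_coords G b r x N c"
    using assms unfolding rational_basis_def rat_coords_def by simp
  then obtain N c where Nc: "\<And>x. x \<in> carrier G \<Longrightarrow> rat_coords G b r x (N x) (c x)"
    by metis
  define \<phi> where "\<phi> = (\<lambda>i x. of_int (c x i) / of_int (N x) :: rat)"
  have \<phi>: "\<phi> i x = of_int (d i) / of_int M"
    if x: "x \<in> carrier G" and R: "rat_coords G b r x M d" and i: "i < r" for i x M d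
  proof -
    have "c x i * M = d i * N x" by (rule rat_coords_unique[OF b x indep Nc[OF x] R i])
    then have "(of_int (c x i) * of_int M :: rat) = of_int (d i) * of_int (N x)"
      by (metis of_int_mult)
    moreover have "N x \<noteq> 0" "M \<noteq> 0" using Nc[OF x] R by (auto simp: rat_coords_def)
    ultimately show ?thesis by (simp add: \<phi>_def frac_eq_eq)
  qed
  have "rat_functional G (\<phi> i)" if i: "i < r" for i
    unfolding rat_functional_def
  proof (intro ballI)
    fix x y assume x: "x \<in> carrier G" and y: "y \<in> carrier G"
    have "rat_coords G b r (x \<otimes> y) (N x * N y) (\<lambda>i. c x i * N y + c y i * N x)"
      using x y Nc b by (intro rat_coords_mult) auto
    then have "\<phi> i (x \<otimes> y) = of_int (c x i * N y + c y i * N x) / of_int (N x * N y)"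
      using x y i by (intro \<phi>) auto
    moreover have "N x \<noteq> 0" "N y \<noteq> 0" using Nc[OF x] Nc[OF y] by (auto simp: rat_coords_def)
    ultimately show "\<phi> i (x \<otimes> y) = \<phi> i x + \<phi> i y" by (simp add: \<phi>_def field_simps)
  qed
  moreover have "\<phi> i (b j) = of_bool (i = j)" if "i < r" "j < r" for i j
    using \<phi>[OF funcset_mem[OF b] rat_coords_basis[OF b]] that by auto
  moreover have "torsion_el G x" if x: "x \<in> carrier G" and z: "\<forall>i<r. \<phi> i x = 0" for x
  proof -
    have N: "N x \<noteq> 0" "torsion_el G (x [^] N x \<otimes> inv (zlc G b (c x) r))"
      using Nc[OF x] by (auto simp: rat_coords_def)
    have "c x i = 0" if "i < r" for i using z N(1) that by (simp add: \<phi>_def)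
    then have "zlc G b (c x) r = \<one>" by (rule zlc_zero)
    with N(2) x have "torsion_el G (x [^] N x)" by simp
    then show ?thesis using torsion_el_root N(1) x by blast
  qed
  ultimately show ?thesis using b by (intro exI[of _ \<phi>]) (auto simp: dual_basis_def)
qed

text \<open>A multiple of \<open>x\<close> minus the integral combination with the same coordinates
  is killed by every \<open>\<phi> i\<close>, hence is torsion, hence is killed by every other
  functional.\<close>

lemma dual_basis_expand:
  assumes D: "dual_basis G I b \<phi>" and \<psi>: "rat_functional G \<psi>" and x: "x \<in> carrier G"
  shows "\<psi> x = (\<Sum>i\<in>I. \<phi> i x * \<psi> (b i))"
proof -
  have I: "finite I" and b: "\<And>i. i \<in> I \<Longrightarrow> b i \<in> carrier G"
    and f: "\<And>i. i \<in> I \<Longrightarrow> rat_functional G (\<phi> i)"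
    using D by (auto simp: dual_basis_def)
  obtain N :: int and c where N: "N \<noteq> 0" "\<And>i. i \<in> I \<Longrightarrow> of_int N * \<phi> i x = of_int (c i)"
    using common_denominator[OF I, of "\<lambda>i. \<phi> i x"] by auto
  define z where "z = finprod G (\<lambda>i. b i [^] c i) I"
  have z: "z \<in> carrier G" unfolding z_def using b by (intro finprod_closed) auto
  have \<theta>z: "\<theta> z = (\<Sum>i\<in>I. of_int (c i) * \<theta> (b i))" if "rat_functional G \<theta>" for \<theta>
    unfolding z_def using b I
    by (subst rat_functional_finprod[OF that]) (auto simp: rat_functional_int_pow[OF that])
  define y where "y = x [^] N \<otimes> inv z"
  have y: "y \<in> carrier G" using x z by (simp add: y_def)
  have \<theta>y: "\<theta> y = of_int N * \<theta> x - \<theta> z" if "rat_functional G \<theta>" for \<theta>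
    using that x z by (simp add: y_def rat_functionalD rat_functional_inv rat_functional_int_pow)
  have "\<phi> i y = 0" if i: "i \<in> I" for i
  proof -
    have "\<phi> i z = (\<Sum>j\<in>I. of_int (c j) * of_bool (i = j))"
      unfolding \<theta>z[OF f[OF i]] using D i by (intro sum.cong) (auto simp: dual_basis_def)
    also have "\<dots> = of_int (c i)" using I i by (simp add: of_bool_def if_distrib cong: if_cong)
    finally show ?thesis using \<theta>y[OF f[OF i]] N(2)[OF i] by simp
  qed
  then have "torsion_el G y" using D y by (auto simp: dual_basis_def)
  then have "\<psi> y = 0" by (rule rat_functional_torsion[OF \<psi>])
  then have "of_int N * \<psi> x = (\<Sum>i\<in>I. of_int (c i) * \<psi> (b i))"
    using \<theta>y[OF \<psi>] \<theta>z[OF \<psi>] by simp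
  also have "\<dots> = of_int N * (\<Sum>i\<in>I. \<phi> i x * \<psi> (b i))"
    unfolding sum_distrib_left by (intro sum.cong) (auto simp flip: N(2))
  finally show ?thesis using N(1) by simp
qed

lemma dual_basis_imp_rational_basis:
  fixes r :: nat
  assumes D: "dual_basis G {..<r} b \<phi>"
  shows "rational_basis G b r"
  unfolding rational_basis_def
proof (intro conjI allI impI ballI)
  have b: "b \<in> {..<r} \<rightarrow> carrier G" and f: "\<And>i. i < r \<Longrightarrow> rat_functional G (\<phi> i)"
    using D by (auto simp: dual_basis_def)
  have \<phi>z: "\<phi> i (zlc G b c r) = of_int (c i)" if i: "i < r" for i c
  proof -
    have "\<phi> i (zlc G b c r) = (\<Sum>j<r. of_int (c j) * of_bool (i = j))"
      unfolding rat_functional_zlc[OF f[OF i] b]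
      using D i by (intro sum.cong) (auto simp: dual_basis_def)
    also have "\<dots> = of_int (c i)" using i by (simp add: of_bool_def if_distrib cong: if_cong)
    finally show ?thesis .
  qed
  show "b i \<in> carrier G" if "i < r" for i using b that by auto
  show "c i = 0" if "torsion_el G (zlc G b c r)" "i < r" for c i
    using \<phi>z[of i c] rat_functional_torsion[OF f that(1), of i] that(2) by simp
  show "\<exists>N::int. N \<noteq> 0 \<and> (\<exists>c. torsion_el G (x [^] N \<otimes> inv (zlc G b c r)))"
    if x: "x \<in> carrier G" for x
  proof -
    obtain N :: int and c where N: "N \<noteq> 0" "\<And>i. i < r \<Longrightarrow> of_int N * \<phi> i x = of_int (c i)"
      using common_denominator[of "{..<r}" "\<lambda>i. \<phi> i x"] by auto
    have "\<phi> i (x [^] N \<otimes> inv (zlc G b c r)) = 0" if i: "i < r" for i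
      using f[OF i] x zlc_closed[OF b] N i \<phi>z[OF i]
      by (simp add: rat_functionalD rat_functional_inv rat_functional_int_pow)
    then have "torsion_el G (x [^] N \<otimes> inv (zlc G b c r))"
      using D x zlc_closed[OF b] by (auto simp: dual_basis_def)
    then show ?thesis using N by blast
  qed
qed

lemma rat_trace_lessThan:
  fixes r :: nat
  assumes D: "dual_basis G {..<r} b \<phi>" and h: "h \<in> hom G G"
  shows "rat_trace G h = (\<Sum>i<r. \<phi> i (h (b i)))"
  unfolding rat_trace_def
proof (rule the_equality)
  have b: "b \<in> {..<r} \<rightarrow> carrier G" and f: "\<And>i. i < r \<Longrightarrow> rat_functional G (\<phi> i)"
    using D by (auto simp: dual_basis_def)
  have hb: "\<And>i. i < r \<Longrightarrow> h (b i) \<in> carrier G" using b h by (auto simp: hom_in_carrier Pi_iff)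
  \<comment> \<open>The definition of \<open>rat_trace\<close> asks for one denominator for the
    whole matrix, hence a common denominator over all pairs of indices.\<close>
  obtain N :: int and a where N0: "N \<noteq> 0"
      "\<forall>p\<in>{..<r} \<times> {..<r}. of_int N * \<phi> (snd p) (h (b (fst p))) = of_int (a p)"
    using common_denominator[of "{..<r} \<times> {..<r}" "\<lambda>p. \<phi> (snd p) (h (b (fst p)))"] by auto
  have N: "N \<noteq> 0"
      "\<And>i j. i < r \<Longrightarrow> j < r \<Longrightarrow> of_int N * \<phi> j (h (b i)) = of_int (a (i, j))"
    using N0 by auto
  have "torsion_el G (h (b i) [^] N \<otimes> inv (zlc G b (\<lambda>j. a (i, j)) r))" if i: "i < r" for i
  proof -
    have "\<phi> j (h (b i) [^] N \<otimes> inv (zlc G b (\<lambda>j. a (i, j)) r)) = 0" if j: "j < r" for j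
    proof -
      have "\<phi> j (zlc G b (\<lambda>j. a (i, j)) r) = (\<Sum>k<r. of_int (a (i, k)) * of_bool (j = k))"
        unfolding rat_functional_zlc[OF f[OF j] b]
        using D j by (intro sum.cong) (auto simp: dual_basis_def)
      also have "\<dots> = of_int (a (i, j))" using j by (simp add: of_bool_def if_distrib cong: if_cong)
      finally show ?thesis
        using f[OF j] hb[OF i] zlc_closed[OF b] N(2)[OF i j]
        by (simp add: rat_functionalD rat_functional_inv rat_functional_int_pow)
    qed
    then show ?thesis using D hb[OF i] zlc_closed[OF b] by (auto simp: dual_basis_def)
  qed
  moreover have "(\<Sum>i<r. \<phi> i (h (b i))) = of_int (\<Sum>i<r. a (i, i)) / of_int N"
  proof -
    have "\<phi> i (h (b i)) = of_int (a (i, i)) / of_int N" if "i < r" for i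
      using N(2)[OF that that] N(1) by (simp add: field_simps)
    then show ?thesis by (simp add: sum_divide_distrib)
  qed
  ultimately show "\<exists>b' r'. rational_basis G b' r' \<and> (\<exists>N::int. N \<noteq> 0 \<and> (\<exists>a::nat \<Rightarrow> nat \<Rightarrow> int.
      (\<forall>i<r'. torsion_el G (h (b' i) [^] N \<otimes> inv (zlc G b' (a i) r'))) \<and>
      (\<Sum>i<r. \<phi> i (h (b i))) = of_int (\<Sum>i<r'. a i i) / of_int N))"
    using dual_basis_imp_rational_basis[OF D] N(1)
    by (intro exI[of _ b] exI[of _ r] exI[of _ N] exI[of _ "\<lambda>i j. a (i, j)"] conjI) auto

next
  fix t :: rat
  assume "\<exists>b r. rational_basis G b r \<and> (\<exists>N::int. N \<noteq> 0 \<and> (\<exists>a::nat \<Rightarrow> nat \<Rightarrow> int.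
      (\<forall>i<r. torsion_el G (h (b i) [^] N \<otimes> inv (zlc G b (a i) r))) \<and>
      t = of_int (\<Sum>i<r. a i i) / of_int N))"
  then obtain b' r' and N :: int and a where R: "rational_basis G b' r'" and N: "N \<noteq> 0"
    and a: "\<And>i. i < r' \<Longrightarrow> torsion_el G (h (b' i) [^] N \<otimes> inv (zlc G b' (a i) r'))"
    and t: "t = of_int (\<Sum>i<r'. a i i) / of_int N" by blast
  obtain \<phi>' where D': "dual_basis G {..<r'} b' \<phi>'" using dual_basis_exists[OF R] by blast
  have b: "b \<in> {..<r} \<rightarrow> carrier G" and f: "\<And>i. i < r \<Longrightarrow> rat_functional G (\<phi> i)"
    using D by (auto simp: dual_basis_def)
  have b': "b' \<in> {..<r'} \<rightarrow> carrier G" and f': "\<And>i. i < r' \<Longrightarrow> rat_functional G (\<phi>' i)"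
    using D' by (auto simp: dual_basis_def)
  have hb: "\<And>i. i < r \<Longrightarrow> h (b i) \<in> carrier G" using b h by (auto simp: hom_in_carrier Pi_iff)
  have hb': "\<And>i. i < r' \<Longrightarrow> h (b' i) \<in> carrier G" using b' h by (auto simp: hom_in_carrier Pi_iff)
  have "\<phi>' i (h (b' i)) = of_int (a i i) / of_int N" if i: "i < r'" for i
  proof -
    have "\<phi>' i (zlc G b' (a i) r') = (\<Sum>k<r'. of_int (a i k) * of_bool (i = k))"
      unfolding rat_functional_zlc[OF f'[OF i] b']
      using D' i by (intro sum.cong) (auto simp: dual_basis_def)
    also have "\<dots> = of_int (a i i)" using i by (simp add: of_bool_def if_distrib cong: if_cong)
    finally have "of_int N * \<phi>' i (h (b' i)) = of_int (a i i)"
      using rat_functional_torsion[OF f'[OF i] a[OF i]] f'[OF i] hb'[OF i] zlc_closed[OF b']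
      by (simp add: rat_functionalD rat_functional_inv rat_functional_int_pow)
    then show ?thesis using N by (simp add: field_simps)
  qed
  then have "t = (\<Sum>j<r'. \<phi>' j (h (b' j)))" by (simp add: t sum_divide_distrib)
  \<comment> \<open>Independence of the basis: \<open>\<phi>' j\<close> composed with
    \<open>h\<close> is evaluated at \<open>b' j\<close> through the basis \<open>b\<close>; after
    the sums are exchanged, \<open>\<phi> i\<close> is evaluated at \<open>h (b i)\<close> through
    the basis \<open>b'\<close>.\<close>
  also have "\<dots> = (\<Sum>j<r'. \<Sum>i<r. \<phi> i (b' j) * \<phi>' j (h (b i)))"
    by (intro sum.cong refl dual_basis_expand[OF D]) (use b' in \<open>auto intro: rat_functional_compose[OF f' h]\<close>)
  also have "\<dots> = (\<Sum>i<r. \<Sum>j<r'. \<phi>' j (h (b i)) * \<phi> i (b' j))"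
    by (subst sum.swap) (simp add: mult.commute)
  also have "\<dots> = (\<Sum>i<r. \<phi> i (h (b i)))"
    by (intro sum.cong refl dual_basis_expand[OF D', symmetric]) (auto intro: f hb)
  finally show "t = (\<Sum>i<r. \<phi> i (h (b i)))" .
qed

lemma rat_trace_dual_basis:
  assumes D: "dual_basis G I b \<phi>" and h: "h \<in> hom G G"
  shows "rat_trace G h = (\<Sum>i\<in>I. \<phi> i (h (b i)))"
proof -
  have "finite I" using D by (auto simp: dual_basis_def)
  then obtain f where f: "bij_betw f {..<card I} I"
    using bij_betw_from_nat_into_finite by blast
  have fI: "f i \<in> I" if "i < card I" for i using f that by (auto simp: bij_betw_def)
  have "dual_basis G {..<card I} (\<lambda>i. b (f i)) (\<lambda>i. \<phi> (f i))"
    unfolding dual_basis_def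
  proof (intro conjI ballI impI)
    fix x assume x: "x \<in> carrier G" "\<forall>i\<in>{..<card I}. \<phi> (f i) x = 0"
    have "\<phi> j x = 0" if "j \<in> I" for j
      using x(2) f that by (metis bij_betw_iff_bijections)
    then show "torsion_el G x" using D x(1) by (auto simp: dual_basis_def)
  qed (use D f fI in \<open>auto simp: dual_basis_def bij_betw_def inj_on_eq_iff\<close>)
  then have "rat_trace G h = (\<Sum>i<card I. \<phi> (f i) (h (b (f i))))" by (rule rat_trace_lessThan[OF _ h])
  also have "\<dots> = (\<Sum>i\<in>I. \<phi> i (h (b i)))" by (rule sum.reindex_bij_betw[OF f])
  finally show ?thesis .
qed

section \<open>Existence of rational bases\<close>

lemma rspan_rat_coords:
  assumes b: "b \<in> {..<r} \<rightarrow> carrier G" and "x \<in> rspan G (b ` {..<r})"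
  shows "\<exists>N c. rat_coords G b r x N c"
  using assms(2)
proof (induction rule: rspan.induct)
  case rspan_one
  show ?case using rat_coords_torsion[OF b torsion_el_one] by blast
next
  case (rspan_incl x)
  then show ?case using rat_coords_basis[OF b] by blast
next
  case (rspan_inv x)
  then show ?case using rat_coords_inv[OF b rspan_carrier] by blast
next
  case (rspan_mult x y)
  then show ?case using rat_coords_mult[OF b rspan_carrier rspan_carrier] by blast
next
  case (rspan_root x M)
  then obtain N c where "rat_coords G b r (x [^] M) N c" by blast
  then have "rat_coords G b r x (M * N) c"
    using rspan_root by (auto simp: rat_coords_def int_pow_pow)
  then show ?case by blast
qed

text \<open>A relation with nonzero coefficient at \<open>i\<close> can be solved for a multiple of
  \<open>b i\<close>; closure under roots then removes the multiple.\<close>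

lemma zlc_remove:
  assumes b: "b \<in> {..<r} \<rightarrow> carrier G" and i: "i < r"
    and t: "torsion_el G (zlc G b c r)" and c: "c i \<noteq> 0"
  shows "b i \<in> rspan G (b ` ({..<r} - {i}))"
proof -
  let ?B = "rspan G (b ` ({..<r} - {i}))"
  have bi: "b i \<in> carrier G" using b i by auto
  define y where "y = finprod G (\<lambda>j. b j [^] c j) ({..<r} - {i})"
  have fin: "finprod G (\<lambda>j. b j [^] c j) J \<in> ?B" if "finite J" "J \<subseteq> {..<r} - {i}" for J
    using that
  proof (induction J rule: finite_induct)
    case empty
    then show ?case by (simp add: rspan_one)
  next
    case (insert j J)
    have cl: "\<And>k. k \<in> insert j J \<Longrightarrow> b k \<in> carrier G" using insert.prems b by auto
    have "finprod G (\<lambda>j. b j [^] c j) (insert j J) = b j [^] c j \<otimes> finprod G (\<lambda>j. b j [^] c j) J"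
      using insert.hyps cl by (intro finprod_insert) auto
    moreover have "b j \<in> ?B" using insert.prems cl by (intro rspan_incl) auto
    ultimately show ?case using insert by (simp add: rspan_mult rspan_int_pow)
  qed
  have y: "y \<in> ?B" unfolding y_def by (rule fin) auto
  have yc: "y \<in> carrier G" using rspan_carrier[OF y] .
  have "zlc G b c r = finprod G (\<lambda>j. b j [^] c j) (insert i ({..<r} - {i}))"
    unfolding zlc_def using i by (simp add: insert_absorb)
  also have "\<dots> = b i [^] c i \<otimes> y"
    unfolding y_def using b i by (intro finprod_insert) auto
  finally obtain n :: int where n: "n \<noteq> 0" "(b i [^] c i \<otimes> y) [^] n = \<one>"
    using t by (auto simp: torsion_el_def)
  then have "b i [^] (c i * n) \<otimes> y [^] n = \<one>"
    using bi yc by (simp add: int_pow_distrib int_pow_pow)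
  then have "b i [^] (c i * n) = inv (y [^] n)"
    using bi yc by (metis int_pow_closed inv_equality)
  then have "b i [^] (c i * n) \<in> ?B" using y by (simp add: rspan_inv rspan_int_pow)
  then show ?thesis using rspan_root[OF bi, of "c i * n"] c n by auto
qed

text \<open>A spanning set of least cardinality is independent, since a nontrivial relation would
  make one of its members redundant.\<close>

lemma rational_basis_exists:
  assumes "finite F" "F \<subseteq> carrier G" "carrier G \<subseteq> rspan G F"
  shows "\<exists>b r. rational_basis G b r"
proof -
  define P where "P F \<longleftrightarrow> finite F \<and> F \<subseteq> carrier G \<and> carrier G \<subseteq> rspan G F" for F
  obtain F' where F': "P F'" and min: "\<And>F''. P F'' \<Longrightarrow> card F' \<le> card F''"
    using ex_has_least_nat[of P F card] assms P_def by blast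
  define r where "r = card F'"
  obtain b where bij: "bij_betw b {..<r} F'"
    using F' bij_betw_from_nat_into_finite unfolding P_def r_def by blast
  have im: "b ` {..<r} = F'" and inj: "inj_on b {..<r}" using bij by (auto simp: bij_betw_def)
  have b: "b \<in> {..<r} \<rightarrow> carrier G" using im F' by (auto simp: P_def)
  have "c i = 0" if t: "torsion_el G (zlc G b c r)" and i: "i < r" for c i
  proof (rule ccontr)
    assume c: "c i \<noteq> 0"
    let ?F = "b ` ({..<r} - {i})"
    have bi: "b i \<in> rspan G ?F" by (rule zlc_remove[OF b i t c])
    have "F' \<subseteq> rspan G ?F"
    proof
      fix x assume "x \<in> F'"
      then obtain j where j: "j < r" "x = b j" using im by auto
      show "x \<in> rspan G ?F"
        using bi j b by (cases "j = i") (auto intro: rspan_incl)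
    qed
    then have "carrier G \<subseteq> rspan G ?F" using rspan_trans[of F' ?F] F' unfolding P_def by blast
    then have "P ?F" using b by (auto simp: P_def)
    then have "r \<le> card ?F" using min r_def by simp
    moreover have "card ?F \<le> card ({..<r} - {i})" by (intro card_image_le) auto
    ultimately show False using i by simp
  qed
  moreover have "\<exists>N::int. N \<noteq> 0 \<and> (\<exists>c. torsion_el G (x [^] N \<otimes> inv (zlc G b c r)))"
    if x: "x \<in> carrier G" for x
    using rspan_rat_coords[OF b, of x] F' x im unfolding P_def rat_coords_def by blast
  ultimately have "rational_basis G b r" using b by (auto simp: rational_basis_def)
  then show ?thesis by blast
qed

end

section \<open>Mayer--Vietoris and finiteness of homology\<close>

definition mv_excision :: "int \<Rightarrow> 'a topology \<Rightarrow> 'a set \<Rightarrow> 'a set \<Rightarrow> 'a chain set \<Rightarrow> 'a chain set" where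
  "mv_excision p X A B = hom_induced p (subtopology X A) (A \<inter> B) X B id"

text \<open>The connecting map of the Mayer--Vietoris sequence: from \<open>X\<close> to the pair
  \<open>(X, B)\<close>, back along excision to the pair \<open>(A, A \<inter> B)\<close>, then the
  boundary of that pair.\<close>

definition mv_boundary :: "int \<Rightarrow> 'a topology \<Rightarrow> 'a set \<Rightarrow> 'a set \<Rightarrow> 'a chain set \<Rightarrow> 'a chain set" where
  "mv_boundary p X A B = (\<lambda>c. hom_boundary p (subtopology X A) (A \<inter> B)
     (inv_into (carrier (relative_homology_group p (subtopology X A) (A \<inter> B))) (mv_excision p X A B)
       (hom_induced p X {} X B id c)))"

context
  fixes X :: "'a topology" and A B :: "'a set"
  assumes A: "openin X A" and B: "openin X B" and AB: "A \<union> B = topspace X"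
begin

text \<open>The excised set \<open>topspace X - A\<close> is closed and, since \<open>A\<close> and
  \<open>B\<close> cover, contained in the open set \<open>B\<close>.\<close>

lemma mv_excision_iso:
  "mv_excision p X A B \<in> iso (relative_homology_group p (subtopology X A) (A \<inter> B)) (relative_homology_group p X B)"
proof -
  have "X closure_of (topspace X - A) = topspace X - A"
    by (simp add: closure_of_eq closedin_diff A)
  moreover have "X interior_of B = B" using B by (simp add: interior_of_openin)
  ultimately have "hom_induced p (subtopology X (topspace X - (topspace X - A))) (B - (topspace X - A))
      (subtopology X (topspace X)) B id
    \<in> iso (relative_homology_group p (subtopology X (topspace X - (topspace X - A))) (B - (topspace X - A)))
          (relative_homology_group p (subtopology X (topspace X)) B)"
    using AB by (intro homology_excision_axiom) auto
  moreover have "topspace X - (topspace X - A) = A" "B - (topspace X - A) = A \<inter> B"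
    using AB by auto
  ultimately show ?thesis by (simp add: mv_excision_def)
qed

lemma mv_excision_bij:
  "bij_betw (mv_excision p X A B) (carrier (relative_homology_group p (subtopology X A) (A \<inter> B)))
     (carrier (relative_homology_group p X B))"
  using mv_excision_iso by (simp add: iso_def)

lemma mv_excision_inv:
  "c \<in> carrier (relative_homology_group p X B) \<Longrightarrow>
   inv_into (carrier (relative_homology_group p (subtopology X A) (A \<inter> B))) (mv_excision p X A B) c
     \<in> carrier (relative_homology_group p (subtopology X A) (A \<inter> B)) \<and>
   mv_excision p X A B
     (inv_into (carrier (relative_homology_group p (subtopology X A) (A \<inter> B))) (mv_excision p X A B) c) = c"
  using mv_excision_bij[of p] by (metis bij_betw_imp_surj_on f_inv_into_f inv_into_into)

text \<open>Any preimage under excision computes the connecting map; additivity, exactness and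
  naturality all go through such a preimage.\<close>

lemma mv_boundary_eq:
  assumes "d \<in> carrier (relative_homology_group p (subtopology X A) (A \<inter> B))"
    and "mv_excision p X A B d = hom_induced p X {} X B id c"
  shows "mv_boundary p X A B c = hom_boundary p (subtopology X A) (A \<inter> B) d"
  using assms mv_excision_bij[of p] unfolding mv_boundary_def
  by (metis bij_betw_inv_into_left)

lemma mv_excision_obtain:
  obtains d where "d \<in> carrier (relative_homology_group p (subtopology X A) (A \<inter> B))"
    and "mv_excision p X A B d = hom_induced p X {} X B id c"
  using mv_excision_inv[OF hom_induced_carrier] by blast

lemma subtopology_Int_absorb: "subtopology (subtopology X A) (A \<inter> B) = subtopology X (A \<inter> B)"
  by (simp add: subtopology_subtopology Int_absorb1 flip: Int_assoc)

lemma mv_boundary_hom: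
  "mv_boundary p X A B \<in> hom (homology_group p X) (homology_group (p - 1) (subtopology X (A \<inter> B)))"
proof (rule homI)
  fix c
  show "mv_boundary p X A B c \<in> carrier (homology_group (p - 1) (subtopology X (A \<inter> B)))"
    unfolding mv_boundary_def using hom_boundary_carrier[of p "subtopology X A" "A \<inter> B"]
    by (simp add: subtopology_Int_absorb)
next
  fix c c' assume c: "c \<in> carrier (homology_group p X)" "c' \<in> carrier (homology_group p X)"
  obtain d where d: "d \<in> carrier (relative_homology_group p (subtopology X A) (A \<inter> B))"
    "mv_excision p X A B d = hom_induced p X {} X B id c" using mv_excision_obtain .
  obtain d' where d': "d' \<in> carrier (relative_homology_group p (subtopology X A) (A \<inter> B))"
    "mv_excision p X A B d' = hom_induced p X {} X B id c'" using mv_excision_obtain .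
  let ?R = "relative_homology_group p (subtopology X A) (A \<inter> B)"
  have hom: "mv_excision p X A B \<in> hom ?R (relative_homology_group p X B)"
    unfolding mv_excision_def by (rule hom_induced_hom)
  have dd: "d \<otimes>\<^bsub>?R\<^esub> d' \<in> carrier ?R"
    using d d' by (simp add: group.is_monoid monoid.m_closed)
  have "mv_excision p X A B (d \<otimes>\<^bsub>?R\<^esub> d') =
     hom_induced p X {} X B id (c \<otimes>\<^bsub>homology_group p X\<^esub> c')"
    using d d' c by (simp add: hom_mult[OF hom] hom_mult[OF hom_induced_hom])
  from mv_boundary_eq[OF dd this] mv_boundary_eq[OF d] mv_boundary_eq[OF d']
  show "mv_boundary p X A B (c \<otimes>\<^bsub>homology_group p X\<^esub> c') =
     mv_boundary p X A B c \<otimes>\<^bsub>homology_group (p - 1) (subtopology X (A \<inter> B))\<^esub> mv_boundary p X A B c'"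
    using d d' hom_mult[OF hom_boundary_hom[of p "subtopology X A" "A \<inter> B"]]
    by (simp add: subtopology_Int_absorb)
qed

text \<open>Exactness at \<open>X\<close>: an excision preimage \<open>d\<close> with vanishing
  boundary comes from a class \<open>a\<close> of \<open>A\<close>; the difference of
  \<open>c\<close> and the image of \<open>a\<close> dies in the homology of the pair
  \<open>(X, B)\<close> and therefore comes from \<open>B\<close>.\<close>

lemma mv_boundary_kernel:
  assumes c: "c \<in> carrier (homology_group p X)"
    and 0: "mv_boundary p X A B c = \<one>\<^bsub>homology_group (p - 1) (subtopology X (A \<inter> B))\<^esub>"
  obtains a b where "a \<in> carrier (homology_group p (subtopology X A))"
    "b \<in> carrier (homology_group p (subtopology X B))"
    "c = hom_induced p (subtopology X A) {} X {} id a \<otimes>\<^bsub>homology_group p X\<^esub>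
         hom_induced p (subtopology X B) {} X {} id b"
proof -
  let ?H = "homology_group p X"
  interpret H: comm_group ?H by simp
  interpret RB: group "relative_homology_group p X B" by simp
  let ?R = "relative_homology_group p (subtopology X A) (A \<inter> B)"
  obtain d where d: "d \<in> carrier ?R" "mv_excision p X A B d = hom_induced p X {} X B id c"
    using mv_excision_obtain .
  have "hom_boundary p (subtopology X A) (A \<inter> B) d =
      \<one>\<^bsub>homology_group (p - 1) (subtopology (subtopology X A) (A \<inter> B))\<^esub>"
    using mv_boundary_eq[OF d] 0 by (simp add: subtopology_Int_absorb)
  then have "d \<in> kernel ?R (homology_group (p - 1) (subtopology (subtopology X A) (A \<inter> B)))
      (hom_boundary p (subtopology X A) (A \<inter> B))"
    using d by (simp add: kernel_def)
  then obtain a where a: "a \<in> carrier (homology_group p (subtopology X A))"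
    "d = hom_induced p (subtopology X A) {} (subtopology X A) (A \<inter> B) id a"
    using homology_exactness_axiom_1[of p "subtopology X A" "A \<inter> B"] by auto
  define a' where "a' = hom_induced p (subtopology X A) {} X {} id a"
  have a': "a' \<in> carrier ?H" unfolding a'_def by (rule hom_induced_carrier)
  have "hom_induced p X {} X B id a' = mv_excision p X A B d"
    unfolding a'_def mv_excision_def a(2)
    by (simp add: hom_induced_compose' continuous_map_from_subtopology)
  then have "hom_induced p X {} X B id (c \<otimes>\<^bsub>?H\<^esub> inv\<^bsub>?H\<^esub> a') = \<one>\<^bsub>relative_homology_group p X B\<^esub>"
    using a' c d(2) group_hom.hom_inv[of ?H "relative_homology_group p X B" "hom_induced p X {} X B id" a']
    by (simp add: hom_mult[OF hom_induced_hom] group_hom_def group_hom_axioms_def hom_induced_hom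
        RB.r_inv hom_induced_carrier)
  then have "c \<otimes>\<^bsub>?H\<^esub> inv\<^bsub>?H\<^esub> a' \<in> kernel ?H (relative_homology_group p X B) (hom_induced p X {} X B id)"
    using a' c by (simp add: kernel_def)
  then obtain b where b: "b \<in> carrier (homology_group p (subtopology X B))"
    "c \<otimes>\<^bsub>?H\<^esub> inv\<^bsub>?H\<^esub> a' = hom_induced p (subtopology X B) {} X {} id b"
    using homology_exactness_axiom_3[of p X B] by auto
  have "c = a' \<otimes>\<^bsub>?H\<^esub> (c \<otimes>\<^bsub>?H\<^esub> inv\<^bsub>?H\<^esub> a')"
    using a' c H.m_lcomm[of a' c "inv\<^bsub>?H\<^esub> a'"] by simp
  then show ?thesis using that[OF a(1) b(1)] b(2) a'_def by simp
qed

text \<open>Two consecutive maps in the exact sequence of the pair \<open>(A, A \<inter> B)\<close>.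
  This forces the connecting map to vanish wherever the intersection injects into \<open>A\<close>
  in homology.\<close>

lemma mv_boundary_inclusion:
  "hom_induced (p - 1) (subtopology X (A \<inter> B)) {} (subtopology X A) {} id (mv_boundary p X A B c)
     = \<one>\<^bsub>homology_group (p - 1) (subtopology X A)\<^esub>"
proof -
  obtain d where d: "d \<in> carrier (relative_homology_group p (subtopology X A) (A \<inter> B))"
    "mv_excision p X A B d = hom_induced p X {} X B id c" using mv_excision_obtain .
  have "hom_boundary p (subtopology X A) (A \<inter> B) d \<in>
     kernel (homology_group (p - 1) (subtopology (subtopology X A) (A \<inter> B))) (homology_group (p - 1) (subtopology X A))
      (hom_induced (p - 1) (subtopology (subtopology X A) (A \<inter> B)) {} (subtopology X A) {} id)"
    using homology_exactness_axiom_2[of p "subtopology X A" "A \<inter> B"] d by auto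
  then show ?thesis
    using mv_boundary_eq[OF d] by (simp add: kernel_def subtopology_Int_absorb)
qed

end

text \<open>The map of pairs induced by \<open>f\<close> carries an excision preimage for
  \<open>c\<close> to one for the image of \<open>c\<close>.\<close>

lemma mv_boundary_natural:
  assumes AB: "openin X A" "openin X B" "A \<union> B = topspace X"
    and AB': "openin Y A'" "openin Y B'" "A' \<union> B' = topspace Y"
    and f: "continuous_map X Y f" "f \<in> A \<rightarrow> A'" "f \<in> B \<rightarrow> B'"
  shows "mv_boundary p Y A' B' (hom_induced p X {} Y {} f c) =
    hom_induced (p - 1) (subtopology X (A \<inter> B)) {} (subtopology Y (A' \<inter> B')) {} f (mv_boundary p X A B c)"
proof -
  obtain d where d: "d \<in> carrier (relative_homology_group p (subtopology X A) (A \<inter> B))"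
    "mv_excision p X A B d = hom_induced p X {} X B id c"
    using mv_excision_obtain[OF AB] .
  let ?d = "hom_induced p (subtopology X A) (A \<inter> B) (subtopology Y A') (A' \<inter> B') f d"
  have fA: "continuous_map (subtopology X A) (subtopology Y A') f"
    using f by (auto simp: continuous_map_in_subtopology continuous_map_from_subtopology)
  have fAB: "f \<in> A \<inter> B \<rightarrow> A' \<inter> B'" using f by auto
  have "mv_excision p Y A' B' ?d = hom_induced p X B Y B' f (mv_excision p X A B d)"
    unfolding mv_excision_def using fA fAB f
    by (simp add: hom_induced_compose' continuous_map_from_subtopology Pi_iff)
  also have "\<dots> = hom_induced p Y {} Y B' id (hom_induced p X {} Y {} f c)"
    unfolding d(2) using f by (simp add: hom_induced_compose')
  finally have "mv_boundary p Y A' B' (hom_induced p X {} Y {} f c) =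
      hom_boundary p (subtopology Y A') (A' \<inter> B') ?d"
    by (intro mv_boundary_eq[OF AB'] hom_induced_carrier)
  also have "\<dots> = hom_induced (p - 1) (subtopology (subtopology X A) (A \<inter> B)) {}
      (subtopology (subtopology Y A') (A' \<inter> B')) {} f (hom_boundary p (subtopology X A) (A \<inter> B) d)"
    using fun_cong[OF naturality_hom_induced[OF fA fAB, of p], of d] by simp
  finally show ?thesis
    using mv_boundary_eq[OF AB d] by (simp add: subtopology_Int_absorb[OF AB] subtopology_Int_absorb[OF AB'])
qed

lemma hom_induced_group_hom:
  "group_hom (homology_group p X) (homology_group p Y) (hom_induced p X {} Y {} f)"
  by (simp add: group_hom_def group_hom_axioms_def hom_induced_hom)

section \<open>Inclusions whose image in homology has finite rank\<close>

definition incl_hom :: "int \<Rightarrow> 'a topology \<Rightarrow> 'a set \<Rightarrow> 'a set \<Rightarrow> 'a chain set \<Rightarrow> 'a chain set" where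
  "incl_hom p X V U = hom_induced p (subtopology X V) {} (subtopology X U) {} id"

definition finite_homology_incl :: "'a topology \<Rightarrow> 'a set \<Rightarrow> 'a set \<Rightarrow> bool" where
  "finite_homology_incl X V U \<longleftrightarrow>
     (\<forall>p. \<exists>F. finite F \<and> F \<subseteq> carrier (homology_group p (subtopology X U)) \<and>
        incl_hom p X V U ` carrier (homology_group p (subtopology X V))
          \<subseteq> rspan (homology_group p (subtopology X U)) F) \<and>
     (\<exists>D. \<forall>p\<ge>D. \<forall>x\<in>carrier (homology_group p (subtopology X V)).
        incl_hom p X V U x = \<one>\<^bsub>homology_group p (subtopology X U)\<^esub>)"

lemma incl_hom_group_hom:
  "group_hom (homology_group p (subtopology X V)) (homology_group p (subtopology X U)) (incl_hom p X V U)"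
  by (simp add: incl_hom_def hom_induced_group_hom)

lemma incl_hom_closed: "incl_hom p X V U c \<in> carrier (homology_group p (subtopology X U))"
  by (simp add: incl_hom_def hom_induced_carrier)

lemma incl_hom_compose:
  assumes "V \<subseteq> W" "W \<subseteq> U"
  shows "incl_hom p X W U (incl_hom p X V W c) = incl_hom p X V U c"
proof -
  have "continuous_map (subtopology X V) (subtopology X W) id"
    "continuous_map (subtopology X W) (subtopology X U) id"
    using assms by (auto simp: continuous_map_in_subtopology continuous_map_from_subtopology)
  then show ?thesis by (simp add: incl_hom_def hom_induced_compose')
qed

text \<open>The inclusion of \<open>V\<close> in \<open>U\<close> factors through that of
  \<open>W'\<close> in \<open>W\<close>.\<close>

lemma finite_homology_incl_subset:
  assumes "finite_homology_incl X W' W" "V \<subseteq> W'" "W' \<subseteq> W" "W \<subseteq> U"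
  shows "finite_homology_incl X V U"
  unfolding finite_homology_incl_def
proof (intro conjI allI)
  have eq: "incl_hom p X V U c = incl_hom p X W U (incl_hom p X W' W (incl_hom p X V W' c))" for p c
    using assms by (simp add: incl_hom_compose)
  fix p
  interpret group_hom "homology_group p (subtopology X W)" "homology_group p (subtopology X U)" "incl_hom p X W U"
    by (rule incl_hom_group_hom)
  obtain F where F: "finite F" "F \<subseteq> carrier (homology_group p (subtopology X W))"
    "incl_hom p X W' W ` carrier (homology_group p (subtopology X W'))
          \<subseteq> rspan (homology_group p (subtopology X W)) F"
    using assms(1) unfolding finite_homology_incl_def by blast
  show "\<exists>F. finite F \<and> F \<subseteq> carrier (homology_group p (subtopology X U)) \<and>
        incl_hom p X V U ` carrier (homology_group p (subtopology X V))
          \<subseteq> rspan (homology_group p (subtopology X U)) F"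
  proof (intro exI[of _ "incl_hom p X W U ` F"] conjI)
    show "incl_hom p X V U ` carrier (homology_group p (subtopology X V))
          \<subseteq> rspan (homology_group p (subtopology X U)) (incl_hom p X W U ` F)"
      unfolding eq using F(3) incl_hom_closed by (force intro!: rspan_hom)
  qed (use F incl_hom_closed in auto)
next
  obtain D where D: "\<And>p x. p \<ge> D \<Longrightarrow> x \<in> carrier (homology_group p (subtopology X W')) \<Longrightarrow>
        incl_hom p X W' W x = \<one>\<^bsub>homology_group p (subtopology X W)\<^esub>"
    using assms(1) unfolding finite_homology_incl_def by blast
  have eq: "incl_hom p X V U c = incl_hom p X W U (incl_hom p X W' W (incl_hom p X V W' c))" for p c
    using assms by (simp add: incl_hom_compose)
  show "\<exists>D. \<forall>p\<ge>D. \<forall>x\<in>carrier (homology_group p (subtopology X V)).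
        incl_hom p X V U x = \<one>\<^bsub>homology_group p (subtopology X U)\<^esub>"
    unfolding eq using D incl_hom_closed group_hom.hom_one[OF incl_hom_group_hom] by metis
qed

text \<open>Presents two open sets as an open cover of the subspace \<open>A \<union> B\<close>,
  where the nested subtopologies collapse.\<close>

lemma mv_setup:
  assumes "openin X A" "openin X B"
  shows "openin (subtopology X (A \<union> B)) A" "openin (subtopology X (A \<union> B)) B"
    "A \<union> B = topspace (subtopology X (A \<union> B))"
    "subtopology (subtopology X (A \<union> B)) A = subtopology X A"
    "subtopology (subtopology X (A \<union> B)) B = subtopology X B"
    "subtopology (subtopology X (A \<union> B)) (A \<inter> B) = subtopology X (A \<inter> B)"
proof -
  show "openin (subtopology X (A \<union> B)) A" "openin (subtopology X (A \<union> B)) B"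
    using assms by (auto simp: openin_open_subtopology openin_Un)
  show "A \<union> B = topspace (subtopology X (A \<union> B))"
    using openin_subset[OF assms(1)] openin_subset[OF assms(2)] by auto
  have "(A \<union> B) \<inter> A = A" "(A \<union> B) \<inter> B = B" "(A \<union> B) \<inter> (A \<inter> B) = A \<inter> B" by auto
  then show "subtopology (subtopology X (A \<union> B)) A = subtopology X A"
    "subtopology (subtopology X (A \<union> B)) B = subtopology X B"
    "subtopology (subtopology X (A \<union> B)) (A \<inter> B) = subtopology X (A \<inter> B)"
    by (simp_all add: subtopology_subtopology)
qed

lemma mv_Un_kernel:
  assumes o: "openin X A" "openin X B"
    and c: "c \<in> carrier (homology_group p (subtopology X (A \<union> B)))"
    and 0: "mv_boundary p (subtopology X (A \<union> B)) A B c = \<one>\<^bsub>homology_group (p - 1) (subtopology X (A \<inter> B))\<^esub>"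
  obtains a b where "a \<in> carrier (homology_group p (subtopology X A))"
    "b \<in> carrier (homology_group p (subtopology X B))"
    "c = incl_hom p X A (A \<union> B) a \<otimes>\<^bsub>homology_group p (subtopology X (A \<union> B))\<^esub> incl_hom p X B (A \<union> B) b"
  using mv_boundary_kernel[OF mv_setup(1-3)[OF o] c] 0
  unfolding mv_setup(4-6)[OF o] incl_hom_def by blast

text \<open>A class of \<open>V1 \<union> V2\<close> is controlled in two stages, hence the two
  layers of open sets. Its boundary is known to have finite rank only in the larger intersection
  \<open>V1' \<inter> V2'\<close>; once that boundary has been corrected to zero, the class splits
  over \<open>V1'\<close> and \<open>V2'\<close>, and the pieces are known to have finite rank only
  in \<open>U\<close>.\<close>

lemma finite_homology_incl_Un:
  assumes o: "openin X V1" "openin X V2" "openin X V1'" "openin X V2'"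
    and sub: "V1 \<subseteq> V1'" "V2 \<subseteq> V2'" "V1' \<subseteq> U" "V2' \<subseteq> U"
    and fin: "finite_homology_incl X V1' U" "finite_homology_incl X V2' U"
      "finite_homology_incl X (V1 \<inter> V2) (V1' \<inter> V2')"
  shows "finite_homology_incl X (V1 \<union> V2) U"
proof -
  let ?V = "V1 \<union> V2" and ?V' = "V1' \<union> V2'"
  let ?H = "\<lambda>p W. homology_group p (subtopology X W)"
  let ?\<Delta> = "\<lambda>p. mv_boundary p (subtopology X ?V) V1 V2"
  let ?\<Delta>' = "\<lambda>p. mv_boundary p (subtopology X ?V') V1' V2'"
  have \<Delta>hom: "group_hom (?H p ?V) (?H (p - 1) (V1 \<inter> V2)) (?\<Delta> p)" for p
    using mv_boundary_hom[OF mv_setup(1-3)[OF o(1,2)], of p] mv_setup(6)[OF o(1,2)]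
    by (simp add: group_hom_def group_hom_axioms_def)
  have \<Delta>'hom: "group_hom (?H p ?V') (?H (p - 1) (V1' \<inter> V2')) (?\<Delta>' p)" for p
    using mv_boundary_hom[OF mv_setup(1-3)[OF o(3,4)], of p] mv_setup(6)[OF o(3,4)]
    by (simp add: group_hom_def group_hom_axioms_def)
  have VV': "?V \<subseteq> ?V'" "?V' \<subseteq> U" using sub by auto
  have id: "continuous_map (subtopology X ?V) (subtopology X ?V') id"
    using VV' by (auto simp: continuous_map_in_subtopology continuous_map_from_subtopology)
  \<comment> \<open>Naturality turns the boundary of an enlarged class into an enlarged boundary, to
    which the finiteness hypothesis on the intersections applies.\<close>
  have nat: "?\<Delta>' p (incl_hom p X ?V ?V' c) = incl_hom (p - 1) X (V1 \<inter> V2) (V1' \<inter> V2') (?\<Delta> p c)" for p c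
    using mv_boundary_natural[OF mv_setup(1-3)[OF o(1,2)] mv_setup(1-3)[OF o(3,4)] id, of p c] sub
    unfolding incl_hom_def mv_setup(6)[OF o(1,2)] mv_setup(6)[OF o(3,4)] by (simp add: subset_iff)
  have split: "\<exists>a\<in>carrier (?H p V1'). \<exists>b\<in>carrier (?H p V2'). incl_hom p X ?V' U c =
       incl_hom p X V1' U a \<otimes>\<^bsub>?H p U\<^esub> incl_hom p X V2' U b"
    if c: "c \<in> carrier (?H p ?V')" and 0: "?\<Delta>' p c = \<one>\<^bsub>?H (p - 1) (V1' \<inter> V2')\<^esub>" for p c
  proof -
    obtain a b where ab: "a \<in> carrier (?H p V1')" "b \<in> carrier (?H p V2')"
      "c = incl_hom p X V1' ?V' a \<otimes>\<^bsub>?H p ?V'\<^esub> incl_hom p X V2' ?V' b"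
      using mv_Un_kernel[OF o(3,4) c 0] .
    have "incl_hom p X ?V' U c = incl_hom p X ?V' U (incl_hom p X V1' ?V' a) \<otimes>\<^bsub>?H p U\<^esub>
        incl_hom p X ?V' U (incl_hom p X V2' ?V' b)"
      unfolding ab(3) by (rule group_hom.hom_mult[OF incl_hom_group_hom incl_hom_closed incl_hom_closed])
    also have "\<dots> = incl_hom p X V1' U a \<otimes>\<^bsub>?H p U\<^esub> incl_hom p X V2' U b"
      using VV' by (simp add: incl_hom_compose)
    finally show ?thesis using ab by blast
  qed
  show ?thesis
    unfolding finite_homology_incl_def
  proof (intro conjI allI)
    fix p
    interpret j: group_hom "?H p ?V" "?H p ?V'" "incl_hom p X ?V ?V'" by (rule incl_hom_group_hom)
    interpret k: group_hom "?H p ?V'" "?H p U" "incl_hom p X ?V' U" by (rule incl_hom_group_hom)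
    interpret d': group_hom "?H p ?V'" "?H (p - 1) (V1' \<inter> V2')" "?\<Delta>' p" by (rule \<Delta>'hom)
    note mono = group.rspan_mono[OF group_relative_homology_group, of _ _ p "subtopology X U" "{}"]
    interpret C0: comm_group "?H (p - 1) (V1' \<inter> V2')" by simp
    define g where "g = (\<lambda>c. ?\<Delta>' p (incl_hom p X ?V ?V' c))"
    have ghom: "group_hom (?H p ?V) (?H (p - 1) (V1' \<inter> V2')) g"
      using hom_compose[OF j.homh d'.homh] by (simp add: g_def comp_def group_hom_def group_hom_axioms_def)
    interpret g: group_hom "?H p ?V" "?H (p - 1) (V1' \<inter> V2')" g by (rule ghom)
    obtain F0 where F0: "finite F0" "F0 \<subseteq> carrier (?H (p - 1) (V1' \<inter> V2'))"
      "incl_hom (p - 1) X (V1 \<inter> V2) (V1' \<inter> V2') ` carrier (?H (p - 1) (V1 \<inter> V2))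
         \<subseteq> rspan (?H (p - 1) (V1' \<inter> V2')) F0"
      using fin(3) unfolding finite_homology_incl_def by blast
    have "g ` carrier (?H p ?V) \<subseteq> rspan (?H (p - 1) (V1' \<inter> V2')) F0"
      unfolding g_def nat using F0(3) group_hom.hom_closed[OF \<Delta>hom] by blast
    \<comment> \<open>The members of \<open>F0\<close> need not be values of \<open>g\<close>.
      Generators inside the image of \<open>g\<close> are required so that they lift to a finite set
      \<open>B\<close> of classes of \<open>?V\<close>.\<close>
    from C0.rspan_finite_subgroup[OF F0(1,2) g.img_is_subgroup this]
    obtain F1 where F1: "finite F1" "F1 \<subseteq> g ` carrier (?H p ?V)"
      "g ` carrier (?H p ?V) \<subseteq> rspan (?H (p - 1) (V1' \<inter> V2')) F1" by blast
    obtain B where B: "finite B" "B \<subseteq> carrier (?H p ?V)" "F1 = g ` B"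
      using finite_subset_image[OF F1(1,2)] by blast
    obtain Fa where Fa: "finite Fa" "Fa \<subseteq> carrier (?H p U)"
      "incl_hom p X V1' U ` carrier (?H p V1') \<subseteq> rspan (?H p U) Fa"
      using fin(1) unfolding finite_homology_incl_def by blast
    obtain Fb where Fb: "finite Fb" "Fb \<subseteq> carrier (?H p U)"
      "incl_hom p X V2' U ` carrier (?H p V2') \<subseteq> rspan (?H p U) Fb"
      using fin(2) unfolding finite_homology_incl_def by blast
    define F where "F = Fa \<union> Fb \<union> incl_hom p X ?V U ` B"
    have kj: "incl_hom p X ?V' U (incl_hom p X ?V ?V' c) = incl_hom p X ?V U c" for c
      using VV' by (simp add: incl_hom_compose)
    have "incl_hom p X ?V U x \<in> rspan (?H p U) F" if x: "x \<in> carrier (?H p ?V)" for x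
    proof -
      interpret i: group_hom "?H p ?V" "?H p U" "incl_hom p X ?V U" by (rule incl_hom_group_hom)
      interpret CV: comm_group "?H p ?V" by simp
      have "g x \<in> rspan (?H (p - 1) (V1' \<inter> V2')) (g ` B)" using F1(3) B(3) x by auto
      from rspan_lift[OF ghom _ _ B(2) this]
      obtain N :: int and y where Ny: "N \<noteq> 0" "y \<in> rspan (?H p ?V) B"
        "g x [^]\<^bsub>?H (p - 1) (V1' \<inter> V2')\<^esub> N = g y" by auto
      have y: "y \<in> carrier (?H p ?V)" using Ny(2) by (rule group.rspan_carrier[OF group_relative_homology_group])
      \<comment> \<open>Removing the lift \<open>y\<close> leaves a class whose boundary in the
        larger intersection vanishes, so that \<open>split\<close> applies to it.\<close>
      define z where "z = x [^]\<^bsub>?H p ?V\<^esub> N \<otimes>\<^bsub>?H p ?V\<^esub> inv\<^bsub>?H p ?V\<^esub> y"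
      have z: "z \<in> carrier (?H p ?V)" using x y by (simp add: z_def)
      have "g z = \<one>\<^bsub>?H (p - 1) (V1' \<inter> V2')\<^esub>"
        using x y Ny(3) by (simp add: z_def g.hom_int_pow)
      then have "?\<Delta>' p (incl_hom p X ?V ?V' z) = \<one>\<^bsub>?H (p - 1) (V1' \<inter> V2')\<^esub>" by (simp add: g_def)
      from split[OF incl_hom_closed this] obtain a b where
        ab: "a \<in> carrier (?H p V1')" "b \<in> carrier (?H p V2')"
        "incl_hom p X ?V U z = incl_hom p X V1' U a \<otimes>\<^bsub>?H p U\<^esub> incl_hom p X V2' U b"
        unfolding kj by blast
      have "incl_hom p X V1' U a \<in> rspan (?H p U) F"
        using Fa(3) ab(1) mono[of Fa F] unfolding F_def by blast
      moreover have "incl_hom p X V2' U b \<in> rspan (?H p U) F"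
        using Fb(3) ab(2) mono[of Fb F] unfolding F_def by blast
      ultimately have zF: "incl_hom p X ?V U z \<in> rspan (?H p U) F"
        unfolding ab(3) by (rule rspan_mult)
      have "incl_hom p X ?V U y \<in> rspan (?H p U) (incl_hom p X ?V U ` B)"
        by (rule i.rspan_hom[OF Ny(2)])
      then have yF: "incl_hom p X ?V U y \<in> rspan (?H p U) F"
        using mono[of "incl_hom p X ?V U ` B" F] unfolding F_def by blast
      have "x [^]\<^bsub>?H p ?V\<^esub> N = z \<otimes>\<^bsub>?H p ?V\<^esub> y"
        using x y by (simp add: z_def monoid.m_assoc group.is_monoid)
      then have "incl_hom p X ?V U x [^]\<^bsub>?H p U\<^esub> N = incl_hom p X ?V U z \<otimes>\<^bsub>?H p U\<^esub> incl_hom p X ?V U y"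
        using x y z by (metis i.hom_int_pow i.hom_mult)
      then have "incl_hom p X ?V U x [^]\<^bsub>?H p U\<^esub> N \<in> rspan (?H p U) F"
        using zF yF by (simp add: rspan_mult)
      then show ?thesis using rspan_root[OF incl_hom_closed Ny(1)] by blast
    qed
    then show "\<exists>F. finite F \<and> F \<subseteq> carrier (?H p U) \<and> incl_hom p X ?V U ` carrier (?H p ?V) \<subseteq> rspan (?H p U) F"
      using Fa Fb B incl_hom_closed[of p X ?V U] by (intro exI[of _ F]) (auto simp: F_def)
  next
    obtain D1 where D1: "\<And>p x. p \<ge> D1 \<Longrightarrow> x \<in> carrier (?H p V1') \<Longrightarrow> incl_hom p X V1' U x = \<one>\<^bsub>?H p U\<^esub>"
      using fin(1) unfolding finite_homology_incl_def by blast
    obtain D2 where D2: "\<And>p x. p \<ge> D2 \<Longrightarrow> x \<in> carrier (?H p V2') \<Longrightarrow> incl_hom p X V2' U x = \<one>\<^bsub>?H p U\<^esub>"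
      using fin(2) unfolding finite_homology_incl_def by blast
    obtain D3 where D3: "\<And>p x. p \<ge> D3 \<Longrightarrow> x \<in> carrier (?H p (V1 \<inter> V2)) \<Longrightarrow>
        incl_hom p X (V1 \<inter> V2) (V1' \<inter> V2') x = \<one>\<^bsub>?H p (V1' \<inter> V2')\<^esub>"
      using fin(3) unfolding finite_homology_incl_def by blast
    show "\<exists>D. \<forall>p\<ge>D. \<forall>x\<in>carrier (?H p ?V). incl_hom p X ?V U x = \<one>\<^bsub>?H p U\<^esub>"
    \<comment> \<open>The boundary lowers the degree by one, hence \<open>D3 + 1\<close>.\<close>
    proof (intro exI[of _ "max D1 (max D2 (D3 + 1))"] allI impI ballI)
      fix p x assume p: "max D1 (max D2 (D3 + 1)) \<le> p" and x: "x \<in> carrier (?H p ?V)"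
      interpret CU: comm_group "?H p U" by simp
      have "?\<Delta>' p (incl_hom p X ?V ?V' x) = \<one>\<^bsub>?H (p - 1) (V1' \<inter> V2')\<^esub>"
        unfolding nat using p by (intro D3 group_hom.hom_closed[OF \<Delta>hom] x) auto
      from split[OF incl_hom_closed this] obtain a b where
        ab: "a \<in> carrier (?H p V1')" "b \<in> carrier (?H p V2')"
        "incl_hom p X ?V' U (incl_hom p X ?V ?V' x) = incl_hom p X V1' U a \<otimes>\<^bsub>?H p U\<^esub> incl_hom p X V2' U b"
        by blast
      then show "incl_hom p X ?V U x = \<one>\<^bsub>?H p U\<^esub>"
        using p D1[OF _ ab(1)] D2[OF _ ab(2)] VV' by (simp add: incl_hom_compose)
    qed
  qed
qed

section \<open>Homology of compact manifolds\<close>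

definition point_class :: "'a topology \<Rightarrow> 'a \<Rightarrow> 'a chain set" where
  "point_class Y a = homologous_rel_set 0 Y {} (frag_of (restrict (\<lambda>_. a) (standard_simplex 0)))"

lemma singular_simplex_point: "a \<in> topspace Y \<Longrightarrow> singular_simplex 0 Y (restrict (\<lambda>_. a) (standard_simplex 0))"
  by (simp add: singular_simplex_def)

lemma singular_relcycle_point:
  "a \<in> topspace Y \<Longrightarrow> singular_relcycle 0 Y {} (frag_of (restrict (\<lambda>_. a) (standard_simplex 0)))"
  by (simp add: chain_boundary_def singular_simplex_point singular_chain_of singular_cycle)

lemma point_class_closed: "a \<in> topspace Y \<Longrightarrow> point_class Y a \<in> carrier (homology_group 0 Y)"
  unfolding point_class_def carrier_relative_homology_group_0
  by (intro imageI CollectI singular_relcycle_point)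

lemma hom_induced_point_class:
  assumes "continuous_map Y Z f" "a \<in> topspace Y"
  shows "hom_induced 0 Y {} Z {} f (point_class Y a) = point_class Z (f a)"
proof -
  have "hom_induced (int 0) Y {} Z {} f (point_class Y a) =
      homologous_rel_set 0 Z {} (chain_map 0 f (frag_of (restrict (\<lambda>_. a) (standard_simplex 0))))"
    unfolding point_class_def using assms singular_relcycle_point by (intro hom_induced_chain_map) auto
  moreover have "simplex_map 0 f (restrict (\<lambda>_. a) (standard_simplex 0)) = restrict (\<lambda>_. f a) (standard_simplex 0)"
    by (auto simp: simplex_map_def restrict_def)
  ultimately show ?thesis by (simp add: point_class_def chain_map_of)
qed

lemma point_class_iso:
  assumes "path_connected_space Y" "a \<in> topspace Y"
  shows "pow (homology_group 0 Y) (point_class Y a) \<in> iso integer_group (homology_group 0 Y)"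
  unfolding point_class_def
  using iso_integer_zeroth_homology_group[OF assms(1) singular_simplex_point[OF assms(2)]] .

lemma homology_0_cases:
  assumes "path_connected_space Y" "a \<in> topspace Y" "x \<in> carrier (homology_group 0 Y)"
  obtains n :: int where "x = point_class Y a [^]\<^bsub>homology_group 0 Y\<^esub> n"
  using point_class_iso[OF assms(1,2)] assms(3) by (auto simp: iso_def bij_betw_def)

lemma point_class_pow_inj:
  assumes "path_connected_space Y" "a \<in> topspace Y"
    "point_class Y a [^]\<^bsub>homology_group 0 Y\<^esub> (m::int) = point_class Y a [^]\<^bsub>homology_group 0 Y\<^esub> n"
  shows "m = n"
  using point_class_iso[OF assms(1,2)] assms(3) by (auto simp: iso_def bij_betw_def inj_on_def)

text \<open>A constant map factors through a one-point space, whose homology vanishes in nonzero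
  degrees.\<close>

lemma hom_induced_const:
  assumes "p \<noteq> 0" "a \<in> topspace Z"
  shows "hom_induced p Y {} Z {} (\<lambda>_. a) c = \<one>\<^bsub>homology_group p Z\<^esub>"
proof -
  let ?P = "subtopology Z {a}"
  have P: "topspace ?P = {a}" using assms by auto
  have "hom_induced p Y {} Z {} (\<lambda>_. a) c = hom_induced p ?P {} Z {} id (hom_induced p Y {} ?P {} (\<lambda>_. a) c)"
    using assms P by (subst hom_induced_compose') (auto simp: comp_def continuous_map_in_subtopology)
  also have "hom_induced p Y {} ?P {} (\<lambda>_. a) c = \<one>\<^bsub>homology_group p ?P\<^esub>"
    using homology_dimension_axiom[OF P assms(1)] hom_induced_carrier[of p Y "{}" ?P "{}" "\<lambda>_. a" c]
    by (simp add: trivial_group_def)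
  finally show ?thesis by (simp add: group_hom.hom_one[OF hom_induced_group_hom])
qed

section \<open>Spaces of finite rational homology: retracts and contractible spaces\<close>

definition finite_homology :: "'a topology \<Rightarrow> bool" where
  "finite_homology Y \<longleftrightarrow>
     (\<forall>p. \<exists>F. finite F \<and> F \<subseteq> carrier (homology_group p Y) \<and>
        carrier (homology_group p Y) \<subseteq> rspan (homology_group p Y) F) \<and>
     (\<exists>D. \<forall>p\<ge>D. carrier (homology_group p Y) = {\<one>\<^bsub>homology_group p Y\<^esub>})"

lemma incl_hom_refl: "c \<in> carrier (homology_group p (subtopology X V)) \<Longrightarrow> incl_hom p X V V c = c"
  by (simp add: incl_hom_def hom_induced_id)

lemma finite_homology_incl_refl:
  "finite_homology_incl X V V \<longleftrightarrow> finite_homology (subtopology X V)"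
proof -
  have "incl_hom p X V V ` carrier (homology_group p (subtopology X V)) = carrier (homology_group p (subtopology X V))" for p
    by (force simp: incl_hom_refl)
  moreover have "\<one>\<^bsub>homology_group p (subtopology X V)\<^esub> \<in> carrier (homology_group p (subtopology X V))" for p
    by (simp add: group.is_monoid monoid.one_closed)
  then have "(\<forall>x\<in>carrier (homology_group p (subtopology X V)). incl_hom p X V V x = \<one>\<^bsub>homology_group p (subtopology X V)\<^esub>)
    \<longleftrightarrow> carrier (homology_group p (subtopology X V)) = {\<one>\<^bsub>homology_group p (subtopology X V)\<^esub>}" for p
    by (auto simp: incl_hom_refl)
  ultimately show ?thesis by (simp add: finite_homology_incl_def finite_homology_def)
qed

text \<open>\<open>f\<close> has a right inverse, so it is surjective on homology, and generators as
  well as vanishing degrees pass from \<open>Y\<close> to \<open>Z\<close>.\<close>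

lemma finite_homology_retract:
  assumes "finite_homology Y" "continuous_map Y Z f" "continuous_map Z Y g" "\<And>z. z \<in> topspace Z \<Longrightarrow> f (g z) = z"
  shows "finite_homology Z"
proof -
  have surj: "hom_induced p Y {} Z {} f (hom_induced p Z {} Y {} g c) = c"
    if "c \<in> carrier (homology_group p Z)" for p c
  proof -
    have "hom_induced p Y {} Z {} f (hom_induced p Z {} Y {} g c) = hom_induced p Z {} Z {} (f \<circ> g) c"
      using assms by (simp add: hom_induced_compose')
    also have "\<dots> = c"
      using assms that by (intro hom_induced_id_gen continuous_map_compose) auto
    finally show ?thesis .
  qed
  show ?thesis
    unfolding finite_homology_def
  proof (intro conjI allI)
    fix p
    interpret group_hom "homology_group p Y" "homology_group p Z" "hom_induced p Y {} Z {} f"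
      by (rule hom_induced_group_hom)
    obtain F where F: "finite F" "F \<subseteq> carrier (homology_group p Y)"
        "carrier (homology_group p Y) \<subseteq> rspan (homology_group p Y) F"
      using assms(1) unfolding finite_homology_def by blast
    have "carrier (homology_group p Z) \<subseteq> rspan (homology_group p Z) (hom_induced p Y {} Z {} f ` F)"
    proof
      fix c assume "c \<in> carrier (homology_group p Z)"
      moreover have "hom_induced p Z {} Y {} g c \<in> rspan (homology_group p Y) F"
        using F(3) hom_induced_carrier by blast
      ultimately show "c \<in> rspan (homology_group p Z) (hom_induced p Y {} Z {} f ` F)"
        using rspan_hom surj by metis
    qed
    then show "\<exists>F. finite F \<and> F \<subseteq> carrier (homology_group p Z) \<and>
        carrier (homology_group p Z) \<subseteq> rspan (homology_group p Z) F"
      using F hom_induced_carrier by (intro exI[of _ "hom_induced p Y {} Z {} f ` F"]) auto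
  next
    obtain D where D: "\<And>p. p \<ge> D \<Longrightarrow> carrier (homology_group p Y) = {\<one>\<^bsub>homology_group p Y\<^esub>}"
      using assms(1) unfolding finite_homology_def by blast
    have "carrier (homology_group p Z) = {\<one>\<^bsub>homology_group p Z\<^esub>}" if "p \<ge> D" for p
    proof -
      have "c = \<one>\<^bsub>homology_group p Z\<^esub>" if c: "c \<in> carrier (homology_group p Z)" for c
      proof -
        have "hom_induced p Z {} Y {} g c = \<one>\<^bsub>homology_group p Y\<^esub>"
          using D[OF \<open>p \<ge> D\<close>] hom_induced_carrier[of p Z "{}" Y "{}" g c] by simp
        then show ?thesis
          using surj[OF c] group_hom.hom_one[OF hom_induced_group_hom] by metis
      qed
      then show ?thesis by (auto simp: group.is_monoid monoid.one_closed)
    qed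
    then show "\<exists>D. \<forall>p\<ge>D. carrier (homology_group p Z) = {\<one>\<^bsub>homology_group p Z\<^esub>}" by blast
  qed
qed

lemma contractible_homology_trivial:
  assumes "contractible_space Y" "p \<noteq> 0"
  shows "carrier (homology_group p Y) = {\<one>\<^bsub>homology_group p Y\<^esub>}"
proof (cases "topspace Y = {}")
  case True
  then show ?thesis using trivial_homology_group_empty by (auto simp: trivial_group_def)
next
  case False
  then have "Y \<noteq> trivial_topology" by auto
  then obtain a where a: "a \<in> topspace Y" "homotopic_with (\<lambda>x. True) Y Y id (\<lambda>x. a)"
    using assms(1) contractible_space by blast
  have "c = \<one>\<^bsub>homology_group p Y\<^esub>" if "c \<in> carrier (homology_group p Y)" for c
    using homology_homotopy_empty[OF a(2), of p] hom_induced_const[OF assms(2) a(1), of Y c]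
      hom_induced_id[OF that] by simp
  then show ?thesis by (auto simp: group.is_monoid monoid.one_closed)
qed

lemma contractible_finite_homology:
  assumes "contractible_space Y"
  shows "finite_homology Y"
  unfolding finite_homology_def
proof (intro conjI allI)
  fix p :: int
  interpret group "homology_group p Y" by simp
  consider "p \<noteq> 0" | "topspace Y = {}" | a where "p = 0" "a \<in> topspace Y" by blast
  then show "\<exists>F. finite F \<and> F \<subseteq> carrier (homology_group p Y) \<and>
        carrier (homology_group p Y) \<subseteq> rspan (homology_group p Y) F"
  proof cases
    case 1
    then show ?thesis
      using contractible_homology_trivial[OF assms] by (intro exI[of _ "{}"]) (simp add: rspan_one)
  next
    case 2
    then show ?thesis using trivial_homology_group_empty[of Y p]
      by (intro exI[of _ "{}"]) (simp add: rspan_one trivial_group_def)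
  next
    case 3
    have pc: "path_connected_space Y" using assms contractible_imp_path_connected_space by blast
    have "carrier (homology_group 0 Y) \<subseteq> rspan (homology_group 0 Y) {point_class Y a}"
    proof
      fix x assume "x \<in> carrier (homology_group 0 Y)"
      then obtain n :: int where "x = point_class Y a [^]\<^bsub>homology_group 0 Y\<^esub> n"
        using homology_0_cases[OF pc 3(2)] by blast
      moreover have "point_class Y a \<in> rspan (homology_group 0 Y) {point_class Y a}"
        using point_class_closed[OF 3(2)] by (simp add: rspan_incl)
      ultimately show "x \<in> rspan (homology_group 0 Y) {point_class Y a}"
        using group.rspan_int_pow[OF group_relative_homology_group] by metis
    qed
    then show ?thesis using 3 point_class_closed[OF 3(2)]
      by (intro exI[of _ "{point_class Y a}"]) simp
  qed
next
  show "\<exists>D. \<forall>p\<ge>D. carrier (homology_group p Y) = {\<one>\<^bsub>homology_group p Y\<^esub>}"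
    using contractible_homology_trivial[OF assms] by (intro exI[of _ 1]) auto
qed

section \<open>Convex open sets of Euclidean space, with convexity written in coordinates\<close>

definition pointwise_convex :: "(nat \<Rightarrow> real) set \<Rightarrow> bool" where
  "pointwise_convex S \<longleftrightarrow>
     (\<forall>x\<in>S. \<forall>y\<in>S. \<forall>t\<in>{0..1}. (\<lambda>i. (1 - t) * x i + t * y i) \<in> S)"

lemma pointwise_convex_Int: "pointwise_convex S \<Longrightarrow> pointwise_convex T \<Longrightarrow> pointwise_convex (S \<inter> T)"
  by (simp add: pointwise_convex_def)

text \<open>The straight-line homotopy towards \<open>v\<close>. It is kept as an explicit map,
  beyond mere contractibility, because the base points of the wedge also require that
  \<open>v\<close> stays fixed.\<close>

lemma pointwise_convex_contraction:
  assumes S: "pointwise_convex S" "S \<subseteq> topspace (Euclidean_space n)" and v: "v \<in> S"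
  shows "continuous_map (prod_topology (top_of_set {0..1}) (subtopology (Euclidean_space n) S))
    (subtopology (Euclidean_space n) S) (\<lambda>(t, x) i. (1 - t) * x i + t * v i)"
proof -
  let ?I = "top_of_set {0..1::real}"
  let ?E = "subtopology (Euclidean_space n) S"
  have 1: "continuous_map (prod_topology ?I ?E) euclideanreal fst"
    using continuous_map_fst[of ?I ?E] by (simp add: continuous_map_in_subtopology)
  have 2: "continuous_map (prod_topology ?I ?E) euclideanreal (\<lambda>z. snd z k)" for k
  proof -
    have "continuous_map ?E euclideanreal (\<lambda>x. x k)"
      unfolding Euclidean_space_def
      by (intro continuous_map_from_subtopology continuous_map_product_projection) auto
    then show ?thesis
      using continuous_map_compose[OF continuous_map_snd, of ?E euclideanreal "\<lambda>x. x k" ?I] by (simp add: comp_def)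
  qed
  have "continuous_map (prod_topology ?I ?E) (powertop_real UNIV) (\<lambda>z i. (1 - fst z) * snd z i + fst z * v i)"
    unfolding continuous_map_componentwise_UNIV by (intro allI continuous_intros 1 2)
  moreover have "(\<lambda>z i. (1 - fst z) * snd z i + fst z * v i) \<in> topspace (prod_topology ?I ?E) \<rightarrow> S"
    using S v by (auto simp: pointwise_convex_def)
  moreover have "S \<subseteq> {x. \<forall>i\<ge>n. x i = 0}" using S by (simp add: topspace_Euclidean_space)
  ultimately show ?thesis
    using v by (auto simp: Euclidean_space_def continuous_map_in_subtopology subtopology_subtopology
        case_prod_unfold image_subset_iff Pi_iff subset_iff)
qed

lemma pointwise_convex_contractible:
  assumes S: "pointwise_convex S" "S \<subseteq> topspace (Euclidean_space n)"
  shows "contractible_space (subtopology (Euclidean_space n) S)"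
proof (cases "S = {}")
  case True
  then show ?thesis by (simp add: contractible_space_subset_singleton[of _ undefined])
next
  case False
  then obtain v where v: "v \<in> S" by auto
  show ?thesis
    unfolding contractible_space_def homotopic_with_def
    using pointwise_convex_contraction[OF S v]
    by (intro exI[of _ v] exI[of _ "\<lambda>(t, x) i. (1 - t) * x i + t * v i"]) auto
qed

text \<open>Induction on the number of sets: the intersection of \<open>C\<close> with the union of
  the others is a union of at most as many convex sets as there are others, hence also covered by
  the induction hypothesis.\<close>

lemma finite_homology_Union_convex:
  assumes "finite \<C>" and "\<And>C. C \<in> \<C> \<Longrightarrow> openin (Euclidean_space n) C \<and> pointwise_convex C"
  shows "finite_homology_incl (Euclidean_space n) (\<Union>\<C>) (\<Union>\<C>)"
  using assms
proof (induction "card \<C>" arbitrary: \<C> rule: less_induct)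
  case less
  have conv: "finite_homology_incl (Euclidean_space n) C C"
    if "openin (Euclidean_space n) C" "pointwise_convex C" for C
    unfolding finite_homology_incl_refl using that
    by (intro contractible_finite_homology pointwise_convex_contractible openin_subset)
  show ?case
  proof (cases "\<C> = {}")
    case True
    have "finite_homology_incl (Euclidean_space n) {} {}"
      by (rule conv) (auto simp: pointwise_convex_def)
    then show ?thesis using True by simp
  next
    case False
    then obtain C \<D> where D: "\<C> = insert C \<D>" "C \<notin> \<D>" by (meson Set.set_insert ex_in_conv)
    have fin: "finite \<D>" "card \<D> < card \<C>" using D less.prems by auto
    have o: "openin (Euclidean_space n) (\<Union>\<D>)" "openin (Euclidean_space n) C"
      using D less.prems by auto
    have 1: "finite_homology_incl (Euclidean_space n) (\<Union>\<D>) (\<Union>\<D>)"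
      by (rule less.hyps) (use fin D less.prems in auto)
    have 2: "finite_homology_incl (Euclidean_space n) C C" using conv D less.prems by auto
    have "finite_homology_incl (Euclidean_space n) (\<Union>((\<lambda>B. B \<inter> C) ` \<D>)) (\<Union>((\<lambda>B. B \<inter> C) ` \<D>))"
    proof (rule less.hyps)
      show "card ((\<lambda>B. B \<inter> C) ` \<D>) < card \<C>"
        using card_image_le[OF fin(1), of "\<lambda>B. B \<inter> C"] fin(2) by simp
    qed (use fin D less.prems pointwise_convex_Int in auto)
    moreover have "\<Union>((\<lambda>B. B \<inter> C) ` \<D>) = \<Union>\<D> \<inter> C" by auto
    ultimately have 3: "finite_homology_incl (Euclidean_space n) (\<Union>\<D> \<inter> C) (\<Union>\<D> \<inter> C)" by simp
    have "finite_homology_incl (Euclidean_space n) (\<Union>\<D> \<union> C) (\<Union>\<D> \<union> C)"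
      by (rule finite_homology_incl_Un[OF o o _ _ _ _ finite_homology_incl_subset[OF 1]
            finite_homology_incl_subset[OF 2] 3]) auto
    then show ?thesis using D by (simp add: Un_commute)
  qed
qed

lemma convex_neighbourhood:
  assumes "openin (Euclidean_space n) S" "x \<in> S"
  obtains C where "openin (Euclidean_space n) C" "pointwise_convex C" "x \<in> C" "C \<subseteq> S"
proof -
  obtain T where T: "openin (powertop_real UNIV) T" "S = T \<inter> {x. \<forall>i\<ge>n. x i = 0}"
    using assms(1) by (auto simp: Euclidean_space_def openin_subtopology)
  then have "x \<in> T" using assms(2) by auto
  then obtain U where U: "finite {i. U i \<noteq> (UNIV :: real set)}" "\<And>i. open (U i)" "x \<in> Pi\<^sub>E UNIV U" "Pi\<^sub>E UNIV U \<subseteq> T"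
    using T(1) unfolding openin_product_topology_alt by auto
  \<comment> \<open>Convexity is achieved by passing to intervals; unrestricted coordinates stay
    unrestricted, so that the box remains open in the product topology.\<close>
  have "\<forall>i. \<exists>W. open W \<and> convex W \<and> x i \<in> W \<and> W \<subseteq> U i \<and> (U i = UNIV \<longrightarrow> W = UNIV)"
  proof
    fix i
    have "x i \<in> U i" using U(3) by auto
    then obtain e where "e > 0" "ball (x i) e \<subseteq> U i" using U(2) open_contains_ball by blast
    then show "\<exists>W. open W \<and> convex W \<and> x i \<in> W \<and> W \<subseteq> U i \<and> (U i = UNIV \<longrightarrow> W = UNIV)"
      by (cases "U i = UNIV") (auto intro: exI[of _ UNIV] exI[of _ "ball (x i) e"])
  qed
  then obtain W where W: "\<And>i. open (W i)" "\<And>i. convex (W i)" "\<And>i. x i \<in> W i" "\<And>i. W i \<subseteq> U i"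
    "\<And>i. U i = UNIV \<Longrightarrow> W i = UNIV" by metis
  define C where "C = Pi\<^sub>E UNIV W \<inter> {x. \<forall>i\<ge>n. x i = 0}"
  show thesis
  proof
    have "finite {i. W i \<noteq> UNIV}" by (rule finite_subset[OF _ U(1)]) (use W(5) in auto)
    then have "openin (powertop_real UNIV) (Pi\<^sub>E UNIV W)"
      using W(1) by (simp add: openin_PiE_gen)
    then show "openin (Euclidean_space n) C"
      by (auto simp: C_def Euclidean_space_def openin_subtopology)
    show "pointwise_convex C"
      using W(2) unfolding pointwise_convex_def C_def convex_alt by (auto simp: PiE_iff)
    show "x \<in> C" using W(3) assms(2) T(2) by (auto simp: C_def PiE_iff)
    show "C \<subseteq> S" using W(4) U(4) T(2) unfolding C_def by (force simp: PiE_iff)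
  qed
qed

text \<open>The homology of a compact set may be wild even inside a chart, so finiteness is required
  only of images between neighbourhoods of \<open>K\<close>.\<close>

definition tame_compact :: "'a topology \<Rightarrow> 'a set \<Rightarrow> bool" where
  "tame_compact X K \<longleftrightarrow> compactin X K \<and> (\<forall>U. openin X U \<and> K \<subseteq> U \<longrightarrow>
     (\<exists>V. openin X V \<and> K \<subseteq> V \<and> V \<subseteq> U \<and> finite_homology_incl X V U))"

definition chart_domain :: "'a topology \<Rightarrow> 'a set \<Rightarrow> bool" where
  "chart_domain X U \<longleftrightarrow> openin X U \<and> (\<exists>n V. openin (Euclidean_space n) V \<and>
     subtopology X U homeomorphic_space subtopology (Euclidean_space n) V)"

lemma chart_domain_obtain:
  assumes "chart_domain X U"
  obtains n V g h where "openin X U" "openin (Euclidean_space n) V"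
    "homeomorphic_maps (subtopology X U) (subtopology (Euclidean_space n) V) g h"
  using assms unfolding chart_domain_def homeomorphic_space_def by blast

lemma chart_open_image:
  assumes U: "openin X U" and V: "openin Y V"
    and gh: "homeomorphic_maps (subtopology X U) (subtopology Y V) g h"
    and W: "openin X W" "W \<subseteq> U"
  shows "openin Y (g ` W)"
proof -
  have "openin (subtopology X U) W" using W by (simp add: openin_open_subtopology U)
  moreover have "homeomorphic_map (subtopology X U) (subtopology Y V) g"
    using gh homeomorphic_map_maps by blast
  ultimately have "openin (subtopology Y V) (g ` W)"
    using homeomorphic_imp_open_map open_map_def by blast
  then show ?thesis using V openin_trans_full by blast
qed

text \<open>In the chart, finitely many convex open sets inside the image of \<open>U'\<close> cover
  the compact set. Their union has finite homology by itself, and its copy \<open>V'\<close> in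
  \<open>X\<close> is the required neighbourhood.\<close>

lemma tame_compact_chart:
  assumes U: "chart_domain X U" and K: "compactin X K" "K \<subseteq> U"
  shows "tame_compact X K"
  unfolding tame_compact_def
proof (intro conjI allI impI)
  fix U' assume U': "openin X U' \<and> K \<subseteq> U'"
  obtain n V g h where oU: "openin X U" and oV: "openin (Euclidean_space n) V"
    and gh: "homeomorphic_maps (subtopology X U) (subtopology (Euclidean_space n) V) g h"
    using chart_domain_obtain[OF U] .
  let ?E = "Euclidean_space n"
  have tU: "topspace (subtopology X U) = U" using oU openin_subset by fastforce
  have tV: "topspace (subtopology ?E V) = V" using oV openin_subset by fastforce
  have cg: "continuous_map (subtopology X U) (subtopology ?E V) g"
    and ch: "continuous_map (subtopology ?E V) (subtopology X U) h"
    and hg: "\<And>x. x \<in> U \<Longrightarrow> h (g x) = x" and gh': "\<And>y. y \<in> V \<Longrightarrow> g (h y) = y"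
    using gh tU tV by (auto simp: homeomorphic_maps_def)
  have gU: "\<And>x. x \<in> U \<Longrightarrow> g x \<in> V" and hV: "\<And>y. y \<in> V \<Longrightarrow> h y \<in> U"
    using cg ch tU tV by (auto simp: continuous_map_def)
  define O' where "O' = g ` (U' \<inter> U)"
  have oO: "openin ?E O'"
    unfolding O'_def using U' oU by (intro chart_open_image[OF oU oV gh]) auto
  have OV: "O' \<subseteq> V" using gU by (auto simp: O'_def)
  have "compactin (subtopology X U) K" using K by (simp add: compactin_subtopology)
  then have "compactin (subtopology ?E V) (g ` K)" by (rule image_compactin[OF _ cg])
  then have cK: "compactin ?E (g ` K)" by (simp add: compactin_subtopology)
  define \<U> where "\<U> = {C. openin ?E C \<and> pointwise_convex C \<and> C \<subseteq> O'}"
  have "g ` K \<subseteq> \<Union>\<U>"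
  proof
    fix y assume "y \<in> g ` K"
    then have "y \<in> O'" using U' K by (auto simp: O'_def)
    from convex_neighbourhood[OF oO this]
    obtain C where "openin ?E C" "pointwise_convex C" "y \<in> C" "C \<subseteq> O'" .
    then show "y \<in> \<Union>\<U>" by (auto simp: \<U>_def)
  qed
  moreover have "\<forall>C\<in>\<U>. openin ?E C" by (simp add: \<U>_def)
  ultimately obtain \<C> where C: "finite \<C>" "\<C> \<subseteq> \<U>" "g ` K \<subseteq> \<Union>\<C>"
    using cK unfolding compactin_def by blast
  define W where "W = \<Union>\<C>"
  have oW: "openin ?E W" and WO: "W \<subseteq> O'" using C by (auto simp: W_def \<U>_def)
  have "finite_homology_incl ?E W W"
    unfolding W_def by (rule finite_homology_Union_convex) (use C in \<open>auto simp: \<U>_def\<close>)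
  then have fW: "finite_homology (subtopology ?E W)" by (simp add: finite_homology_incl_refl)
  define V' where "V' = h ` W"
  have V'U: "V' \<subseteq> U" using hV WO OV by (auto simp: V'_def)
  have oV': "openin X V'"
    unfolding V'_def
    using gh WO OV by (subst (asm) homeomorphic_maps_sym) (intro chart_open_image[OF oV oU _ oW], auto)
  have "finite_homology (subtopology X V')"
  proof (rule finite_homology_retract[OF fW])
    have "continuous_map (subtopology (subtopology ?E V) W) (subtopology X U) h"
      using ch by (rule continuous_map_from_subtopology)
    moreover have "V \<inter> W = W" using WO OV by auto
    ultimately have "continuous_map (subtopology ?E W) X h"
      by (simp add: subtopology_subtopology continuous_map_in_subtopology)
    then show "continuous_map (subtopology ?E W) (subtopology X V') h"
      by (auto simp: continuous_map_in_subtopology V'_def)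
    have "continuous_map (subtopology (subtopology X U) V') (subtopology ?E V) g"
      using cg by (rule continuous_map_from_subtopology)
    moreover have "U \<inter> V' = V'" using V'U by auto
    ultimately have "continuous_map (subtopology X V') ?E g"
      by (simp add: subtopology_subtopology continuous_map_in_subtopology)
    moreover have "g ` V' \<subseteq> W" using gh' WO OV by (auto simp: V'_def subset_iff)
    ultimately show "continuous_map (subtopology X V') (subtopology ?E W) g"
      by (auto simp: continuous_map_in_subtopology)
    show "h (g z) = z" if "z \<in> topspace (subtopology X V')" for z
      using that V'U hg by auto
  qed
  then have "finite_homology_incl X V' V'" by (simp add: finite_homology_incl_refl)
  moreover have V'U': "V' \<subseteq> U'" using WO hg by (auto simp: V'_def O'_def)
  ultimately have "finite_homology_incl X V' U'"
    by (rule finite_homology_incl_subset[OF _ subset_refl subset_refl])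
  moreover have "K \<subseteq> V'"
  proof
    fix x assume "x \<in> K"
    then have "g x \<in> W" "h (g x) = x" using C K hg by (auto simp: W_def)
    then show "x \<in> V'" unfolding V'_def by (metis imageI)
  qed
  ultimately show "\<exists>V. openin X V \<and> K \<subseteq> V \<and> V \<subseteq> U' \<and> finite_homology_incl X V U'"
    using oV' V'U' by blast
qed (rule K)

text \<open>The neighbourhoods of \<open>A\<close> and \<open>B\<close> must be shrunk until they
  meet inside the neighbourhood \<open>W\<close> of \<open>A \<inter> B\<close>. What remains of
  \<open>A\<close> and \<open>B\<close> outside \<open>W\<close> consists of two disjoint compact
  sets, which a Hausdorff space separates by disjoint open sets.\<close>

lemma tame_compact_Un:
  assumes X: "Hausdorff_space X" and A: "tame_compact X A" and B: "tame_compact X B"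
    and AB: "tame_compact X (A \<inter> B)"
  shows "tame_compact X (A \<union> B)"
  unfolding tame_compact_def
proof (intro conjI allI impI)
  have cA: "compactin X A" and cB: "compactin X B" using A B by (auto simp: tame_compact_def)
  then show "compactin X (A \<union> B)" by (simp add: compactin_Un)
  fix U assume U: "openin X U \<and> A \<union> B \<subseteq> U"
  obtain VA where VA: "openin X VA" "A \<subseteq> VA" "VA \<subseteq> U" "finite_homology_incl X VA U"
    using A U unfolding tame_compact_def by (meson Un_subset_iff)
  obtain VB where VB: "openin X VB" "B \<subseteq> VB" "VB \<subseteq> U" "finite_homology_incl X VB U"
    using B U unfolding tame_compact_def by (meson Un_subset_iff)
  have "openin X (VA \<inter> VB)" "A \<inter> B \<subseteq> VA \<inter> VB" using VA VB by auto
  then obtain W where W: "openin X W" "A \<inter> B \<subseteq> W" "W \<subseteq> VA \<inter> VB" "finite_homology_incl X W (VA \<inter> VB)"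
    using AB unfolding tame_compact_def by blast
  have "A - W = (topspace X - W) \<inter> A" "B - W = (topspace X - W) \<inter> B"
    using compactin_subset_topspace[OF cA] compactin_subset_topspace[OF cB] by auto
  then have "compactin X (A - W)" "compactin X (B - W)"
    using cA cB W(1) by (simp_all add: closed_Int_compactin closedin_diff)
  moreover have "disjnt (A - W) (B - W)" using W(2) by (auto simp: disjnt_def)
  ultimately obtain OA OB where O: "openin X OA" "openin X OB" "A - W \<subseteq> OA" "B - W \<subseteq> OB" "disjnt OA OB"
    using X unfolding Hausdorff_space_compact_sets by meson
  define A' where "A' = VA \<inter> (W \<union> OA)"
  define B' where "B' = VB \<inter> (W \<union> OB)"
  have o: "openin X A'" "openin X B'" using VA VB W O by (auto simp: A'_def B'_def)
  have "A' \<inter> B' \<subseteq> W" using O(5) by (auto simp: A'_def B'_def disjnt_def)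
  then have "finite_homology_incl X (A' \<inter> B') (VA \<inter> VB)"
    by (rule finite_homology_incl_subset[OF W(4)]) (use W in auto)
  then have "finite_homology_incl X (A' \<union> B') U"
    by (intro finite_homology_incl_Un[OF o VA(1) VB(1) _ _ VA(3) VB(3) VA(4) VB(4)]) (auto simp: A'_def B'_def)
  moreover have "A \<union> B \<subseteq> A' \<union> B'" using VA VB O by (auto simp: A'_def B'_def)
  moreover have "A' \<union> B' \<subseteq> U" using VA VB by (auto simp: A'_def B'_def)
  ultimately show "\<exists>V. openin X V \<and> A \<union> B \<subseteq> V \<and> V \<subseteq> U \<and> finite_homology_incl X V U"
    using o by (intro exI[of _ "A' \<union> B'"]) auto
qed

text \<open>The intersection of \<open>K\<close> with the union of the others is a compact subset of
  the single chart that contains \<open>K\<close>, so \<open>tame_compact_chart\<close> supplies the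
  hypothesis of \<open>tame_compact_Un\<close> on intersections.\<close>

lemma tame_compact_Union:
  assumes X: "Hausdorff_space X" and "finite \<K>"
    and "\<And>K. K \<in> \<K> \<Longrightarrow> compactin X K \<and> (\<exists>U. chart_domain X U \<and> K \<subseteq> U)"
  shows "tame_compact X (\<Union>\<K>)"
  using assms(2,3)
proof (induction \<K> rule: finite_induct)
  case empty
  have "finite_homology_incl X {} {}"
    unfolding finite_homology_incl_refl
    by (intro contractible_finite_homology contractible_space_subset_singleton[of _ undefined]) auto
  then have "finite_homology_incl X {} U" for U by (rule finite_homology_incl_subset) auto
  then show ?case by (auto simp: tame_compact_def)
next
  case (insert K \<K>)
  have K: "compactin X K" "\<exists>U. chart_domain X U \<and> K \<subseteq> U" using insert.prems by auto
  have IH: "tame_compact X (\<Union>\<K>)" using insert by auto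
  then have "compactin X (\<Union>\<K>)" by (simp add: tame_compact_def)
  then have "compactin X (K \<inter> \<Union>\<K>)"
    using K(1) X compactin_imp_closedin closed_compactin_Inter closed_Int_compactin by metis
  then have "tame_compact X (K \<inter> \<Union>\<K>)" using K(2) tame_compact_chart by (metis inf.coboundedI1)
  moreover have "tame_compact X K" using K tame_compact_chart by blast
  ultimately show ?case using tame_compact_Un[OF X _ IH, of K] by simp
qed

lemma compact_manifold_finite_homology:
  assumes X: "top_manifold X" "compact_space X"
  shows "finite_homology X"
proof -
  have H: "Hausdorff_space X" using X by (simp add: top_manifold_def)
  have ch: "\<exists>U. chart_domain X U \<and> x \<in> U" if "x \<in> topspace X" for x
    using X(1) that unfolding top_manifold_def chart_domain_def by blast
  \<comment> \<open>Regularity gives every point a closed, hence compact, neighbourhood inside a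
    chart. Finitely many of these cover \<open>X\<close>.\<close>
  have nb: "neighbourhood_base_of (closedin X) X"
    using neighbourhood_base_of_closedin compact_Hausdorff_imp_regular_space[OF X(2) H] by blast
  have "\<forall>x\<in>topspace X. \<exists>V. openin X V \<and> x \<in> V \<and> (\<exists>K U. closedin X K \<and> V \<subseteq> K \<and> chart_domain X U \<and> K \<subseteq> U)"
  proof
    fix x assume "x \<in> topspace X"
    then obtain U where U: "chart_domain X U" "x \<in> U" using ch by blast
    then have "openin X U" by (simp add: chart_domain_def)
    from nb[unfolded neighbourhood_base_of, rule_format, OF conjI[OF this U(2)]]
    obtain V K where "openin X V" "closedin X K" "x \<in> V" "V \<subseteq> K" "K \<subseteq> U" by auto
    with U(1) show "\<exists>V. openin X V \<and> x \<in> V \<and> (\<exists>K U. closedin X K \<and> V \<subseteq> K \<and> chart_domain X U \<and> K \<subseteq> U)"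
      by blast
  qed
  then obtain V where V: "\<And>x. x \<in> topspace X \<Longrightarrow> openin X (V x) \<and> x \<in> V x \<and>
      (\<exists>K U. closedin X K \<and> V x \<subseteq> K \<and> chart_domain X U \<and> K \<subseteq> U)" by metis
  have "compactin X (topspace X)" using X(2) by (simp add: compact_space_def)
  moreover have "\<forall>W\<in>V ` topspace X. openin X W" "topspace X \<subseteq> \<Union>(V ` topspace X)" using V by auto
  ultimately obtain \<F> where F: "finite \<F>" "\<F> \<subseteq> V ` topspace X" "topspace X \<subseteq> \<Union>\<F>"
    unfolding compactin_def by meson
  have "\<exists>K. W \<subseteq> K \<and> closedin X K \<and> (\<exists>U. chart_domain X U \<and> K \<subseteq> U)" if W: "W \<in> \<F>" for W
  proof -
    obtain x where "x \<in> topspace X" "W = V x" using F(2) W by auto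
    then show ?thesis using V[of x] by auto
  qed
  then have "\<forall>W\<in>\<F>. \<exists>K. W \<subseteq> K \<and> closedin X K \<and> (\<exists>U. chart_domain X U \<and> K \<subseteq> U)" by (rule ballI)
  then obtain K where K: "\<And>W. W \<in> \<F> \<Longrightarrow> W \<subseteq> K W \<and> closedin X (K W) \<and> (\<exists>U. chart_domain X U \<and> K W \<subseteq> U)" by metis
  have "tame_compact X (\<Union>(K ` \<F>))"
  proof (rule tame_compact_Union[OF H])
    fix L assume "L \<in> K ` \<F>"
    then obtain W where "W \<in> \<F>" "L = K W" by blast
    then show "compactin X L \<and> (\<exists>U. chart_domain X U \<and> L \<subseteq> U)"
      using K[of W] closedin_compact_space[OF X(2), of L] by simp
  qed (use F(1) in simp)
  moreover have "\<Union>(K ` \<F>) = topspace X"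
  proof
    show "\<Union>(K ` \<F>) \<subseteq> topspace X"
    proof (rule UN_least)
      fix W assume "W \<in> \<F>"
      then have "closedin X (K W)" using K by simp
      then show "K W \<subseteq> topspace X" by (rule closedin_subset)
    qed
    have "\<Union>\<F> \<subseteq> \<Union>(K ` \<F>)"
    proof (rule Union_least)
      fix W assume W: "W \<in> \<F>"
      then have "W \<subseteq> K W" using K by simp
      with W show "W \<subseteq> \<Union>(K ` \<F>)" by (auto intro: UN_I)
    qed
    with F(3) show "topspace X \<subseteq> \<Union>(K ` \<F>)" by (rule subset_trans)
  qed
  ultimately have "tame_compact X (topspace X)" by simp
  \<comment> \<open>The only open set containing \<open>topspace X\<close> is
    \<open>topspace X\<close> itself, so finiteness of an inclusion becomes finiteness of the
    space.\<close>
  then obtain W where "topspace X \<subseteq> W" "W \<subseteq> topspace X" "finite_homology_incl X W (topspace X)"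
    unfolding tame_compact_def by (meson openin_topspace subset_refl)
  then have "finite_homology_incl X (topspace X) (topspace X)" by (metis subset_antisym)
  then show ?thesis by (simp add: finite_homology_incl_refl)
qed

section \<open>Homology of the wedge\<close>

text \<open>The base point is fixed at all times, so that the contractions on different summands
  agree at the common point of the wedge.\<close>

definition pointed_contraction :: "'a topology \<Rightarrow> 'a \<Rightarrow> 'a set \<Rightarrow> (real \<times> 'a \<Rightarrow> 'a) \<Rightarrow> bool" where
  "pointed_contraction Y a U h \<longleftrightarrow> openin Y U \<and> a \<in> U \<and>
     continuous_map (prod_topology (top_of_set {0..1}) (subtopology Y U)) (subtopology Y U) h \<and>
     (\<forall>x\<in>U. h (0, x) = x \<and> h (1, x) = a) \<and> (\<forall>t\<in>{0..1}. h (t, a) = a)"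

text \<open>The straight-line contraction of a convex neighbourhood in a chart, conjugated by the
  chart; aiming it at the image of \<open>a\<close> keeps \<open>a\<close> fixed.\<close>

lemma manifold_pointed_contraction:
  assumes "top_manifold Y" "a \<in> topspace Y"
  obtains U h where "pointed_contraction Y a U h"
proof -
  obtain S where "chart_domain Y S" and aS: "a \<in> S"
    using assms unfolding top_manifold_def chart_domain_def by blast
  then obtain n V g h where oS: "openin Y S" and oV: "openin (Euclidean_space n) V"
    and gh: "homeomorphic_maps (subtopology Y S) (subtopology (Euclidean_space n) V) g h"
    using chart_domain_obtain by metis
  let ?E = "Euclidean_space n" and ?I = "top_of_set {0..1::real}"
  have tS: "topspace (subtopology Y S) = S" using oS openin_subset by fastforce
  have tV: "topspace (subtopology ?E V) = V" using oV openin_subset by fastforce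
  have cg: "continuous_map (subtopology Y S) (subtopology ?E V) g"
    and ch: "continuous_map (subtopology ?E V) (subtopology Y S) h"
    and hg: "\<And>x. x \<in> S \<Longrightarrow> h (g x) = x" and gh': "\<And>y. y \<in> V \<Longrightarrow> g (h y) = y"
    using gh tS tV by (auto simp: homeomorphic_maps_def)
  have gS: "\<And>x. x \<in> S \<Longrightarrow> g x \<in> V" and hV: "\<And>y. y \<in> V \<Longrightarrow> h y \<in> S"
    using cg ch tS tV by (auto simp: continuous_map_def)
  obtain C where C: "openin ?E C" "pointwise_convex C" "g a \<in> C" "C \<subseteq> V"
    using convex_neighbourhood[OF oV gS[OF aS]] .
  define U where "U = h ` C"
  have US: "U \<subseteq> S" using C hV by (auto simp: U_def)
  have gU: "g x \<in> C" if "x \<in> U" for x using that C gh' by (auto simp: U_def subset_iff)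
  define k where "k = (\<lambda>(t, x) i. (1 - t) * x i + t * g a i)"
  have ck: "continuous_map (prod_topology ?I (subtopology ?E C)) (subtopology ?E C) k"
    unfolding k_def by (rule pointwise_convex_contraction[OF C(2) openin_subset[OF C(1)] C(3)])
  have cgU: "continuous_map (subtopology Y U) (subtopology ?E C) g"
  proof -
    have "continuous_map (subtopology (subtopology Y S) U) ?E g"
      using cg continuous_map_from_subtopology by (auto simp: continuous_map_in_subtopology)
    moreover have "S \<inter> U = U" using US by auto
    ultimately show ?thesis using gU by (auto simp: subtopology_subtopology continuous_map_in_subtopology)
  qed
  have chC: "continuous_map (subtopology ?E C) (subtopology Y U) h"
  proof -
    have "continuous_map (subtopology (subtopology ?E V) C) Y h"
      using ch continuous_map_from_subtopology by (auto simp: continuous_map_in_subtopology)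
    moreover have "V \<inter> C = C" using C by auto
    ultimately show ?thesis by (auto simp: U_def subtopology_subtopology continuous_map_in_subtopology)
  qed
  have "continuous_map (prod_topology ?I (subtopology Y U)) (prod_topology ?I (subtopology ?E C)) (\<lambda>z. (fst z, g (snd z)))"
    unfolding continuous_map_pairwise comp_def fst_conv snd_conv
    using continuous_map_fst[of ?I "subtopology Y U"]
      continuous_map_compose[OF continuous_map_snd cgU, of ?I] by (simp add: comp_def)
  from continuous_map_compose[OF continuous_map_compose[OF this ck] chC]
  have c: "continuous_map (prod_topology ?I (subtopology Y U)) (subtopology Y U) (\<lambda>z. h (k (fst z, g (snd z))))"
    by (simp add: comp_def)
  show thesis
  proof (rule that[of U "\<lambda>z. h (k (fst z, g (snd z)))"], unfold pointed_contraction_def, intro conjI ballI)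
    have sym: "homeomorphic_maps (subtopology ?E V) (subtopology Y S) h g"
      using gh by (subst homeomorphic_maps_sym)
    show "openin Y U" unfolding U_def by (rule chart_open_image[OF oV oS sym C(1,4)])
    show "a \<in> U" unfolding U_def using hg[OF aS] C(3) by (metis imageI)
    show "h (k (fst (0, x), g (snd (0, x)))) = x" if "x \<in> U" for x
      using that US hg by (auto simp: k_def)
    show "h (k (fst (1, x), g (snd (1, x)))) = a" if "x \<in> U" for x
      using hg[OF aS] by (simp add: k_def)
    show "h (k (fst (t, a), g (snd (t, a)))) = a" for t
      using hg[OF aS] by (simp add: k_def algebra_simps)
  qed (rule c)
qed

section \<open>The wedge topology\<close>

lemma istopology_wedge:
  "istopology (\<lambda>U. U \<subseteq> wedge_carrier X x0 s \<and>
      (\<forall>i<s. openin (X i) {x \<in> topspace (X i). wedge_incl x0 i x \<in> U}))"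
  unfolding istopology_def
proof (intro conjI allI impI)
  fix S T :: "(nat \<times> 'a) option set" and i
  assume "S \<subseteq> wedge_carrier X x0 s \<and> (\<forall>i<s. openin (X i) {x \<in> topspace (X i). wedge_incl x0 i x \<in> S})"
    and "T \<subseteq> wedge_carrier X x0 s \<and> (\<forall>i<s. openin (X i) {x \<in> topspace (X i). wedge_incl x0 i x \<in> T})"
    and i: "i < s"
  then have "openin (X i) ({x \<in> topspace (X i). wedge_incl x0 i x \<in> S} \<inter> {x \<in> topspace (X i). wedge_incl x0 i x \<in> T})"
    by blast
  then show "openin (X i) {x \<in> topspace (X i). wedge_incl x0 i x \<in> S \<inter> T}"
    by (rule back_subst) auto
next
  fix \<K> :: "(nat \<times> 'a) option set set" and i
  assume K: "\<forall>K\<in>\<K>. K \<subseteq> wedge_carrier X x0 s \<and> (\<forall>i<s. openin (X i) {x \<in> topspace (X i). wedge_incl x0 i x \<in> K})"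
    and i: "i < s"
  have "openin (X i) (\<Union>K\<in>\<K>. {x \<in> topspace (X i). wedge_incl x0 i x \<in> K})"
    using K i by (intro openin_Union) auto
  then show "openin (X i) {x \<in> topspace (X i). wedge_incl x0 i x \<in> \<Union>\<K>}"
    by (rule back_subst) auto
qed auto

lemma openin_wedge:
  "openin (wedge X x0 s) U \<longleftrightarrow> U \<subseteq> wedge_carrier X x0 s \<and>
      (\<forall>i<s. openin (X i) {x \<in> topspace (X i). wedge_incl x0 i x \<in> U})"
  unfolding wedge_def topology_inverse'[OF istopology_wedge] ..

lemma wedge_incl_carrier: "i < s \<Longrightarrow> x \<in> topspace (X i) \<Longrightarrow> wedge_incl x0 i x \<in> wedge_carrier X x0 s"
  by (auto simp: wedge_incl_def wedge_carrier_def)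

lemma topspace_wedge: "topspace (wedge X x0 s) = wedge_carrier X x0 s"
proof -
  have "openin (wedge X x0 s) (wedge_carrier X x0 s)"
    unfolding openin_wedge
  proof (intro conjI allI impI)
    fix i assume "i < s"
    then have "{x \<in> topspace (X i). wedge_incl x0 i x \<in> wedge_carrier X x0 s} = topspace (X i)"
      using wedge_incl_carrier by fast
    then show "openin (X i) {x \<in> topspace (X i). wedge_incl x0 i x \<in> wedge_carrier X x0 s}" by simp
  qed simp
  then show ?thesis
    by (metis openin_subset openin_topspace openin_wedge subset_antisym)
qed

lemma continuous_map_wedge_incl: "i < s \<Longrightarrow> continuous_map (X i) (wedge X x0 s) (wedge_incl x0 i)"
  unfolding continuous_map_def topspace_wedge using wedge_incl_carrier openin_wedge by fastforce

lemma wedge_proj_incl: "wedge_proj x0 j (wedge_incl x0 i x) = (if i = j then x else x0 j)"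
  by (auto simp: wedge_proj_def wedge_incl_def)

lemma wedge_proj_None [simp]: "wedge_proj x0 j None = x0 j"
  by (simp add: wedge_proj_def)

text \<open>Both assumptions come from the manifold structure: T1 makes base points closed and hence
  the summands closed in the wedge, and the contractions provide the open sets for
  Mayer--Vietoris.\<close>

locale contractible_wedge =
  fixes X :: "nat \<Rightarrow> 'a topology" and x0 :: "nat \<Rightarrow> 'a" and s :: nat
    and U :: "nat \<Rightarrow> 'a set" and h :: "nat \<Rightarrow> real \<times> 'a \<Rightarrow> 'a"
  assumes t1: "i < s \<Longrightarrow> t1_space (X i)"
    and contraction: "i < s \<Longrightarrow> pointed_contraction (X i) (x0 i) (U i) (h i)"
begin

abbreviation "W \<equiv> wedge X x0 s"
abbreviation "\<iota> \<equiv> wedge_incl x0"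
abbreviation "\<nu> \<equiv> wedge_proj x0"

lemma base: "i < s \<Longrightarrow> x0 i \<in> topspace (X i)"
  using contraction openin_subset unfolding pointed_contraction_def by blast

lemma U_subset: "i < s \<Longrightarrow> U i \<subseteq> topspace (X i)"
  using contraction openin_subset unfolding pointed_contraction_def by blast

lemma base_U: "i < s \<Longrightarrow> x0 i \<in> U i"
  using contraction unfolding pointed_contraction_def by blast

lemma contraction_closed: "i < s \<Longrightarrow> t \<in> {0..1} \<Longrightarrow> x \<in> U i \<Longrightarrow> h i (t, x) \<in> U i"
  using contraction[of i] U_subset[of i] unfolding pointed_contraction_def continuous_map_def
  by (auto simp: Pi_iff)

lemma continuous_map_wedge_proj:
  assumes j: "j < s"
  shows "continuous_map W (X j) (\<nu> j)"
  unfolding continuous_map_def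
proof (intro conjI allI impI)
  show "\<nu> j \<in> topspace W \<rightarrow> topspace (X j)"
    using base[OF j] by (auto simp: topspace_wedge wedge_carrier_def wedge_proj_def)
  fix V assume V: "openin (X j) V"
  show "openin W {p \<in> topspace W. \<nu> j p \<in> V}"
    unfolding openin_wedge
  proof (intro conjI allI impI)
    fix i assume i: "i < s"
    have eq: "{x \<in> topspace (X i). \<iota> i x \<in> {p \<in> topspace W. \<nu> j p \<in> V}} =
      {x \<in> topspace (X i). \<nu> j (\<iota> i x) \<in> V}"
      using wedge_incl_carrier[OF i] by (auto simp: topspace_wedge)
    show "openin (X i) {x \<in> topspace (X i). \<iota> i x \<in> {p \<in> topspace W. \<nu> j p \<in> V}}"
    proof (cases "i = j")
      case True
      then have "{x \<in> topspace (X i). \<nu> j (\<iota> i x) \<in> V} = topspace (X i) \<inter> V"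
        by (auto simp: wedge_proj_incl)
      then show ?thesis unfolding eq using V True by (simp add: openin_Int)
    next
      case False
      then have "{x \<in> topspace (X i). \<nu> j (\<iota> i x) \<in> V} = (if x0 j \<in> V then topspace (X i) else {})"
        by (auto simp: wedge_proj_incl)
      then show ?thesis unfolding eq by simp
    qed
  qed (simp add: topspace_wedge)
qed

text \<open>For \<open>i \<ge> s\<close> this is just \<open>{None}\<close>, a value used when the
  wedge is covered by closed pieces.\<close>

definition summand :: "nat \<Rightarrow> (nat \<times> 'a) option set" where
  "summand i = insert None {Some (i, x) | x. i < s \<and> x \<in> topspace (X i) \<and> x \<noteq> x0 i}"

lemma closedin_summand: "closedin W (summand i)"
  unfolding closedin_def openin_wedge
proof (intro conjI allI impI)
  show "summand i \<subseteq> topspace W" by (auto simp: topspace_wedge summand_def wedge_carrier_def)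
  fix j assume j: "j < s"
  have "{x \<in> topspace (X j). \<iota> j x \<in> topspace W - summand i} =
      (if i = j then {} else topspace (X j) - {x0 j})"
    using j by (auto simp: topspace_wedge summand_def wedge_carrier_def wedge_incl_def)
  moreover have "closedin (X j) {x0 j}"
    using t1[OF j] base[OF j] by (simp add: t1_space_closedin_singleton)
  ultimately show "openin (X j) {x \<in> topspace (X j). \<iota> j x \<in> topspace W - summand i}"
    by (auto simp: openin_diff)
qed (auto simp: topspace_wedge)

text \<open>The summands with index in \<open>J\<close> are enlarged by the pieces
  \<open>U i\<close> of the others, which makes the set open. For \<open>k \<notin> J\<close> the
  sets \<open>nbhd J\<close> and \<open>nbhd {k}\<close> meet exactly in the contractible set
  \<open>nbhd {}\<close>, as the Mayer--Vietoris induction requires.\<close>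

definition nbhd :: "nat set \<Rightarrow> (nat \<times> 'a) option set" where
  "nbhd J = insert None {Some (i, x) | i x. i < s \<and> x \<in> topspace (X i) \<and> x \<noteq> x0 i \<and> (i \<in> J \<or> x \<in> U i)}"

lemma nbhd_subset: "nbhd J \<subseteq> topspace W"
  by (auto simp: topspace_wedge nbhd_def wedge_carrier_def)

lemma topspace_nbhd [simp]: "topspace (subtopology W (nbhd J)) = nbhd J"
  using nbhd_subset by auto

lemma nbhd_full: "nbhd {..<s} = topspace W"
  by (auto simp: topspace_wedge nbhd_def wedge_carrier_def)

lemma openin_nbhd: "openin W (nbhd J)"
  unfolding openin_wedge
proof (intro conjI allI impI)
  show "nbhd J \<subseteq> wedge_carrier X x0 s" using nbhd_subset topspace_wedge by metis
  fix i assume i: "i < s"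
  have "{x \<in> topspace (X i). \<iota> i x \<in> nbhd J} = (if i \<in> J then topspace (X i) else U i)"
    using i base_U[OF i] U_subset[OF i] by (auto simp: nbhd_def wedge_incl_def)
  then show "openin (X i) {x \<in> topspace (X i). \<iota> i x \<in> nbhd J}"
    using contraction[OF i] by (simp add: pointed_contraction_def)
qed

definition nbhd_homotopy :: "nat set \<Rightarrow> real \<times> (nat \<times> 'a) option \<Rightarrow> (nat \<times> 'a) option" where
  "nbhd_homotopy J z = (case snd z of None \<Rightarrow> None
     | Some (i, x) \<Rightarrow> if i \<in> J then Some (i, x) else \<iota> i (h i (fst z, x)))"

text \<open>A product with the interval does not obviously carry the quotient topology, so
  continuity is checked on finitely many closed pieces, one for each summand; on each of them the
  map is the projection \<open>snd\<close> or factors through \<open>X i\<close>.\<close>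

lemma nbhd_homotopy_continuous:
  "continuous_map (prod_topology (top_of_set {0..1}) (subtopology W (nbhd J))) (subtopology W (nbhd J)) (nbhd_homotopy J)"
proof -
  let ?I = "top_of_set {0..1::real}" and ?N = "subtopology W (nbhd J)"
  define f where "f = (\<lambda>i z. if i < s \<and> i \<notin> J then \<iota> i (h i (fst z, \<nu> i (snd z))) else snd z)"
  have "continuous_map (prod_topology ?I ?N) W (nbhd_homotopy J)"
  \<comment> \<open>The extra index \<open>s\<close> contributes the piece over
    \<open>summand s = {None}\<close>, which covers the base point even if there are no
    summands.\<close>
  proof (rule pasting_lemma_closed[where I = "{..s}" and T = "\<lambda>i. {0..1} \<times> (nbhd J \<inter> summand i)" and f = f])
    fix i assume "i \<in> {..s}"
    have "closedin ?N (nbhd J \<inter> summand i)"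
      using closedin_summand closedin_subtopology_Int_closed by blast
    moreover have "closedin ?I {0..1}"
      using closedin_topspace[of ?I] by simp
    ultimately show "closedin (prod_topology ?I ?N) ({0..1} \<times> (nbhd J \<inter> summand i))"
      by (simp add: closedin_prod_Times_iff)
    have sub: "subtopology (prod_topology ?I ?N) ({0..1} \<times> (nbhd J \<inter> summand i)) =
       prod_topology ?I (subtopology W (nbhd J \<inter> summand i))"
    proof -
      have "nbhd J \<inter> (nbhd J \<inter> summand i) = nbhd J \<inter> summand i" by auto
      then have "subtopology (subtopology W (nbhd J)) (nbhd J \<inter> summand i) = subtopology W (nbhd J \<inter> summand i)"
        by (simp add: subtopology_subtopology)
      moreover have "subtopology ?I {0..1} = ?I" by (simp add: subtopology_subtopology)
      ultimately show ?thesis by (simp only: subtopology_Times)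
    qed
    show "continuous_map (subtopology (prod_topology ?I ?N) ({0..1} \<times> (nbhd J \<inter> summand i))) W (f i)"
    proof (cases "i < s \<and> i \<notin> J")
      case True
      let ?S = "subtopology W (nbhd J \<inter> summand i)"
      have "\<nu> i ` (nbhd J \<inter> summand i) \<subseteq> U i"
        using True base_U[of i] by (auto simp: nbhd_def summand_def wedge_proj_def)
      then have "continuous_map ?S (subtopology (X i) (U i)) (\<nu> i)"
        using continuous_map_wedge_proj[of i] True
        by (auto simp: continuous_map_in_subtopology continuous_map_from_subtopology)
      then have "continuous_map (prod_topology ?I ?S) (prod_topology ?I (subtopology (X i) (U i))) (\<lambda>z. (fst z, \<nu> i (snd z)))"
        unfolding continuous_map_pairwise comp_def fst_conv snd_conv
        using continuous_map_fst[of ?I ?S] continuous_map_compose[OF continuous_map_snd, of ?S _ "\<nu> i" ?I]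
        by (simp add: comp_def)
      moreover have "continuous_map (prod_topology ?I (subtopology (X i) (U i))) (X i) (h i)"
        using contraction[of i] True by (auto simp: pointed_contraction_def continuous_map_in_subtopology)
      ultimately have "continuous_map (prod_topology ?I ?S) (X i) (\<lambda>z. h i (fst z, \<nu> i (snd z)))"
        using continuous_map_compose by (fastforce simp: comp_def)
      then have "continuous_map (prod_topology ?I ?S) W (\<lambda>z. \<iota> i (h i (fst z, \<nu> i (snd z))))"
        using continuous_map_compose[OF _ continuous_map_wedge_incl[of i s X x0]] True
        by (fastforce simp: comp_def)
      then show ?thesis using True unfolding sub by (simp add: f_def)
    next
      case False
      have "continuous_map (prod_topology ?I (subtopology W (nbhd J \<inter> summand i))) W snd"
        using continuous_map_snd continuous_map_into_fulltopology by blast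
      moreover have "f i = snd" unfolding f_def by (subst if_not_P[OF False]) (rule refl)
      ultimately show ?thesis unfolding sub by (simp only:)
    qed
  next
    fix i j z
    assume z: "z \<in> topspace (prod_topology ?I ?N) \<inter> ({0..1} \<times> (nbhd J \<inter> summand i)) \<inter> ({0..1} \<times> (nbhd J \<inter> summand j))"
    show "f i z = f j z"
    proof (cases "i = j")
      case False
      \<comment> \<open>Distinct summands meet only in the base point, where every contraction
        stands still.\<close>
      then have n: "snd z = None" "fst z \<in> {0..1}" using z by (auto simp: summand_def)
      have "h k (fst z, x0 k) = x0 k" if "k < s" for k
        using contraction[OF that] n(2) by (simp add: pointed_contraction_def)
      then have "f k z = None" for k using n(1) by (simp add: f_def wedge_incl_def)
      then show ?thesis by simp
    qed simp
  next
    fix z assume z: "z \<in> topspace (prod_topology ?I ?N)"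
    then have zN: "fst z \<in> {0..1}" "snd z \<in> nbhd J" by auto
    show "\<exists>j. j \<in> {..s} \<and> z \<in> {0..1} \<times> (nbhd J \<inter> summand j) \<and> nbhd_homotopy J z = f j z"
    proof (cases "snd z")
      case None
      then show ?thesis using zN
        by (intro exI[of _ s]) (auto simp: summand_def nbhd_homotopy_def f_def mem_Times_iff)
    next
      case (Some ix)
      then obtain i x where ix: "snd z = Some (i, x)" "i < s" "x \<in> topspace (X i)" "x \<noteq> x0 i"
        using zN(2) by (auto simp: nbhd_def)
      then show ?thesis using zN
        by (intro exI[of _ i]) (auto simp: summand_def nbhd_homotopy_def f_def mem_Times_iff wedge_proj_def)
    qed
  qed simp
  moreover have "nbhd_homotopy J z \<in> nbhd J" if z: "fst z \<in> {0..1}" "snd z \<in> nbhd J" for z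
  proof (cases "snd z")
    case None
    then show ?thesis by (simp add: nbhd_homotopy_def nbhd_def)
  next
    case (Some ix)
    then obtain i x where ix: "snd z = Some (i, x)" "i < s" "x \<in> topspace (X i)" "x \<noteq> x0 i" "i \<in> J \<or> x \<in> U i"
      using z(2) by (auto simp: nbhd_def)
    show ?thesis
    proof (cases "i \<in> J")
      case True
      then show ?thesis using ix by (simp add: nbhd_homotopy_def nbhd_def)
    next
      case False
      then have "h i (fst z, x) \<in> U i" using contraction_closed[OF ix(2) z(1)] ix by simp
      then show ?thesis using ix False U_subset[OF ix(2)]
        by (auto simp: nbhd_homotopy_def nbhd_def wedge_incl_def)
    qed
  qed
  ultimately show ?thesis
    by (auto simp: continuous_map_in_subtopology simp del: topspace_subtopology)
qed

lemma nbhd_homotopy_0: "p \<in> nbhd J \<Longrightarrow> nbhd_homotopy J (0, p) = p"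
  using contraction by (auto simp: nbhd_homotopy_def nbhd_def pointed_contraction_def wedge_incl_def)

lemma nbhd_homotopy_1:
  "p \<in> nbhd J \<Longrightarrow> nbhd_homotopy J (1, p) = (case p of None \<Rightarrow> None | Some (i, x) \<Rightarrow> if i \<in> J then p else None)"
  using contraction by (auto simp: nbhd_homotopy_def nbhd_def pointed_contraction_def wedge_incl_def)

lemma nbhd_homotopic:
  assumes "\<And>p. p \<in> nbhd J \<Longrightarrow> g p = (case p of None \<Rightarrow> None | Some (i, x) \<Rightarrow> if i \<in> J then p else None)"
  shows "homotopic_with (\<lambda>_. True) (subtopology W (nbhd J)) (subtopology W (nbhd J)) id g"
  using nbhd_homotopy_continuous[of J] nbhd_homotopy_0 nbhd_homotopy_1 assms
  by (subst homotopic_with) (auto intro!: exI[of _ "nbhd_homotopy J"])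

lemma contractible_nbhd_empty: "contractible_space (subtopology W (nbhd {}))"
  unfolding contractible_space_def
  by (rule exI[of _ None], rule nbhd_homotopic) (auto split: option.splits)

lemma continuous_incl_nbhd:
  assumes "k < s" "k \<in> J"
  shows "continuous_map (X k) (subtopology W (nbhd J)) (\<iota> k)"
  using assms continuous_map_wedge_incl[of k s X x0]
  by (auto simp: continuous_map_in_subtopology nbhd_def wedge_incl_def)

lemma continuous_proj_nbhd: "k < s \<Longrightarrow> continuous_map (subtopology W (nbhd J)) (X k) (\<nu> k)"
  by (simp add: continuous_map_wedge_proj continuous_map_from_subtopology)

text \<open>The identity of \<open>nbhd J\<close> is homotopic to the map that collapses everything
  outside the summands in \<open>J\<close>, and after this collapse the projection to
  \<open>X k\<close> is constant.\<close>

lemma proj_trivial_outside: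
  assumes k: "k < s" "k \<notin> J" and p: "p \<noteq> 0"
    and c: "c \<in> carrier (homology_group p (subtopology W (nbhd J)))"
  shows "hom_induced p (subtopology W (nbhd J)) {} (X k) {} (\<nu> k) c = \<one>\<^bsub>homology_group p (X k)\<^esub>"
proof -
  let ?N = "subtopology W (nbhd J)"
  define g :: "(nat \<times> 'a) option \<Rightarrow> (nat \<times> 'a) option"
    where "g = (\<lambda>p. case p of None \<Rightarrow> None | Some (i, x) \<Rightarrow> if i \<in> J then p else None)"
  have hom: "homotopic_with (\<lambda>_. True) ?N ?N id g" by (rule nbhd_homotopic) (simp add: g_def)
  then have g: "continuous_map ?N ?N g" using homotopic_with_imp_continuous_maps by blast
  have "hom_induced p ?N {} (X k) {} (\<nu> k) c = hom_induced p ?N {} (X k) {} (\<nu> k) (hom_induced p ?N {} ?N {} g c)"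
    using homology_homotopy_empty[OF hom, of p] hom_induced_id[OF c] by metis
  also have "\<dots> = hom_induced p ?N {} (X k) {} (\<nu> k \<circ> g) c"
    using g continuous_proj_nbhd[OF k(1)] by (intro hom_induced_compose') auto
  also have "hom_induced p ?N {} (X k) {} (\<nu> k \<circ> g) = hom_induced p ?N {} (X k) {} (\<lambda>_. x0 k)"
    using k by (intro hom_induced_eq) (auto simp: g_def wedge_proj_def split: option.splits)
  finally show ?thesis using hom_induced_const[OF p base[OF k(1)]] by metis
qed

text \<open>Up to homotopy \<open>\<iota> k \<circ> \<nu> k\<close> is the identity of
  \<open>nbhd {k}\<close>, so \<open>\<nu> k\<close> has a left inverse in homology.\<close>

lemma proj_injective_single:
  assumes k: "k < s" and c: "c \<in> carrier (homology_group p (subtopology W (nbhd {k})))"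
    and triv: "hom_induced p (subtopology W (nbhd {k})) {} (X k) {} (\<nu> k) c = \<one>\<^bsub>homology_group p (X k)\<^esub>"
  shows "c = \<one>\<^bsub>homology_group p (subtopology W (nbhd {k}))\<^esub>"
proof -
  let ?N = "subtopology W (nbhd {k})"
  have hom: "homotopic_with (\<lambda>_. True) ?N ?N id (\<iota> k \<circ> \<nu> k)"
    by (rule nbhd_homotopic) (auto simp: nbhd_def wedge_proj_def wedge_incl_def split: if_splits)
  have "c = hom_induced p ?N {} ?N {} (\<iota> k \<circ> \<nu> k) c"
    using homology_homotopy_empty[OF hom, of p] hom_induced_id[OF c] by metis
  also have "\<dots> = hom_induced p (X k) {} ?N {} (\<iota> k) (hom_induced p ?N {} (X k) {} (\<nu> k) c)"
    using continuous_proj_nbhd[OF k] continuous_incl_nbhd[OF k, of "{k}"]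
    by (intro hom_induced_compose'[symmetric]) auto
  finally show ?thesis using triv group_hom.hom_one[OF hom_induced_group_hom] by metis
qed

lemma proj_incl_hom:
  assumes k: "k < s" and "J \<subseteq> J'"
  shows "hom_induced p (subtopology W (nbhd J')) {} (X k) {} (\<nu> k) (incl_hom p W (nbhd J) (nbhd J') c) =
    hom_induced p (subtopology W (nbhd J)) {} (X k) {} (\<nu> k) c"
proof -
  have "nbhd J \<subseteq> nbhd J'" using assms(2) by (auto simp: nbhd_def)
  then have "continuous_map (subtopology W (nbhd J)) (subtopology W (nbhd J')) id"
    by (auto simp: continuous_map_in_subtopology continuous_map_from_subtopology)
  then show ?thesis
    unfolding incl_hom_def using continuous_proj_nbhd[OF k] by (simp add: hom_induced_compose')
qed

text \<open>Mayer--Vietoris for \<open>nbhd J\<close> and \<open>nbhd {k}\<close> splits a class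
  into parts \<open>a\<close> and \<open>b\<close>. The projection to \<open>X k\<close> does not
  see \<open>a\<close>, so \<open>b\<close> vanishes first, and then the induction hypothesis
  applies to \<open>a\<close>.\<close>

lemma proj_injective_nbhd:
  assumes "finite J" "J \<subseteq> {..<s}" "p \<noteq> 0" "c \<in> carrier (homology_group p (subtopology W (nbhd J)))"
    and "\<And>k. k \<in> J \<Longrightarrow> hom_induced p (subtopology W (nbhd J)) {} (X k) {} (\<nu> k) c = \<one>\<^bsub>homology_group p (X k)\<^esub>"
  shows "c = \<one>\<^bsub>homology_group p (subtopology W (nbhd J))\<^esub>"
  using assms(1,2,4,5)
proof (induction J arbitrary: c rule: finite_induct)
  case empty
  then show ?case using contractible_homology_trivial[OF contractible_nbhd_empty assms(3)] by simp
next
  case (insert k J)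
  let ?K = "insert k J"
  let ?H = "\<lambda>J. homology_group p (subtopology W (nbhd J))"
  have k: "k < s" using insert.prems by simp
  have Un: "nbhd J \<union> nbhd {k} = nbhd ?K" by (auto simp: nbhd_def)
  have Int: "nbhd J \<inter> nbhd {k} = nbhd {}" using insert.hyps by (auto simp: nbhd_def)
  note o = openin_nbhd[of J] openin_nbhd[of "{k}"]
  define d where "d = mv_boundary p (subtopology W (nbhd ?K)) (nbhd J) (nbhd {k}) c"
  have mvs: "openin (subtopology W (nbhd ?K)) (nbhd J)" "openin (subtopology W (nbhd ?K)) (nbhd {k})"
      "nbhd J \<union> nbhd {k} = topspace (subtopology W (nbhd ?K))"
      "subtopology (subtopology W (nbhd ?K)) (nbhd J) = subtopology W (nbhd J)"
      "subtopology (subtopology W (nbhd ?K)) (nbhd {}) = subtopology W (nbhd {})"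
    using mv_setup[OF o] unfolding Un Int by auto
  have dc: "d \<in> carrier (homology_group (p - 1) (subtopology W (nbhd {})))"
    using hom_in_carrier[OF mv_boundary_hom[OF mvs(1-3)] insert.prems(2)]
    by (simp add: d_def Int mvs(5))
  have dJ: "hom_induced (p - 1) (subtopology W (nbhd {})) {} (subtopology W (nbhd J)) {} id d =
      \<one>\<^bsub>homology_group (p - 1) (subtopology W (nbhd J))\<^esub>"
    using mv_boundary_inclusion[OF mvs(1-3), of p c] by (simp add: d_def Int mvs(4,5))
  \<comment> \<open>Contractibility of the intersection does not suffice when \<open>p = 1\<close>,
    since degree 0 is not trivial. Instead the inclusion into \<open>nbhd J\<close> is injective in
    homology: followed by the constant map to \<open>None\<close> it is homotopic to the identity of
    \<open>nbhd {}\<close>.\<close>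
  have d1: "d = \<one>\<^bsub>homology_group (p - 1) (subtopology W (nbhd {}))\<^esub>"
  proof -
    let ?N = "subtopology W (nbhd {})" and ?M = "subtopology W (nbhd J)"
    have hom: "homotopic_with (\<lambda>_. True) ?N ?N id (\<lambda>_. None)"
      by (rule nbhd_homotopic) (auto split: option.splits)
    have None: "None \<in> topspace ?N" unfolding topspace_nbhd by (simp add: nbhd_def)
    have id: "continuous_map ?N ?M id"
      by (auto simp: continuous_map_in_subtopology continuous_map_from_subtopology nbhd_def)
    have "d = hom_induced (p - 1) ?N {} ?N {} ((\<lambda>_. None) \<circ> id) d"
      using homology_homotopy_empty[OF hom, of "p - 1"] hom_induced_id[OF dc] by (simp add: comp_def)
    also have "\<dots> = hom_induced (p - 1) ?M {} ?N {} (\<lambda>_. None) (hom_induced (p - 1) ?N {} ?M {} id d)"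
      using None id by (intro hom_induced_compose'[symmetric]) auto
    finally show ?thesis using dJ group_hom.hom_one[OF hom_induced_group_hom] by metis
  qed
  obtain a b where ab: "a \<in> carrier (?H J)" "b \<in> carrier (?H {k})"
    "c = incl_hom p W (nbhd J) (nbhd ?K) a \<otimes>\<^bsub>?H ?K\<^esub> incl_hom p W (nbhd {k}) (nbhd ?K) b"
    using mv_Un_kernel[OF o, of c p] insert.prems(2) d1 unfolding Un Int d_def by blast
  have split: "hom_induced p (subtopology W (nbhd ?K)) {} (X i) {} (\<nu> i) c =
      hom_induced p (subtopology W (nbhd J)) {} (X i) {} (\<nu> i) a \<otimes>\<^bsub>homology_group p (X i)\<^esub>
      hom_induced p (subtopology W (nbhd {k})) {} (X i) {} (\<nu> i) b" if "i < s" for i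
    unfolding ab(3)
    using proj_incl_hom[OF that subset_insertI, of p k J a] proj_incl_hom[OF that, of "{k}" ?K p b]
    by (simp add: group_hom.hom_mult[OF hom_induced_group_hom incl_hom_closed incl_hom_closed])
  have "hom_induced p (subtopology W (nbhd J)) {} (X k) {} (\<nu> k) a = \<one>\<^bsub>homology_group p (X k)\<^esub>"
    by (rule proj_trivial_outside[OF k insert.hyps(2) assms(3) ab(1)])
  then have "hom_induced p (subtopology W (nbhd {k})) {} (X k) {} (\<nu> k) b = \<one>\<^bsub>homology_group p (X k)\<^esub>"
    using split[OF k] insert.prems(3)[of k]
    by (simp add: group.is_monoid hom_induced_carrier)
  then have b: "b = \<one>\<^bsub>?H {k}\<^esub>" by (rule proj_injective_single[OF k ab(2)])
  have "a = \<one>\<^bsub>?H J\<^esub>"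
  proof (rule insert.IH)
    fix i assume i: "i \<in> J"
    then have "i < s" using insert.prems by auto
    then show "hom_induced p (subtopology W (nbhd J)) {} (X i) {} (\<nu> i) a = \<one>\<^bsub>homology_group p (X i)\<^esub>"
      using split[of i] insert.prems(3)[of i] i
      unfolding b group_hom.hom_one[OF hom_induced_group_hom]
      by (simp add: monoid.r_one group.is_monoid hom_induced_carrier)
  qed (use insert.prems ab in auto)
  then show ?case
    using ab(3) b by (simp add: group_hom.hom_one[OF incl_hom_group_hom] group.is_monoid monoid.l_one)
qed

lemma proj_injective:
  assumes "p \<noteq> 0" "c \<in> carrier (homology_group p W)"
    and "\<And>k. k < s \<Longrightarrow> hom_induced p W {} (X k) {} (\<nu> k) c = \<one>\<^bsub>homology_group p (X k)\<^esub>"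
  shows "c = \<one>\<^bsub>homology_group p W\<^esub>"
  using proj_injective_nbhd[of "{..<s}" p c] assms by (simp add: nbhd_full)

lemma path_connected_wedge:
  assumes "\<And>i. i < s \<Longrightarrow> path_connected_space (X i)"
  shows "path_connected_space W"
proof -
  \<comment> \<open>The member \<open>{None}\<close> is added so that the union is the whole wedge
    also for \<open>s = 0\<close>.\<close>
  have "path_connectedin W (\<Union>(insert {None} ((\<lambda>i. \<iota> i ` topspace (X i)) ` {..<s})))"
  proof (rule path_connectedin_Union)
    fix S assume "S \<in> insert {None} ((\<lambda>i. \<iota> i ` topspace (X i)) ` {..<s})"
    then consider "S = {None}" | i where "i < s" "S = \<iota> i ` topspace (X i)" by auto
    then show "path_connectedin W S"
    proof cases
      case 1
      then show ?thesis by (simp add: topspace_wedge wedge_carrier_def)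
    next
      case 2
      then show ?thesis
        using path_connectedin_continuous_map_image[OF continuous_map_wedge_incl[OF 2(1), of X x0],
            of "topspace (X i)"] assms
        by (simp add: path_connectedin_topspace)
    qed
  next
    have "None \<in> \<iota> i ` topspace (X i)" if "i < s" for i
      using base[OF that] by (force simp: wedge_incl_def)
    then show "\<Inter>(insert {None} ((\<lambda>i. \<iota> i ` topspace (X i)) ` {..<s})) \<noteq> {}" by auto
  qed
  moreover have "\<Union>(insert {None} ((\<lambda>i. \<iota> i ` topspace (X i)) ` {..<s})) = topspace W"
    using base by (force simp: topspace_wedge wedge_carrier_def wedge_incl_def)
  ultimately show ?thesis by (metis path_connectedin_topspace)
qed

end

section \<open>Lefschetz numbers and Dold coefficients\<close>

lemma moebius_prime_mult:
  assumes p: "prime p" and e: "e > 0"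
  shows "moebius (p * e) = (if p dvd e then 0 else - moebius e)"
proof (cases "p dvd e")
  case True
  then have "p ^ 2 dvd p * e" by (simp add: power2_eq_square)
  then have "\<not> squarefree (p * e)"
    using p by (meson not_prime_unit not_squarefreeI)
  then show ?thesis using True by (simp add: moebius_def)
next
  case False
  then have cop: "coprime p e" using p prime_imp_coprime by blast
  have "squarefree (p * e) \<longleftrightarrow> squarefree e"
    using squarefree_mult_coprime[OF cop squarefree_prime[OF p]] squarefree_multD(2) by blast
  moreover have "card (prime_factors (p * e)) = Suc (card (prime_factors e))"
  proof -
    have "prime_factors (p * e) = insert p (prime_factors e)"
      using p e by (simp add: prime_factors_product prime_prime_factors)
    moreover have "p \<notin> prime_factors e" using False by auto
    ultimately show ?thesis by simp
  qed
  ultimately show ?thesis using False p e by (simp add: moebius_def)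
qed

text \<open>With a fixed prime \<open>p\<close> dividing \<open>m\<close>, each divisor
  \<open>e\<close> prime to \<open>p\<close> is cancelled by \<open>p * e\<close>, and the remaining
  divisors \<open>p * e\<close> with \<open>p dvd e\<close> have value 0.\<close>

lemma sum_moebius_divisors:
  assumes m: "m > (1::nat)"
  shows "(\<Sum>d\<in>{d. d dvd m}. moebius d) = 0"
proof -
  obtain p where p: "prime p" "p dvd m" using m prime_factor_nat[of m] by auto
  define A where "A = {d. d dvd m \<and> \<not> p dvd d}"
  have fin: "finite {d. d dvd m}" using m by simp
  obtain k where k: "m = p * k" using p by auto
  have k0: "k > 0" using k m by (cases k) auto
  have p0: "p > 0" using p prime_gt_0_nat by blast
  have img: "{d. d dvd m \<and> p dvd d} = (*) p ` {e. e dvd k}"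
    using p0 by (auto simp: k image_iff elim!: dvdE)
  have A: "{e. e dvd k \<and> \<not> p dvd e} = A"
  proof -
    have "e dvd k" if "e dvd p * k" "\<not> p dvd e" for e
      using that p prime_imp_coprime coprime_commute coprime_dvd_mult_right_iff by metis
    then show ?thesis by (auto simp: A_def k)
  qed
  have "(\<Sum>d\<in>{d. d dvd m \<and> p dvd d}. moebius d) = (\<Sum>e\<in>{e. e dvd k}. moebius (p * e))"
    unfolding img using p0 by (subst sum.reindex) (auto simp: inj_on_def)
  also have "\<dots> = (\<Sum>e\<in>{e. e dvd k}. if p dvd e then 0 else - moebius e)"
    using k0 by (intro sum.cong refl moebius_prime_mult p(1)) (auto intro: dvd_pos_nat)
  also have "\<dots> = (\<Sum>e\<in>{e. e dvd k \<and> \<not> p dvd e}. - moebius e)"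
    using k0 by (intro sum.mono_neutral_cong_right) auto
  also have "\<dots> = - (\<Sum>e\<in>A. moebius e)" by (simp add: A sum_negf)
  finally have 1: "(\<Sum>d\<in>{d. d dvd m \<and> p dvd d}. moebius d) = - (\<Sum>e\<in>A. moebius e)" .
  have "(\<Sum>d\<in>{d. d dvd m}. moebius d) = (\<Sum>d\<in>{d. d dvd m \<and> p dvd d} \<union> A. moebius d)"
    by (rule sum.cong) (auto simp: A_def)
  also have "\<dots> = (\<Sum>d\<in>{d. d dvd m \<and> p dvd d}. moebius d) + (\<Sum>d\<in>A. moebius d)"
    using fin by (intro sum.union_disjoint) (auto simp: A_def intro: finite_subset[OF _ fin])
  finally show ?thesis using 1 by simp
qed

text \<open>The substitution \<open>d = m div r\<close> turns the coefficient into a multiple of the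
  divisor sum of the Moebius function.\<close>

lemma dold_const:
  assumes "m > 1"
  shows "dold (\<lambda>r. c) m = 0"
proof -
  have "(\<Sum>r\<in>{r. r dvd m}. moebius (m div r)) = (\<Sum>d\<in>{d. d dvd m}. moebius d)"
    using assms by (intro sum.reindex_bij_witness[of _ "\<lambda>d. m div d" "\<lambda>d. m div d"]) (auto elim!: dvdE)
  then have "(\<Sum>r\<in>{r. r dvd m}. of_int (moebius (m div r)) :: rat) = 0"
    using sum_moebius_divisors[OF assms] by (simp flip: of_int_sum)
  then show ?thesis by (simp add: dold_def flip: sum_distrib_right)
qed

lemma dold_one: "dold L 1 = L 1"
  by (simp add: dold_def moebius_def)

lemma dold_cong: "(\<And>r. r dvd m \<Longrightarrow> L r = L' r) \<Longrightarrow> dold L m = dold L' m"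
  by (simp add: dold_def)

lemma dold_add: "dold (\<lambda>r. L r + L' r) m = dold L m + dold L' m"
  by (simp add: dold_def sum.distrib algebra_simps)

lemma dold_sum: "dold (\<lambda>r. \<Sum>i\<in>I. L i r) m = (\<Sum>i\<in>I. dold (L i) m)"
  unfolding dold_def sum_distrib_left by (rule sum.swap)

section \<open>Cycles of the permutation\<close>

lemma orbit_card_dvd:
  assumes "\<sigma> permutes S" "finite S" and r: "(\<sigma> ^^ r) i = i"
  shows "card (orbit \<sigma> i) dvd r"
proof -
  have perm: "permutation \<sigma>" using assms permutation_permutes by blast
  have i: "i \<in> orbit \<sigma> i" by (rule permutation_self_in_orbit[OF perm])
  let ?d = "funpow_dist1 \<sigma> i i"
  have "card (orbit \<sigma> i) = ?d"
    using orbit_conv_funpow_dist1[OF i] card_image[OF inj_on_funpow_dist1[OF i]] by simp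
  moreover have d: "(\<sigma> ^^ ?d) i = i" by (rule funpow_dist1_prop[OF i])
  have "(\<sigma> ^^ (r mod ?d)) i = i" using funpow_mod_eq[OF d, of r] r by simp
  then have "r mod ?d = 0"
    using funpow_dist1_least[of "r mod ?d" \<sigma> i i] by (metis bot_nat_0.not_eq_extremum mod_less_divisor zero_less_Suc)
  ultimately show ?thesis by auto
qed

text \<open>The left-hand sum counts each cycle once, as a set. Grouping indices by their orbit
  matches both sides, since the indices with orbit \<open>\<Lambda>\<close> are exactly the members
  of \<open>\<Lambda>\<close>.\<close>

lemma sum_over_orbits:
  fixes g :: "nat \<Rightarrow> rat"
  assumes \<sigma>: "\<sigma> permutes {..<s}"
  shows "(\<Sum>\<Lambda>\<in>{orbit \<sigma> i | i. i < s}. (if card \<Lambda> dvd m then 1 else 0) * (\<Sum>i\<in>\<Lambda>. g i)) =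
    (\<Sum>i<s. if card (orbit \<sigma> i) dvd m then g i else 0)"
proof -
  have perm: "permutation \<sigma>" using assms permutation_permutes by blast
  have cyc: "cyclic_on \<sigma> (orbit \<sigma> j)" for j by (rule cyclic_on_orbit'[OF perm])
  have fib: "{i \<in> {..<s}. orbit \<sigma> i = \<Lambda>} = \<Lambda>" if "\<Lambda> \<in> orbit \<sigma> ` {..<s}" for \<Lambda>
    using that permutes_orbit_subset[OF \<sigma>] orbit_cyclic_eq3[OF cyc] permutation_self_in_orbit[OF perm] by blast
  have "(\<Sum>i<s. if card (orbit \<sigma> i) dvd m then g i else 0) =
    (\<Sum>\<Lambda>\<in>orbit \<sigma> ` {..<s}. \<Sum>i\<in>{i \<in> {..<s}. orbit \<sigma> i = \<Lambda>}. if card (orbit \<sigma> i) dvd m then g i else 0)"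
    by (rule sum.image_gen) simp
  also have "\<dots> = (\<Sum>\<Lambda>\<in>orbit \<sigma> ` {..<s}. (if card \<Lambda> dvd m then 1 else 0) * (\<Sum>i\<in>\<Lambda>. g i))"
  proof (rule sum.cong[OF refl])
    fix \<Lambda> assume L: "\<Lambda> \<in> orbit \<sigma> ` {..<s}"
    have "(\<Sum>i\<in>{i \<in> {..<s}. orbit \<sigma> i = \<Lambda>}. if card (orbit \<sigma> i) dvd m then g i else 0) =
      (\<Sum>i\<in>{i \<in> {..<s}. orbit \<sigma> i = \<Lambda>}. if card \<Lambda> dvd m then g i else 0)"
      by (rule sum.cong) auto
    then show "(\<Sum>i\<in>{i \<in> {..<s}. orbit \<sigma> i = \<Lambda>}. if card (orbit \<sigma> i) dvd m then g i else 0) =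
        (if card \<Lambda> dvd m then 1 else 0) * (\<Sum>i\<in>\<Lambda>. g i)"
      unfolding fib[OF L] by simp
  qed
  also have "orbit \<sigma> ` {..<s} = {orbit \<sigma> i | i. i < s}" by auto
  finally show ?thesis ..
qed

section \<open>Traces in a single degree\<close>

definition homology_trace :: "int \<Rightarrow> 'a topology \<Rightarrow> ('a \<Rightarrow> 'a) \<Rightarrow> rat" where
  "homology_trace p Y g = rat_trace (homology_group p Y) (hom_induced p Y {} Y {} g)"

lemma finite_homology_dual_basis:
  assumes "finite_homology Y"
  obtains r b \<phi> where "dual_basis (homology_group p Y) {..<r::nat} b \<phi>"
proof -
  interpret comm_group "homology_group p Y" by simp
  obtain b r where "rational_basis (homology_group p Y) b r"
    using assms rational_basis_exists unfolding finite_homology_def by meson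
  then show thesis using dual_basis_exists that by blast
qed

lemma dual_basis_imp_carrier: "dual_basis G I b \<phi> \<Longrightarrow> i \<in> I \<Longrightarrow> b i \<in> carrier G"
  by (simp add: dual_basis_def)

lemma homology_trace_dual_basis:
  assumes "dual_basis (homology_group p Y) I b \<phi>"
  shows "homology_trace p Y g = (\<Sum>i\<in>I. \<phi> i (hom_induced p Y {} Y {} g (b i)))"
  unfolding homology_trace_def
  by (rule comm_group.rat_trace_dual_basis[OF abelian_homology_group assms hom_induced_hom])

lemma homology_trace_trivial:
  assumes "carrier (homology_group p Y) = {\<one>\<^bsub>homology_group p Y\<^esub>}"
  shows "homology_trace p Y g = 0"
proof -
  interpret comm_group "homology_group p Y" by simp
  have "dual_basis (homology_group p Y) ({} :: nat set) (\<lambda>_. \<one>\<^bsub>homology_group p Y\<^esub>) (\<lambda>_ _. 0)"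
    using assms torsion_el_one by (simp add: dual_basis_def)
  then show ?thesis using homology_trace_dual_basis by fastforce
qed

lemma homology_trace_const:
  assumes "finite_homology Y" "p \<noteq> 0" "a \<in> topspace Y" "\<And>x. x \<in> topspace Y \<Longrightarrow> g x = a"
  shows "homology_trace p Y g = 0"
proof -
  interpret comm_group "homology_group p Y" by simp
  obtain r b \<phi> where D: "dual_basis (homology_group p Y) {..<r::nat} b \<phi>"
    using finite_homology_dual_basis[OF assms(1)] .
  have "hom_induced p Y {} Y {} g = hom_induced p Y {} Y {} (\<lambda>_. a)"
    using assms(4) by (rule hom_induced_eq)
  then have "hom_induced p Y {} Y {} g c = \<one>\<^bsub>homology_group p Y\<^esub>" for c
    using hom_induced_const[OF assms(2,3)] by metis
  then show ?thesis
    unfolding homology_trace_dual_basis[OF D]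
    by (intro sum.neutral ballI) (use D rat_functional_one in \<open>simp add: dual_basis_def\<close>)
qed

text \<open>Degree 0 of a path-connected space is infinite cyclic and generated by any point class,
  so it is enough that \<open>g\<close> fixes that class.\<close>

lemma homology_trace_0:
  assumes Y: "path_connected_space Y" "a \<in> topspace Y" and g: "continuous_map Y Y g"
  shows "homology_trace 0 Y g = 1"
proof -
  let ?H = "homology_group 0 Y" and ?q = "point_class Y a"
  interpret comm_group ?H by simp
  define \<phi> where "\<phi> x = (of_int (THE n. x = ?q [^]\<^bsub>?H\<^esub> (n::int)) :: rat)" for x
  have q: "?q \<in> carrier ?H" by (rule point_class_closed[OF Y(2)])
  have \<phi>q: "\<phi> (?q [^]\<^bsub>?H\<^esub> (n::int)) = of_int n" for n
  proof -
    have "(THE k. ?q [^]\<^bsub>?H\<^esub> n = ?q [^]\<^bsub>?H\<^esub> (k::int)) = n"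
      using point_class_pow_inj[OF Y] by (intro the_equality) auto
    then show ?thesis by (simp add: \<phi>_def)
  qed
  have \<phi>1: "\<phi> ?q = 1" using \<phi>q[of 1] q by simp
  have D: "dual_basis ?H {()} (\<lambda>_. ?q) (\<lambda>_. \<phi>)"
    unfolding dual_basis_def
  proof (intro conjI ballI impI)
    show "rat_functional ?H \<phi>"
      unfolding rat_functional_def
    proof (intro ballI)
      fix x y assume x: "x \<in> carrier ?H" and y: "y \<in> carrier ?H"
      obtain n m :: int where "x = ?q [^]\<^bsub>?H\<^esub> n" "y = ?q [^]\<^bsub>?H\<^esub> m"
        using homology_0_cases[OF Y x] homology_0_cases[OF Y y] by metis
      then show "\<phi> (x \<otimes>\<^bsub>?H\<^esub> y) = \<phi> x + \<phi> y"
        using q \<phi>q[of "n + m"] by (simp add: \<phi>q int_pow_mult)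
    qed
    fix x assume x: "x \<in> carrier ?H" and z: "\<forall>i\<in>{()}. \<phi> x = 0"
    obtain n :: int where n: "x = ?q [^]\<^bsub>?H\<^esub> n" using homology_0_cases[OF Y x] .
    then have "n = 0" using z \<phi>q by simp
    then show "torsion_el ?H x" using n torsion_el_one by simp
  qed (use q \<phi>1 in auto)
  have ga: "g a \<in> topspace Y" using g Y(2) by (auto simp: continuous_map_def)
  \<comment> \<open>All point classes coincide: the constant map sends the classes of
    \<open>g a\<close> and of \<open>a\<close> both to \<open>?q\<close>, which forces
    \<open>n = 1\<close>.\<close>
  obtain n :: int where n: "point_class Y (g a) = ?q [^]\<^bsub>?H\<^esub> n"
    using homology_0_cases[OF Y point_class_closed[OF ga]] .
  interpret c: group_hom ?H ?H "hom_induced 0 Y {} Y {} (\<lambda>_. a)" by (rule hom_induced_group_hom)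
  have const: "hom_induced 0 Y {} Y {} (\<lambda>_. a) (point_class Y y) = ?q" if "y \<in> topspace Y" for y
    using hom_induced_point_class[of Y Y "\<lambda>_. a" y] that Y(2) by simp
  have "?q = ?q [^]\<^bsub>?H\<^esub> n"
    using const[OF ga] const[OF Y(2)] c.hom_int_pow[OF q, of n] n by simp
  then have "n = 1" using point_class_pow_inj[OF Y, of 1 n] q by simp
  then have "hom_induced 0 Y {} Y {} g ?q = ?q"
    using hom_induced_point_class[OF g Y(2)] n q by simp
  then show ?thesis using homology_trace_dual_basis[OF D] \<phi>1 by simp
qed

text \<open>Replaces the set of degrees with nonzero trace, which depends on \<open>g\<close>, by a
  fixed range in which different maps and spaces can be compared degree by degree.\<close>

lemma lefschetz_eq_sum:
  assumes "\<And>k. k \<ge> D \<Longrightarrow> homology_trace (int k) Y g = 0"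
  shows "lefschetz Y g = (\<Sum>k<D. (-1) ^ k * homology_trace (int k) Y g)"
proof -
  have "{k::nat. homology_trace (int k) Y g \<noteq> 0} \<subseteq> {..<D}"
    using assms by (auto simp: not_le[symmetric])
  then show ?thesis
    unfolding lefschetz_def homology_trace_def[symmetric] by (intro sum.mono_neutral_left) auto
qed

lemma finite_homology_trace_bound:
  assumes "finite_homology Y"
  obtains D :: nat where "\<And>k g. k \<ge> D \<Longrightarrow> homology_trace (int k) Y g = 0"
proof -
  obtain D where D: "\<And>p. p \<ge> D \<Longrightarrow> carrier (homology_group p Y) = {\<one>\<^bsub>homology_group p Y\<^esub>}"
    using assms unfolding finite_homology_def by blast
  show thesis
  proof
    fix k :: nat and g :: "'a \<Rightarrow> 'a" assume "k \<ge> nat D"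
    then show "homology_trace (int k) Y g = 0" by (intro homology_trace_trivial D) simp
  qed
qed

lemma lefschetz_const:
  assumes Y: "finite_homology Y" "path_connected_space Y" "a \<in> topspace Y"
    and g: "\<And>x. x \<in> topspace Y \<Longrightarrow> g x = a"
  shows "lefschetz Y g = 1"
proof -
  have "lefschetz Y g = (\<Sum>k<1. (-1) ^ k * homology_trace (int k) Y g)"
    using homology_trace_const[OF Y(1) _ Y(3) g] by (intro lefschetz_eq_sum) simp
  moreover have "continuous_map Y Y g"
    by (rule continuous_map_eq[of Y Y "\<lambda>_. a"]) (simp_all add: g Y(3))
  ultimately show ?thesis using homology_trace_0[OF Y(2,3)] by simp
qed

section \<open>Lefschetz numbers of self-maps of the wedge\<close>

context contractible_wedge
begin

text \<open>The dual bases of the summands combine: vectors are pushed in by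
  \<open>\<iota> i\<close> and functionals are pulled back by \<open>\<nu> i\<close>. Duality holds
  because \<open>\<nu> j \<circ> \<iota> i\<close> is the identity or constant, and completeness is
  the joint injectivity of the projections. The diagonal entries are then those of the maps
  \<open>\<nu> i \<circ> g \<circ> \<iota> i\<close>.\<close>

lemma homology_trace_wedge:
  assumes p: "p \<noteq> 0" and fin: "\<And>i. i < s \<Longrightarrow> finite_homology (X i)" and g: "continuous_map W W g"
  shows "homology_trace p W g = (\<Sum>i<s. homology_trace p (X i) (\<lambda>x. \<nu> i (g (\<iota> i x))))"
proof -
  let ?H = "homology_group p W" and ?G = "\<lambda>i. homology_group p (X i)"
  let ?\<nu> = "\<lambda>i. hom_induced p W {} (X i) {} (\<nu> i)" and ?\<iota> = "\<lambda>i. hom_induced p (X i) {} W {} (\<iota> i)"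
  interpret H: comm_group ?H by simp
  have "\<forall>i. \<exists>r b \<phi>. i < s \<longrightarrow> dual_basis (?G i) {..<r::nat} b \<phi>"
    using finite_homology_dual_basis[OF fin] by metis
  then obtain r b \<phi> where D: "\<And>i. i < s \<Longrightarrow> dual_basis (?G i) {..<r i::nat} (b i) (\<phi> i)" by metis
  note c\<nu> = continuous_map_wedge_proj and c\<iota> = continuous_map_wedge_incl[of _ s X x0]
  have \<nu>\<iota>: "?\<nu> j (?\<iota> i c) = (if i = j then c else \<one>\<^bsub>?G j\<^esub>)"
    if ij: "i < s" "j < s" and c: "c \<in> carrier (?G i)" for i j c
  proof -
    have "?\<nu> j (?\<iota> i c) = hom_induced p (X i) {} (X j) {} (\<nu> j \<circ> \<iota> i) c"
      using c\<nu>[OF ij(2)] c\<iota>[OF ij(1)] by (intro hom_induced_compose') auto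
    also have "\<dots> = (if i = j then c else \<one>\<^bsub>?G j\<^esub>)"
    proof (cases "i = j")
      case True
      have "\<nu> j \<circ> \<iota> i = id" using True by (auto simp: wedge_proj_incl)
      then show ?thesis using True hom_induced_id[OF c] by simp
    next
      case False
      have "\<nu> j \<circ> \<iota> i = (\<lambda>_. x0 j)" using False by (auto simp: wedge_proj_incl)
      then show ?thesis using False hom_induced_const[OF p base[OF ij(2)]] by simp
    qed
    finally show ?thesis .
  qed
  define I where "I = (SIGMA i:{..<s}. {..<r i})"
  have "dual_basis ?H I (\<lambda>(i, k). ?\<iota> i (b i k)) (\<lambda>(i, k) c. \<phi> i k (?\<nu> i c))"
    unfolding dual_basis_def
  proof (intro conjI ballI impI)
    show "finite I" by (simp add: I_def)
    fix ik assume "ik \<in> I"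
    then obtain i k where ik: "ik = (i, k)" "i < s" "k < r i" by (auto simp: I_def)
    have f: "rat_functional (?G i) (\<phi> i k)" using D[OF ik(2)] ik(3) by (simp add: dual_basis_def)
    show "(case ik of (i, k) \<Rightarrow> ?\<iota> i (b i k)) \<in> carrier ?H" by (simp add: ik hom_induced_carrier)
    show "rat_functional ?H ((\<lambda>(i, k) c. \<phi> i k (?\<nu> i c)) ik)"
      using rat_functional_compose[OF f hom_induced_hom] by (simp add: ik)
    fix jl assume "jl \<in> I"
    then obtain j l where jl: "jl = (j, l)" "j < s" "l < r j" by (auto simp: I_def)
    have bc: "b j l \<in> carrier (?G j)" using dual_basis_imp_carrier[OF D[OF jl(2)]] jl(3) by simp
    show "(\<lambda>(i, k) c. \<phi> i k (?\<nu> i c)) ik (case jl of (i, k) \<Rightarrow> ?\<iota> i (b i k)) = of_bool (ik = jl)"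
    proof (cases "i = j")
      case True
      then show ?thesis using D[OF ik(2)] ik jl \<nu>\<iota>[OF jl(2) ik(2) bc] by (auto simp: dual_basis_def)
    next
      case False
      then show ?thesis using ik jl \<nu>\<iota>[OF jl(2) ik(2) bc]
          group.rat_functional_one[OF group_relative_homology_group f] by auto
    qed
  next
    fix c assume c: "c \<in> carrier ?H" and z: "\<forall>ik\<in>I. (\<lambda>(i, k) c. \<phi> i k (?\<nu> i c)) ik c = 0"
    have "\<exists>n::int. n \<noteq> 0 \<and> ?\<nu> i c [^]\<^bsub>?G i\<^esub> n = \<one>\<^bsub>?G i\<^esub>" if i: "i < s" for i
    proof -
      have "\<phi> i k (?\<nu> i c) = 0" if "k < r i" for k using z i that by (auto simp: I_def)
      then have "torsion_el (?G i) (?\<nu> i c)"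
        using D[OF i] hom_induced_carrier[of p W "{}" "X i" "{}" "\<nu> i" c] by (auto simp: dual_basis_def)
      then show ?thesis by (simp add: torsion_el_def)
    qed
    then obtain n :: "nat \<Rightarrow> int" where n: "\<And>i. i < s \<Longrightarrow> n i \<noteq> 0 \<and> ?\<nu> i c [^]\<^bsub>?G i\<^esub> n i = \<one>\<^bsub>?G i\<^esub>"
      by metis
    \<comment> \<open>Each projection of \<open>c\<close> is torsion with its own exponent; the
      product kills all of them at once, and joint injectivity then applies to this power of
      \<open>c\<close>.\<close>
    define N where "N = (\<Prod>i<s. n i)"
    have N0: "N \<noteq> 0" using n by (simp add: N_def)
    have "c [^]\<^bsub>?H\<^esub> N = \<one>\<^bsub>?H\<^esub>"
    proof (rule proj_injective[OF p])
      show "c [^]\<^bsub>?H\<^esub> N \<in> carrier ?H" using c by simp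
      fix i assume i: "i < s"
      interpret v: group_hom ?H "?G i" "?\<nu> i" by (rule hom_induced_group_hom)
      obtain M where M: "N = n i * M"
        unfolding N_def using i by (metis dvdE dvd_prodI finite_lessThan lessThan_iff)
      have "?\<nu> i (c [^]\<^bsub>?H\<^esub> N) = (?\<nu> i c [^]\<^bsub>?G i\<^esub> n i) [^]\<^bsub>?G i\<^esub> M"
        using c by (simp add: v.hom_int_pow M v.H.int_pow_pow)
      then show "?\<nu> i (c [^]\<^bsub>?H\<^esub> N) = \<one>\<^bsub>?G i\<^esub>" using n[OF i] by simp
    qed
    then show "torsion_el ?H c" using c N0 by (auto simp: torsion_el_def)
  qed
  then have "homology_trace p W g =
      (\<Sum>ik\<in>I. (\<lambda>(i, k) c. \<phi> i k (?\<nu> i c)) ik (hom_induced p W {} W {} g (case ik of (i, k) \<Rightarrow> ?\<iota> i (b i k))))"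
    by (rule homology_trace_dual_basis)
  also have "\<dots> = (\<Sum>i<s. \<Sum>k<r i. \<phi> i k (?\<nu> i (hom_induced p W {} W {} g (?\<iota> i (b i k)))))"
    unfolding I_def by (subst sum.Sigma) (auto intro!: sum.cong)
  also have "\<dots> = (\<Sum>i<s. homology_trace p (X i) (\<lambda>x. \<nu> i (g (\<iota> i x))))"
  proof (rule sum.cong[OF refl])
    fix i assume "i \<in> {..<s}"
    then have i: "i < s" by simp
    have "?\<nu> i (hom_induced p W {} W {} g (?\<iota> i c)) = hom_induced p (X i) {} (X i) {} (\<nu> i \<circ> (g \<circ> \<iota> i)) c" for c
      using c\<nu>[OF i] c\<iota>[OF i] g continuous_map_compose[OF c\<iota>[OF i] g] by (simp add: hom_induced_compose')
    then show "(\<Sum>k<r i. \<phi> i k (?\<nu> i (hom_induced p W {} W {} g (?\<iota> i (b i k))))) =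
        homology_trace p (X i) (\<lambda>x. \<nu> i (g (\<iota> i x)))"
      unfolding homology_trace_dual_basis[OF D[OF i]] by (simp add: comp_def)
  qed
  finally show ?thesis .
qed

text \<open>In every nonzero degree the traces add up. In degree 0 the wedge and each summand have
  trace 1, so this degree is split off on both sides.\<close>

lemma lefschetz_wedge:
  assumes fin: "\<And>i. i < s \<Longrightarrow> finite_homology (X i)" and pc: "\<And>i. i < s \<Longrightarrow> path_connected_space (X i)"
    and g: "continuous_map W W g"
  shows "lefschetz W g = 1 + (\<Sum>i<s. lefschetz (X i) (\<lambda>x. \<nu> i (g (\<iota> i x))) - 1)"
proof -
  let ?g = "\<lambda>i x. \<nu> i (g (\<iota> i x))"
  have "\<forall>i. \<exists>D::nat. i < s \<longrightarrow> (\<forall>k\<ge>D. \<forall>g. homology_trace (int k) (X i) g = 0)"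
    using finite_homology_trace_bound[OF fin] by metis
  then obtain D :: "nat \<Rightarrow> nat" where D: "\<And>i k g. i < s \<Longrightarrow> k \<ge> D i \<Longrightarrow> homology_trace (int k) (X i) g = 0"
    by metis
  \<comment> \<open>The sum dominates every \<open>D i\<close>; the successor makes \<open>M\<close>
    positive, so that degree 0 lies in the range and every \<open>k \<ge> M\<close> is a nonzero
    degree.\<close>
  define M where "M = Suc (\<Sum>i<s. D i)"
  have DM: "D i \<le> M" if "i < s" for i
    using member_le_sum[of i "{..<s}" D] that by (simp add: M_def)
  have L: "lefschetz (X i) h = (\<Sum>k<M. (-1) ^ k * homology_trace (int k) (X i) h)" if "i < s" for i h
    using D[OF that] DM[OF that] by (intro lefschetz_eq_sum) simp
  have M0: "{..<M} = insert 0 {1..<M}" by (auto simp: M_def)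
  have tr0: "homology_trace 0 (X i) (?g i) = 1" if i: "i < s" for i
  proof (rule homology_trace_0[OF pc[OF i] base[OF i]])
    show "continuous_map (X i) (X i) (?g i)"
      using continuous_map_compose[OF continuous_map_compose[OF continuous_map_wedge_incl[OF i] g]
          continuous_map_wedge_proj[OF i]] by (simp add: comp_def)
  qed
  have Li: "lefschetz (X i) (?g i) - 1 = (\<Sum>k=1..<M. (-1) ^ k * homology_trace (int k) (X i) (?g i))" if "i < s" for i
    using L[OF that] tr0[OF that] by (simp add: M0)
  have "lefschetz W g = (\<Sum>k<M. (-1) ^ k * homology_trace (int k) W g)"
  proof (rule lefschetz_eq_sum)
    fix k assume k: "k \<ge> M"
    then have "homology_trace (int k) W g = (\<Sum>i<s. homology_trace (int k) (X i) (?g i))"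
      by (intro homology_trace_wedge fin g) (simp add: M_def)
    also have "\<dots> = 0" using k DM D by (intro sum.neutral) (meson le_trans lessThan_iff)
    finally show "homology_trace (int k) W g = 0" .
  qed
  also have "\<dots> = homology_trace 0 W g + (\<Sum>k=1..<M. (-1) ^ k * homology_trace (int k) W g)"
    by (simp add: M0)
  also have "homology_trace 0 W g = 1"
    using path_connected_wedge[OF pc] g
    by (intro homology_trace_0[where a = None]) (auto simp: topspace_wedge wedge_carrier_def)
  also have "(\<Sum>k=1..<M. (-1) ^ k * homology_trace (int k) W g) =
      (\<Sum>k=1..<M. \<Sum>i<s. (-1) ^ k * homology_trace (int k) (X i) (?g i))"
    unfolding sum_distrib_left[symmetric]
    by (intro sum.cong refl) (simp add: homology_trace_wedge[OF _ fin g])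
  also have "\<dots> = (\<Sum>i<s. lefschetz (X i) (?g i) - 1)"
    by (subst sum.swap) (simp add: Li)
  finally show ?thesis .
qed

text \<open>If \<open>f p\<close> is not the base point, it lies in exactly one summand
  \<open>k\<close>, and its coordinate there is not the base point; by permutativity
  \<open>k\<close> can only be \<open>\<sigma> j\<close>.\<close>

lemma permutative_summand:
  assumes cont: "continuous_map W W f" and "f None = None" and perm: "permutative X x0 s f \<sigma>"
    and p: "p \<in> summand j" "j < s"
  shows "f p \<in> summand (\<sigma> j)"
proof -
  have pj: "p = \<iota> j (\<nu> j p)" "\<nu> j p \<in> topspace (X j)"
    using p base[OF p(2)] by (auto simp: summand_def wedge_incl_def wedge_proj_def)
  have "p \<in> topspace W" using p closedin_summand closedin_subset by blast
  then have fp: "f p \<in> topspace W" using cont by (auto simp: continuous_map_def)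
  show ?thesis
  proof (cases "f p")
    case None
    then show ?thesis by (simp add: summand_def)
  next
    case (Some ky)
    then obtain k y where ky: "f p = Some (k, y)" "k < s" "y \<in> topspace (X k)" "y \<noteq> x0 k"
      using fp by (auto simp: topspace_wedge wedge_carrier_def)
    have "\<nu> k (f p) = y" using ky(1) by (simp add: wedge_proj_def)
    then have "wedge_coord x0 f 1 j k (\<nu> j p) = y" using pj by (simp add: wedge_coord_def)
    then have "k = \<sigma> j" using perm pj ky p(2) unfolding permutative_def by metis
    then show ?thesis using ky by (simp add: summand_def)
  qed
qed

text \<open>The iterate moves summand \<open>i\<close> into the summand with index
  \<open>(\<sigma> ^^ r) i\<close>, and a summand other than \<open>i\<close> is collapsed by
  \<open>\<nu> i\<close>.\<close>

lemma permutative_coord_const: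
  assumes cont: "continuous_map W W f" and f0: "f None = None" and perm: "permutative X x0 s f \<sigma>"
    and i: "i < s" "(\<sigma> ^^ r) i \<noteq> i" and x: "x \<in> topspace (X i)"
  shows "wedge_coord x0 f r i i x = x0 i"
proof -
  have \<sigma>: "\<sigma> permutes {..<s}" using perm by (simp add: permutative_def)
  have lt: "(\<sigma> ^^ n) i < s" for n
    using i(1) permutes_in_image[OF \<sigma>] by (induction n) auto
  have "(f ^^ n) (\<iota> i x) \<in> summand ((\<sigma> ^^ n) i)" for n
  proof (induction n)
    case 0
    then show ?case using i x by (simp add: summand_def wedge_incl_def)
  next
    case (Suc n)
    then show ?case using permutative_summand[OF cont f0 perm Suc lt] by simp
  qed
  from this[of r] i(2) show ?thesis
    by (auto simp: wedge_coord_def summand_def wedge_proj_def)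
qed

end

theorem theorem2:
  fixes X :: "nat \<Rightarrow> 'a topology" and x0 :: "nat \<Rightarrow> 'a" and s :: nat
    and f :: "(nat \<times> 'a) option \<Rightarrow> (nat \<times> 'a) option" and \<sigma> :: "nat \<Rightarrow> nat"
  assumes spaces: "\<forall>i<s. top_manifold (X i) \<and> compact_space (X i) \<and>
                         path_connected_space (X i) \<and> x0 i \<in> topspace (X i)"
    and cont: "continuous_map (wedge X x0 s) (wedge X x0 s) f"
    and pointed: "f None = None"
    and perm: "permutative X x0 s f \<sigma>"
    and blocks: "squared_by_blocks X s \<sigma>"
  shows "(\<forall>m::nat. m > 1 \<longrightarrow>
            dold (\<lambda>r. lefschetz (wedge X x0 s) (f ^^ r)) m =
            (\<Sum>\<Lambda>\<in>{orbit \<sigma> i | i. i < s}.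
               (if card \<Lambda> dvd m then 1 else 0) *
               (\<Sum>i\<in>\<Lambda>. dold (\<lambda>r. lefschetz (X i) (wedge_coord x0 f r i i)) m)))
       \<and> dold (\<lambda>r. lefschetz (wedge X x0 s) (f ^^ r)) 1 = lefschetz (wedge X x0 s) f"
proof (intro conjI allI impI)
  show "dold (\<lambda>r. lefschetz (wedge X x0 s) (f ^^ r)) 1 = lefschetz (wedge X x0 s) f"
    by (subst dold_one) (simp only: funpow_0 funpow.simps o_id One_nat_def)
  fix m :: nat assume m: "m > 1"
  have "\<forall>i. \<exists>U h. i < s \<longrightarrow> pointed_contraction (X i) (x0 i) U h"
    using spaces manifold_pointed_contraction by metis
  then obtain U h where "\<And>i. i < s \<Longrightarrow> pointed_contraction (X i) (x0 i) (U i) (h i)" by metis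
  moreover have "t1_space (X i)" if "i < s" for i
    using spaces that by (simp add: top_manifold_def Hausdorff_imp_t1_space)
  ultimately interpret contractible_wedge X x0 s U h by unfold_locales
  have fin: "finite_homology (X i)" and pc: "path_connected_space (X i)" if "i < s" for i
    using spaces that compact_manifold_finite_homology by auto
  have \<sigma>: "\<sigma> permutes {..<s}" using perm by (simp add: permutative_def)
  have iter: "continuous_map W W (f ^^ r)" for r
  proof (induction r)
    case (Suc r)
    then show ?case using continuous_map_compose[OF Suc cont] by (simp add: comp_def)
  qed simp
  let ?L = "\<lambda>i r. lefschetz (X i) (wedge_coord x0 f r i i)"
  have "lefschetz W (f ^^ r) = 1 + (\<Sum>i<s. ?L i r - 1)" for r
    using lefschetz_wedge[OF fin pc iter] by (simp add: wedge_coord_def[abs_def])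
  \<comment> \<open>The part \<open>1 - of_nat s\<close> does not depend on \<open>r\<close>, so its
    Dold coefficient at \<open>m > 1\<close> is zero.\<close>
  then have "lefschetz W (f ^^ r) = (1 - of_nat s) + (\<Sum>i<s. ?L i r)" for r
    by (simp add: sum_subtractf)
  then have "dold (\<lambda>r. lefschetz W (f ^^ r)) m = (\<Sum>i<s. dold (?L i) m)"
    using dold_const[OF m] by (simp add: dold_add dold_sum)
  also have "\<dots> = (\<Sum>i<s. if card (orbit \<sigma> i) dvd m then dold (?L i) m else 0)"
  proof (rule sum.cong[OF refl])
    fix i assume "i \<in> {..<s}"
    then have i: "i < s" by simp
    have "dold (?L i) m = 0" if nd: "\<not> card (orbit \<sigma> i) dvd m"
    proof -
      \<comment> \<open>A cycle length that does not divide \<open>m\<close> divides no divisor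
        \<open>r\<close> of \<open>m\<close>. Hence \<open>i\<close> is not fixed by
        \<open>\<sigma> ^^ r\<close>, and the coordinate map is constant.\<close>
      have "?L i r = 1" if "r dvd m" for r
      proof (rule lefschetz_const[OF fin[OF i] pc[OF i] base[OF i]])
        have "(\<sigma> ^^ r) i \<noteq> i"
          using orbit_card_dvd[OF \<sigma>, of r i] nd that dvd_trans by blast
        then show "wedge_coord x0 f r i i x = x0 i" if "x \<in> topspace (X i)" for x
          using permutative_coord_const[OF cont pointed perm i _ that] by simp
      qed
      then have "dold (?L i) m = dold (\<lambda>r. 1) m" by (rule dold_cong)
      then show ?thesis using dold_const[OF m] by simp
    qed
    then show "dold (?L i) m = (if card (orbit \<sigma> i) dvd m then dold (?L i) m else 0)" by simp
  qed
  also have "\<dots> = (\<Sum>\<Lambda>\<in>{orbit \<sigma> i | i. i < s}. (if card \<Lambda> dvd m then 1 else 0) * (\<Sum>i\<in>\<Lambda>. dold (?L i) m))"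
    by (rule sum_over_orbits[OF \<sigma>, symmetric])
  finally show "dold (\<lambda>r. lefschetz (wedge X x0 s) (f ^^ r)) m =
            (\<Sum>\<Lambda>\<in>{orbit \<sigma> i | i. i < s}.
               (if card \<Lambda> dvd m then 1 else 0) *
               (\<Sum>i\<in>\<Lambda>. dold (\<lambda>r. lefschetz (X i) (wedge_coord x0 f r i i)) m))" .
qed

end
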